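(* Let $\alpha>0$, $\delta=1/\alpha$, $\beta\le 1$, $\gamma\in(0,1)$, $\hat\beta>0$, $\hat\gamma\in(0,1)$, and let $X$ be the hypergeometric Lévy process with parameters $(\beta,\gamma,\hat\beta,\hat\gamma)$ and lifetime $\zeta$. Let $I(\alpha,X)=\int_0^{\zeta}e^{-\alpha X_t}\,dt$ and let $\mathcal M(s)=\mathbb E[I(\alpha,X)^{s-1}]$ be its Mellin transform. Then $$\mathcal M(s)\equiv\Gamma(s)M(s)\qquad\text{for all } s\in\mathbb C,$$ where $$M(s)=C\,\frac{G((1-\beta)\delta+s;\delta)}{G((1-\beta+\gamma)\delta+s;\delta)}\,\frac{G((\hat\beta+\hat\gamma)\delta+1-s;\delta)}{G(\hat\beta\delta+1-s;\delta)}$$ and the constant $C$ is such that $M(1)=1$.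
   Context: The hypergeometric Lévy process $X$ is the (possibly killed) Lévy process started at $0$ with Laplace exponent $\psi(z)=\ln\mathbb E[e^{zX_1}]=-\frac{\Gamma(1-\beta+\gamma-z)}{\Gamma(1-\beta-z)}\frac{\Gamma(\hat\beta+\hat\gamma+z)}{\Gamma(\hat\beta+z)}$. If $\beta<1$ it is killed at rate $-\psi(0)>0$; if $\beta=1$ then $\zeta=+\infty$ and $X$ drifts to $+\infty$. The expectation $\mathbb E[I(\alpha,X)^{s-1}]$ is finite for $0<\mathrm{Re}(s)<1+\hat\beta\delta$; outside this strip $\mathcal M$ denotes its meromorphic continuation, so the claim means that $\mathbb E[I(\alpha,X)^{s-1}]=\Gamma(s)M(s)$ in the strip and that $\Gamma(s)M(s)$ is the meromorphic continuation to $\mathbb C$. For $\tau>0$, $G(z;\tau)$ is the Barnes double gamma function: the entire function $$G(z;\tau)=\frac z\tau e^{a\frac z\tau+b\frac{z^2}{2\tau}}\prod_{m\ge0}\prod_{n\ge0}{}^{'}\Big(1+\frac{z}{m\tau+n}\Big)e^{-\frac{z}{m\tau+n}+\frac{z^2}{2(m\tau+n)^2}}$$ (prime: the factor $m=n=0$ is omitted), with the constants $a=a(\tau),b=b(\tau)$ chosen so that $G(1;\tau)=1$, $G(z+1;\tau)=\Gamma(z/\tau)G(z;\tau)$ and $G(z+\tau;\tau)=(2\pi)^{(\tau-1)/2}\tau^{-z+1/2}\Gamma(z)G(z;\tau)$. *)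

theory Defs
  imports "HOL-Probability.Probability" "HOL-Complex_Analysis.Complex_Analysis"
begin

section \<open>Killed Levy processes\<close>

text \<open>Stochastic processes are families \<open>X t \<omega>\<close> indexed by \<open>real\<close>, of which only the
  times \<open>t \<ge> 0\<close> are used.\<close>

definition levy_process :: "'a measure \<Rightarrow> (real \<Rightarrow> 'a \<Rightarrow> real) \<Rightarrow> bool" where
  "levy_process M Y \<longleftrightarrow>
     prob_space M \<and>
     (\<forall>t\<ge>0. Y t \<in> borel_measurable M) \<and>
     (AE \<omega> in M. Y 0 \<omega> = 0) \<and>
     (\<forall>(n::nat) t. 0 \<le> t 0 \<longrightarrow> (\<forall>i<n. t i \<le> t (Suc i)) \<longrightarrow>
        prob_space.indep_vars M (\<lambda>_. borel) (\<lambda>i \<omega>. Y (t (Suc i)) \<omega> - Y (t i) \<omega>) {..<n}) \<and>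
     (\<forall>s\<ge>0. \<forall>h\<ge>0. distr M borel (\<lambda>\<omega>. Y (s + h) \<omega> - Y s \<omega>) = distr M borel (Y h)) \<and>
     (\<forall>\<omega>\<in>space M.
        (\<forall>t\<ge>0. ((\<lambda>s. Y s \<omega>) \<longlongrightarrow> Y t \<omega>) (at_right t)) \<and>
        (\<forall>t>0. \<exists>l. ((\<lambda>s. Y s \<omega>) \<longlongrightarrow> l) (at_left t)))"

text \<open>A (possibly) killed Levy process with lifetime \<open>\<zeta>\<close>: a Levy process \<open>Y\<close> killed at a time
  \<open>\<zeta>\<close> that is independent of the whole process \<open>Y\<close> and exponentially distributed with rate \<open>q\<close>;
  for \<open>q = 0\<close> the condition below says that \<open>\<zeta> = \<infinity>\<close> almost surely. There is no explicit cemetery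
  state: the values \<open>X t \<omega>\<close> with \<open>t \<ge> \<zeta> \<omega>\<close> are unconstrained and never used.\<close>

definition killed_levy_process ::
    "'a measure \<Rightarrow> (real \<Rightarrow> 'a \<Rightarrow> real) \<Rightarrow> ('a \<Rightarrow> ennreal) \<Rightarrow> bool" where
  "killed_levy_process M X \<zeta> \<longleftrightarrow>
     (\<exists>Y q. levy_process M Y \<and> (0::real) \<le> q \<and>
        \<zeta> \<in> borel_measurable M \<and>
        (\<forall>t\<ge>0. measure M {\<omega> \<in> space M. ennreal t < \<zeta> \<omega>} = exp (- q * t)) \<and>
        prob_space.indep_set M
          (sets (vimage_algebra (space M) (\<lambda>\<omega>. \<lambda>t\<in>{0..}. Y t \<omega>) (Pi\<^sub>M {0..} (\<lambda>_. borel))))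
          (sets (vimage_algebra (space M) \<zeta> borel)) \<and>
        (\<forall>\<omega>\<in>space M. \<forall>t\<ge>0. ennreal t < \<zeta> \<omega> \<longrightarrow> X t \<omega> = Y t \<omega>))"

text \<open>\<open>ln E[exp (z X\<^sub>1)] = \<psi> z\<close> for \<open>z\<close> in \<open>S\<close>, with the usual convention that \<open>exp (z X\<^sub>1)\<close>
  vanishes once the process has been killed.\<close>

definition has_laplace_exponent ::
    "'a measure \<Rightarrow> (real \<Rightarrow> 'a \<Rightarrow> real) \<Rightarrow> ('a \<Rightarrow> ennreal) \<Rightarrow> (complex \<Rightarrow> complex) \<Rightarrow> complex set \<Rightarrow> bool"
  where
  "has_laplace_exponent M X \<zeta> \<psi> S \<longleftrightarrow>
     (\<forall>z\<in>S. has_bochner_integral M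
        (\<lambda>\<omega>. if 1 < \<zeta> \<omega> then exp (z * complex_of_real (X 1 \<omega>)) else 0) (exp (\<psi> z)))"

section \<open>Hypergeometric Levy processes\<close>

text \<open>The library's \<open>rGamma\<close> is the entire function \<open>1 / Gamma\<close>, so the quotients have their
  correct value 0 at the poles of the denominators (in particular at \<open>z = 0\<close> when \<open>\<beta> = 1\<close>).
  The primed parameters are the hatted ones of the usual notation.\<close>

definition hypergeometric_exponent :: "real \<Rightarrow> real \<Rightarrow> real \<Rightarrow> real \<Rightarrow> complex \<Rightarrow> complex" where
  "hypergeometric_exponent \<beta> \<gamma> \<beta>' \<gamma>' z =
     - (Gamma (of_real (1 - \<beta> + \<gamma>) - z) * rGamma (of_real (1 - \<beta>) - z))
     * (Gamma (of_real (\<beta>' + \<gamma>') + z) * rGamma (of_real \<beta>' + z))"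

text \<open>The strip is the maximal vertical strip around the imaginary axis on which the exponent is
  holomorphic, bounded by the first poles of the two numerators; it is the set of \<open>z\<close> for
  which \<open>E[exp (z X\<^sub>1)]\<close> converges.\<close>

definition hypergeometric_levy_process ::
    "'a measure \<Rightarrow> (real \<Rightarrow> 'a \<Rightarrow> real) \<Rightarrow> ('a \<Rightarrow> ennreal) \<Rightarrow> real \<Rightarrow> real \<Rightarrow> real \<Rightarrow> real \<Rightarrow> bool" where
  "hypergeometric_levy_process M X \<zeta> \<beta> \<gamma> \<beta>' \<gamma>' \<longleftrightarrow>
     killed_levy_process M X \<zeta> \<and>
     has_laplace_exponent M X \<zeta> (hypergeometric_exponent \<beta> \<gamma> \<beta>' \<gamma>')
       {z. - (\<beta>' + \<gamma>') < Re z \<and> Re z < 1 - \<beta> + \<gamma>}"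

definition exp_functional ::
    "real \<Rightarrow> (real \<Rightarrow> 'a \<Rightarrow> real) \<Rightarrow> ('a \<Rightarrow> ennreal) \<Rightarrow> 'a \<Rightarrow> ennreal" where
  "exp_functional \<alpha> X \<zeta> \<omega> =
     (\<integral>\<^sup>+t\<in>{t. 0 \<le> t \<and> ennreal t < \<zeta> \<omega>}. ennreal (exp (- \<alpha> * X t \<omega>)) \<partial>lborel)"

section \<open>The Barnes double gamma function\<close>

definition barnes_product :: "real \<Rightarrow> real \<Rightarrow> real \<Rightarrow> complex \<Rightarrow> complex" where
  "barnes_product a b \<tau> z =
     z / of_real \<tau> * exp (of_real a * (z / of_real \<tau>) + of_real b * (z\<^sup>2 / (2 * of_real \<tau>))) *
     (\<Prod>m. \<Prod>n. if m = 0 \<and> n = 0 then 1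
        else (let w = z / of_real (real m * \<tau> + real n) in (1 + w) * exp (- w + w\<^sup>2 / 2)))"

text \<open>In the functional equations the poles of the Gamma factors are excluded. The constants
  \<open>a(\<tau>)\<close> and \<open>b(\<tau>)\<close> are real; over the complex numbers the normalization would not determine
  the function (for \<open>\<tau> = 1\<close>, say, \<open>a\<close> could be shifted by \<open>2 * pi * \<i>\<close>).\<close>

definition barnes_constants :: "real \<Rightarrow> real \<Rightarrow> real \<Rightarrow> bool" where
  "barnes_constants \<tau> a b \<longleftrightarrow>
     (let G = barnes_product a b \<tau> in
        G 1 = 1 \<and>
        (\<forall>z. z / of_real \<tau> \<notin> \<int>\<^sub>\<le>\<^sub>0 \<longrightarrow> G (z + 1) = Gamma (z / of_real \<tau>) * G z) \<and>
        (\<forall>z. z \<notin> \<int>\<^sub>\<le>\<^sub>0 \<longrightarrow>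
           G (z + of_real \<tau>) =
             of_real ((2 * pi) powr ((\<tau> - 1) / 2)) * of_real \<tau> powr (1 / 2 - z) * Gamma z * G z))"

definition double_gamma :: "complex \<Rightarrow> real \<Rightarrow> complex" where
  "double_gamma z \<tau> =
     (let (a, b) = (SOME (a, b). barnes_constants \<tau> a b) in barnes_product a b \<tau> z)"

definition mellin_M :: "complex \<Rightarrow> real \<Rightarrow> real \<Rightarrow> real \<Rightarrow> real \<Rightarrow> real \<Rightarrow> complex \<Rightarrow> complex" where
  "mellin_M C \<delta> \<beta> \<gamma> \<beta>' \<gamma>' s =
     C * (double_gamma (of_real ((1 - \<beta>) * \<delta>) + s) \<delta>
           / double_gamma (of_real ((1 - \<beta> + \<gamma>) * \<delta>) + s) \<delta>)
       * (double_gamma (of_real ((\<beta>' + \<gamma>') * \<delta>) + 1 - s) \<delta>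
           / double_gamma (of_real (\<beta>' * \<delta>) + 1 - s) \<delta>)"

end

theory Submission
  imports Defs
begin

text \<open>Write \<open>I\<close> for the exponential functional and \<open>\<psi>\<close> for the Laplace exponent. The Markov property at
  time \<open>u\<close> applied to \<open>I\<^sup>s = s \<integral> f(u) (\<integral>\<^sub>u\<^sup>\<infinity> f)\<^sup>s\<^sup>-\<^sup>1 du\<close> with \<open>f u = exp (- \<alpha> X\<^sub>u)\<close> yields the recurrence
  \<open>E[I\<^sup>s] = s / (- \<psi> (- \<alpha> s)) E[I\<^sup>s\<^sup>-\<^sup>1]\<close> for \<open>0 < s < \<beta>' \<delta>\<close>, and with it finiteness of all the moments
  involved once those of small positive order are known to be finite; the latter follows from a maximal
  inequality. By the functional equation \<open>G (z + 1) = \<Gamma> (z / \<delta>) G z\<close>, the function \<open>\<Gamma> s * M s\<close> satisfies the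
  same recurrence, so its quotient with the Mellin transform has period 1. The Mellin transform is bounded
  on vertical lines, and \<open>\<Gamma> s * M s\<close> decays no faster than \<open>exp (- 3 \<pi> \<bar>Im s\<bar> / 2)\<close>: each factor of the Weierstrass
  product of \<open>G\<close> is monotone along vertical lines in a way that allows comparing \<open>G\<close>-quotients with
  \<open>\<Gamma>\<close>-values. A 1-periodic function of growth less than \<open>exp (2 \<pi> \<bar>Im s\<bar>)\<close> is constant.

  The constants \<open>a\<close>, \<open>b\<close> of \<open>G\<close> exist because both shifts of the logarithm of the product are, up to
  \<open>ln \<Gamma>\<close>, affine functions on the positive half-line.\<close>

section \<open>The Barnes double gamma function on the positive half-line\<close>

text \<open>Only two constants \<open>a\<close>, \<open>b\<close> are available for three
  requirements. They are used up by the shift by 1; the multiplier of the shift by \<tau> and the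
  value \<open>G 1 = 1\<close> must then come out right by themselves, and this is what Raabe's
  formula is for. The rate 3 \<pi> / 2 arises as follows: the factor \<Gamma>(s) and the G-quotient
  containing \<beta>' each lose exp(- \<pi> |Im s| / 2) and one factor 1 + |Im s|, while the other
  quotient is bounded below by a constant; raising the resulting rate \<pi> to 3 \<pi> / 2 absorbs
  the polynomial loss and stays below 2 \<pi>. Monotonicity takes the place of an asymptotic
  expansion of G. On the probabilistic side, killing is separated from the motion: the lifetime is
  independent and memoryless, so moments are computed for the unkilled process and the factor exp(-
  q u) enters through the Markov property, with q = 0 included. Since -\<psi>(-c) > 0 for 0 < c <
  \<beta>' also when \<beta> = 1, no case distinction on killing occurs. Paths are recorded at
  dyadic times, where a law is determined by finitely many independent increments at a time and
  right continuity recovers the rest.\<close>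

definition ln_tail :: "real \<Rightarrow> real" where
  "ln_tail u = ln (1 + u) - u + u\<^sup>2 / 2"

text \<open>The derivative of \<open>ln_tail\<close> is \<open>u^2 / (1 + u)\<close>, which lies
  between 0 and \<open>u^2\<close>. As \<open>ln_tail u\<close> is the logarithm of the primary
  factor \<open>(1 + u) * exp (- u + u^2 / 2)\<close>, the cubic bound drives the convergence of the
  double product.\<close>

lemma ln_tail_bounds:
  assumes "0 \<le> u"
  shows "0 \<le> ln_tail u" "ln_tail u \<le> u ^ 3 / 3"
proof -
  have d: "((\<lambda>u. ln (1 + u) - u + u\<^sup>2 / 2) has_real_derivative x\<^sup>2 / (1 + x)) (at x)" if "0 \<le> x" for x :: real
    using that by (auto intro!: derivative_eq_intros simp: field_simps power2_eq_square)
  have "(\<lambda>u. ln (1 + u) - u + u\<^sup>2 / 2) 0 \<le> (\<lambda>u. ln (1 + u) - u + u\<^sup>2 / 2) u"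
    using d by (intro DERIV_nonneg_imp_nondecreasing[OF assms]) (force intro!: exI)+
  then show "0 \<le> ln_tail u" by (simp add: ln_tail_def)
  have d': "((\<lambda>u. u ^ 3 / 3 - (ln (1 + u) - u + u\<^sup>2 / 2)) has_real_derivative x\<^sup>2 - x\<^sup>2 / (1 + x)) (at x)" if "0 \<le> x" for x :: real
    using that by (intro DERIV_diff d) (auto intro!: derivative_eq_intros)
  have nn: "0 \<le> x\<^sup>2 - x\<^sup>2 / (1 + x)" if "0 \<le> x" for x :: real
    using that by (simp add: field_simps)
  have "(\<lambda>u. u ^ 3 / 3 - (ln (1 + u) - u + u\<^sup>2 / 2)) 0 \<le> (\<lambda>u. u ^ 3 / 3 - (ln (1 + u) - u + u\<^sup>2 / 2)) u"
    using d' nn by (intro DERIV_nonneg_imp_nondecreasing[OF assms]) blast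
  then show "ln_tail u \<le> u ^ 3 / 3" by (simp add: ln_tail_def)
qed

text \<open>Both periods are free, although G has the periods \<tau> and 1: the shift by the second
  period is analysed once and, the double sum being symmetric, yields both functional
  equations.\<close>

definition lat :: "real \<Rightarrow> real \<Rightarrow> nat \<Rightarrow> nat \<Rightarrow> real" where
  "lat \<sigma> \<tau> m n = real m * \<sigma> + real n * \<tau>"

lemma lat_pos:
  assumes "\<sigma> > 0" "\<tau> > 0" "m \<noteq> 0 \<or> n \<noteq> 0"
  shows "lat \<sigma> \<tau> m n > 0"
  using assms by (auto simp: lat_def intro: add_pos_nonneg add_nonneg_pos)

text \<open>A majorant of product form: by the inequality of arithmetic and geometric means, the
  cube of a nonzero lattice point is at least a multiple of
  \<open>((m + 1) * (n + 1)) powr (3 / 2)\<close>, so the double sums are dominated by products of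
  two convergent single sums.\<close>

definition cube_weight :: "nat \<Rightarrow> real" where
  "cube_weight n = real (Suc n) powr (- 3 / 2)"

lemma cube_weight_nonneg [simp]: "0 \<le> cube_weight n"
  by (simp add: cube_weight_def)

lemma summable_cube_weight: "summable cube_weight"
proof -
  have "summable (\<lambda>n. real n powr (- 3 / 2))"
    by (subst summable_real_powr_iff) simp
  then show ?thesis
    unfolding cube_weight_def by (subst summable_Suc_iff)
qed

lemma lat_cube_bound:
  assumes "\<sigma> > 0" "\<tau> > 0"
  obtains K where "K > 0"
    "\<And>m n. m \<noteq> 0 \<or> n \<noteq> 0 \<Longrightarrow> 1 / lat \<sigma> \<tau> m n ^ 3 \<le> K * cube_weight m * cube_weight n"
proof -
  define k where "k = min \<sigma> \<tau>"
  have k: "k > 0" "k \<le> \<sigma>" "k \<le> \<tau>" using assms by (auto simp: k_def)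
  \<comment> \<open>Away from the origin
    \<open>2 * sqrt p \<le> m + n + 2 \<le> 3 * (m + n)\<close>, so a lattice point is at least
    \<open>k * (2 / 3) * sqrt p\<close>; the cube of 3/2 is 27/8.\<close>
  have "1 / lat \<sigma> \<tau> m n ^ 3 \<le> (27 / (8 * k ^ 3)) * cube_weight m * cube_weight n" if mn: "m \<noteq> 0 \<or> n \<noteq> 0" for m n
  proof -
    define p where "p = real (Suc m) * real (Suc n)"
    have p: "p > 0" by (simp add: p_def)
    have "k * (real m + real n) \<le> lat \<sigma> \<tau> m n"
      using k by (auto simp: lat_def algebra_simps intro!: add_mono mult_right_mono)
    have "real m + real n + 2 \<le> 3 * (real m + real n)" using mn by auto
    moreover have "2 * sqrt p \<le> real (Suc m) + real (Suc n)"
      using arith_geo_mean_sqrt[of "real (Suc m)" "real (Suc n)"] by (simp add: p_def)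
    ultimately have "2 / 3 * sqrt p \<le> real m + real n" by simp
    then have "k * (2 / 3 * sqrt p) \<le> k * (real m + real n)"
      using k by (intro mult_left_mono) auto
    also have "\<dots> \<le> lat \<sigma> \<tau> m n" by fact
    finally have a: "k * (2 / 3 * sqrt p) \<le> lat \<sigma> \<tau> m n" .
    have b: "k * (2 / 3 * sqrt p) > 0" using k p by simp
    have c: "lat \<sigma> \<tau> m n > 0" using a b by linarith
    have "1 / lat \<sigma> \<tau> m n ^ 3 \<le> 1 / (k * (2 / 3 * sqrt p)) ^ 3"
      using a b by (intro divide_left_mono power_mono mult_pos_pos zero_less_power) (use k p c in auto)
    also have "\<dots> = 27 / (8 * k ^ 3) * (1 / sqrt p ^ 3)"
      by (simp add: power_mult_distrib power_divide field_simps)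
    also have "1 / sqrt p ^ 3 = p powr (- 3 / 2)"
    proof -
      have "sqrt p ^ 3 = p powr (3 / 2)"
        using p by (simp add: powr_half_sqrt[symmetric] powr_power)
      then show ?thesis by (simp add: powr_minus_divide)
    qed
    also have "\<dots> = cube_weight m * cube_weight n"
      by (simp add: p_def cube_weight_def powr_mult)
    finally show ?thesis by simp
  qed
  then show ?thesis using k by (intro that[of "27 / (8 * k ^ 3)"]) auto
qed

definition barnes_log_term :: "real \<Rightarrow> real \<Rightarrow> real \<Rightarrow> nat \<Rightarrow> nat \<Rightarrow> real" where
  "barnes_log_term \<sigma> \<tau> x m n = (if m = 0 \<and> n = 0 then 0 else ln_tail (x / lat \<sigma> \<tau> m n))"

definition barnes_log_sum :: "real \<Rightarrow> real \<Rightarrow> real \<Rightarrow> real" where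
  "barnes_log_sum \<sigma> \<tau> x = (\<Sum>m. \<Sum>n. barnes_log_term \<sigma> \<tau> x m n)"

lemma barnes_log_term_bounds:
  assumes "\<sigma> > 0" "\<tau> > 0" "x \<ge> 0"
  obtains K where "K \<ge> 0" "\<And>m n. 0 \<le> barnes_log_term \<sigma> \<tau> x m n"
    "\<And>m n. barnes_log_term \<sigma> \<tau> x m n \<le> K * cube_weight m * cube_weight n"
proof -
  obtain K where K: "K > 0" "\<And>m n. m \<noteq> 0 \<or> n \<noteq> 0 \<Longrightarrow> 1 / lat \<sigma> \<tau> m n ^ 3 \<le> K * cube_weight m * cube_weight n"
    using lat_cube_bound assms by blast
  have nn: "0 \<le> barnes_log_term \<sigma> \<tau> x m n" for m n
    using lat_pos[OF assms(1,2), of m n] assms(3) unfolding barnes_log_term_def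
    by (auto intro!: ln_tail_bounds simp del: neq0_conv)
  have "barnes_log_term \<sigma> \<tau> x m n \<le> (x ^ 3 / 3 * K) * cube_weight m * cube_weight n" for m n
  proof (cases "m = 0 \<and> n = 0")
    case True
    then show ?thesis using assms K by (simp add: barnes_log_term_def)
  next
    case False
    then have p: "lat \<sigma> \<tau> m n > 0" using lat_pos assms by auto
    have "barnes_log_term \<sigma> \<tau> x m n \<le> (x / lat \<sigma> \<tau> m n) ^ 3 / 3"
      using False p assms(3) ln_tail_bounds(2)[of "x / lat \<sigma> \<tau> m n"] by (auto simp: barnes_log_term_def)
    also have "\<dots> = x ^ 3 / 3 * (1 / lat \<sigma> \<tau> m n ^ 3)" by (simp add: power_divide)
    also have "\<dots> \<le> x ^ 3 / 3 * (K * cube_weight m * cube_weight n)"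
      using False K assms(3) by (intro mult_left_mono) auto
    finally show ?thesis by (simp add: mult_ac)
  qed
  then show ?thesis using nn K assms by (intro that[of "x ^ 3 / 3 * K"]) auto
qed

text \<open>Nonnegative terms below a product of two summable sequences are summable over pairs;
  this gives both iterated sums and permits their interchange.\<close>

lemma summable_barnes_log_term:
  assumes "\<sigma> > 0" "\<tau> > 0" "x \<ge> 0"
  shows "summable (barnes_log_term \<sigma> \<tau> x m)"
    and "summable (\<lambda>m. \<Sum>n. barnes_log_term \<sigma> \<tau> x m n)"
    and "barnes_log_sum \<sigma> \<tau> x = (\<Sum>n. \<Sum>m. barnes_log_term \<sigma> \<tau> x m n)"
proof -
  obtain K where K: "K \<ge> 0" "\<And>m n. 0 \<le> barnes_log_term \<sigma> \<tau> x m n"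
    "\<And>m n. barnes_log_term \<sigma> \<tau> x m n \<le> K * cube_weight m * cube_weight n"
    using barnes_log_term_bounds assms by blast
  have *: "summable (barnes_log_term \<sigma> \<tau> x m)" for m
    by (rule summable_comparison_test_ev[where g="\<lambda>n. K * cube_weight m * cube_weight n"])
       (use K in \<open>auto intro!: summable_mult summable_cube_weight always_eventually\<close>)
  have **: "summable (\<lambda>m. barnes_log_term \<sigma> \<tau> x m n)" for n
    by (rule summable_comparison_test_ev[where g="\<lambda>m. K * cube_weight m * cube_weight n"])
       (use K in \<open>auto intro!: summable_mult summable_mult2 summable_cube_weight always_eventually\<close>)
  show "summable (barnes_log_term \<sigma> \<tau> x m)" by (rule *)
  show "summable (\<lambda>m. \<Sum>n. barnes_log_term \<sigma> \<tau> x m n)"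
  proof (rule summable_comparison_test_ev[where g="\<lambda>m. K * cube_weight m * suminf cube_weight"])
    have "(\<Sum>n. barnes_log_term \<sigma> \<tau> x m n) \<le> K * cube_weight m * suminf cube_weight" for m
      by (subst suminf_mult[symmetric]) (use K in \<open>auto intro!: suminf_le * summable_mult summable_cube_weight\<close>)
    moreover have "0 \<le> (\<Sum>n. barnes_log_term \<sigma> \<tau> x m n)" for m
      using K by (intro suminf_nonneg *) auto
    ultimately show "\<forall>\<^sub>F m in sequentially. norm (\<Sum>n. barnes_log_term \<sigma> \<tau> x m n) \<le> K * cube_weight m * suminf cube_weight"
      by (intro always_eventually) auto
  qed (auto intro!: summable_mult summable_mult2 summable_cube_weight)
  have hs: "(f has_sum suminf f) UNIV" if "summable f" "\<And>n. 0 \<le> f n" for f :: "nat \<Rightarrow> real"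
    using that by (intro norm_summable_imp_has_sum) (auto simp: summable_sums)
  have so: "(f summable_on UNIV)" if "summable f" "\<And>n. 0 \<le> f n" for f :: "nat \<Rightarrow> real"
    using hs[OF that] by (auto simp: summable_on_def)
  have prod: "(\<lambda>(m, n). K * cube_weight m * cube_weight n) summable_on UNIV \<times> UNIV"
  proof -
    have "(\<lambda>(m, n). cube_weight m * cube_weight n) summable_on UNIV \<times> UNIV"
    proof (rule summable_on_SigmaI[where g="\<lambda>m. cube_weight m * suminf cube_weight"])
      show "(\<lambda>m. cube_weight m * suminf cube_weight) summable_on UNIV"
        by (intro summable_on_cmult_left so summable_cube_weight) auto
      show "((\<lambda>n. case (m, n) of (m, n) \<Rightarrow> cube_weight m * cube_weight n) has_sum cube_weight m * suminf cube_weight) UNIV" for m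
        using has_sum_cmult_right[OF hs[OF summable_cube_weight], of "cube_weight m"] by simp
    qed auto
    from summable_on_cmult_right[OF this, of K] show ?thesis
      by (simp add: case_prod_unfold mult_ac)
  qed
  have sum2: "(\<lambda>(m, n). barnes_log_term \<sigma> \<tau> x m n) summable_on UNIV \<times> UNIV"
    by (rule summable_on_comparison_test[OF prod]) (use K in auto)
  have r1: "(\<Sum>n. barnes_log_term \<sigma> \<tau> x m n) = (\<Sum>\<^sub>\<infinity>n. barnes_log_term \<sigma> \<tau> x m n)" for m
    using hs[OF *[of m]] K by (metis infsumI)
  have r2: "(\<Sum>m. barnes_log_term \<sigma> \<tau> x m n) = (\<Sum>\<^sub>\<infinity>m. barnes_log_term \<sigma> \<tau> x m n)" for n
    using hs[OF **[of n]] K by (metis infsumI)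
  have s1: "(\<lambda>m. \<Sum>\<^sub>\<infinity>n. barnes_log_term \<sigma> \<tau> x m n) summable_on UNIV"
    using summable_on_Sigma_banach[OF sum2] by simp
  have sum2': "(\<lambda>(n, m). barnes_log_term \<sigma> \<tau> x m n) summable_on UNIV \<times> UNIV"
    using sum2 by (subst (asm) summable_on_swap) (simp add: case_prod_unfold)
  have s2: "(\<lambda>n. \<Sum>\<^sub>\<infinity>m. barnes_log_term \<sigma> \<tau> x m n) summable_on UNIV"
    using summable_on_Sigma_banach[OF sum2'] by simp
  have "(\<Sum>m. \<Sum>\<^sub>\<infinity>n. barnes_log_term \<sigma> \<tau> x m n) = (\<Sum>\<^sub>\<infinity>m. \<Sum>\<^sub>\<infinity>n. barnes_log_term \<sigma> \<tau> x m n)"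
    using has_sum_imp_sums[OF has_sum_infsum[OF s1]] by (simp add: sums_iff)
  also have "\<dots> = (\<Sum>\<^sub>\<infinity>n. \<Sum>\<^sub>\<infinity>m. barnes_log_term \<sigma> \<tau> x m n)"
    by (rule infsum_swap_banach) (use sum2 in simp)
  also have "\<dots> = (\<Sum>n. \<Sum>\<^sub>\<infinity>m. barnes_log_term \<sigma> \<tau> x m n)"
    using has_sum_imp_sums[OF has_sum_infsum[OF s2]] by (simp add: sums_iff)
  finally show "barnes_log_sum \<sigma> \<tau> x = (\<Sum>n. \<Sum>m. barnes_log_term \<sigma> \<tau> x m n)"
    by (simp add: barnes_log_sum_def r1 r2)
qed

section \<open>Shifts of the logarithmic double sum by one period\<close>

lemma barnes_log_sum_commute:
  assumes "\<sigma> > 0" "\<tau> > 0" "x \<ge> 0"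
  shows "barnes_log_sum \<sigma> \<tau> x = barnes_log_sum \<tau> \<sigma> x"
proof -
  have "barnes_log_term \<sigma> \<tau> x m n = barnes_log_term \<tau> \<sigma> x n m" for m n
    by (auto simp: barnes_log_term_def lat_def add.commute)
  then show ?thesis
    using summable_barnes_log_term(3)[OF assms] by (simp add: barnes_log_sum_def)
qed

text \<open>Convergence at 1 and 2 forces both coefficients to converge. Hence a limit of affine
  functions can be recognized as affine without evaluating the sums that make up its
  coefficients.\<close>

lemma affine_limit:
  fixes h :: "real \<Rightarrow> real"
  assumes "\<And>x. x > 0 \<Longrightarrow> (\<lambda>N::nat. p N + q N * x) \<longlonglongrightarrow> h x"
  obtains P Q where "\<And>x. x > 0 \<Longrightarrow> h x = P + Q * x"
proof -
  have 1: "(\<lambda>N. (p N + q N * 2) - (p N + q N * 1)) \<longlonglongrightarrow> h 2 - h 1"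
    by (intro tendsto_diff assms) auto
  then have q: "q \<longlonglongrightarrow> h 2 - h 1" by simp
  have "(\<lambda>N. (p N + q N * 1) - q N) \<longlonglongrightarrow> h 1 - (h 2 - h 1)"
    by (intro tendsto_diff assms q) auto
  then have p: "p \<longlonglongrightarrow> h 1 - (h 2 - h 1)" by simp
  have "h x = (h 1 - (h 2 - h 1)) + (h 2 - h 1) * x" if "x > 0" for x
    using assms[OF that] tendsto_add[OF p tendsto_mult_right[OF q, of x]] LIMSEQ_unique by (metis mult.commute)
  then show ?thesis using that by blast
qed

lemma tendsto_ln_add_diff:
  assumes "\<tau> > 0"
  shows "(\<lambda>N. ln (y + real N * \<tau>) - ln (real N * \<tau>)) \<longlonglongrightarrow> 0"
  using assms by real_asymp

text \<open>The partial sums over \<open>n\<close> of the \<open>m\<close>-th row telescope, up to affine functions of \<open>x\<close>.\<close>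

lemma barnes_row_shift_partial:
  assumes "\<sigma> > 0" "\<tau> > 0" "x > 0"
  shows "(\<Sum>n<Suc N. barnes_log_term \<sigma> \<tau> (x + \<tau>) m n - barnes_log_term \<sigma> \<tau> x m n) =
    ln (x + real m * \<sigma> + real (Suc N) * \<tau>) - ln (x + real m * \<sigma> + (if m = 0 then \<tau> else 0))
    + ((\<Sum>n<Suc N. if m = 0 \<and> n = 0 then 0 else - \<tau> / lat \<sigma> \<tau> m n + \<tau>\<^sup>2 / (2 * (lat \<sigma> \<tau> m n)\<^sup>2))
    + (\<Sum>n<Suc N. if m = 0 \<and> n = 0 then 0 else \<tau> / (lat \<sigma> \<tau> m n)\<^sup>2) * x)"
proof (induction N)
  have step: "barnes_log_term \<sigma> \<tau> (x + \<tau>) m n - barnes_log_term \<sigma> \<tau> x m n =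
     ln (x + real m * \<sigma> + real (Suc n) * \<tau>) - ln (x + real m * \<sigma> + real n * \<tau>)
     + (- \<tau> / lat \<sigma> \<tau> m n + \<tau>\<^sup>2 / (2 * (lat \<sigma> \<tau> m n)\<^sup>2)) + \<tau> / (lat \<sigma> \<tau> m n)\<^sup>2 * x"
    if "m \<noteq> 0 \<or> n \<noteq> 0" for n
  proof -
    define w where "w = lat \<sigma> \<tau> m n"
    have w: "w > 0" using lat_pos[OF assms(1,2) that] by (simp add: w_def)
    have e: "ln (1 + y / w) = ln (y + w) - ln w" if "y > 0" for y
    proof -
      have "1 + y / w = (y + w) / w" using w by (simp add: field_simps)
      then show ?thesis using that w by (simp add: ln_div)
    qed
    have eq1: "x + real m * \<sigma> + real (Suc n) * \<tau> = (x + \<tau>) + w" "x + real m * \<sigma> + real n * \<tau> = x + w"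
      by (auto simp: w_def lat_def algebra_simps)
    have "barnes_log_term \<sigma> \<tau> (x + \<tau>) m n - barnes_log_term \<sigma> \<tau> x m n =
      ln (1 + (x + \<tau>) / w) - (x + \<tau>) / w + ((x + \<tau>) / w)\<^sup>2 / 2 - (ln (1 + x / w) - x / w + (x / w)\<^sup>2 / 2)"
      using that by (auto simp: barnes_log_term_def ln_tail_def w_def)
    also have "\<dots> = ln ((x + \<tau>) + w) - ln (x + w) + ((- ((x + \<tau>) / w) + ((x + \<tau>) / w)\<^sup>2 / 2) - (- (x / w) + (x / w)\<^sup>2 / 2))"
      using assms by (subst (1 2) e) auto
    also have "((- ((x + \<tau>) / w) + ((x + \<tau>) / w)\<^sup>2 / 2) - (- (x / w) + (x / w)\<^sup>2 / 2)) = (- \<tau> / w + \<tau>\<^sup>2 / (2 * w\<^sup>2)) + \<tau> / w\<^sup>2 * x"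
      using w by (simp add: field_simps power2_eq_square)
    finally show ?thesis by (simp only: eq1) (simp add: w_def)
  qed
  \<comment> \<open>Row 0 lacks the term n = 0, so its telescoping sum starts at
    \<open>ln (x + \<tau>)\<close>; every other row starts at \<open>ln (x + m * \<sigma>)\<close>.
    This is the source of the \<open>if\<close> in the statement.\<close>
  case 0
  show ?case using step[of 0] by (cases "m = 0") (auto simp: barnes_log_term_def)
  case (Suc N)
  show ?case
    unfolding sum.lessThan_Suc[of _ "Suc N"] Suc.IH
    using step[of "Suc N"] by (simp add: algebra_simps)
qed

lemma barnes_row_shift:
  assumes "\<sigma> > 0" "\<tau> > 0"
  obtains p q where "\<And>x. x > 0 \<Longrightarrow>
    (\<Sum>n. barnes_log_term \<sigma> \<tau> (x + \<tau>) m n) - (\<Sum>n. barnes_log_term \<sigma> \<tau> x m n) =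
    p + q * x - ln (x + real m * \<sigma> + (if m = 0 then \<tau> else 0))"
proof -
  define D where "D x = (\<Sum>n. barnes_log_term \<sigma> \<tau> (x + \<tau>) m n) - (\<Sum>n. barnes_log_term \<sigma> \<tau> x m n)
     + ln (x + real m * \<sigma> + (if m = 0 then \<tau> else 0))" for x
  define p where "p N = (\<Sum>n<Suc N. if m = 0 \<and> n = 0 then 0 else - \<tau> / lat \<sigma> \<tau> m n + \<tau>\<^sup>2 / (2 * (lat \<sigma> \<tau> m n)\<^sup>2))" for N
  define q where "q N = (\<Sum>n<Suc N. if m = 0 \<and> n = 0 then 0 else \<tau> / (lat \<sigma> \<tau> m n)\<^sup>2)" for N
  \<comment> \<open>The upper end of the telescoping sum diverges, but differs by o(1) from
    \<open>ln (real (Suc N) * \<tau>)\<close>, which does not involve x and can be moved into the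
    constant coefficient.\<close>
  have "(\<lambda>N. (ln (real (Suc N) * \<tau>) + p N) + q N * x) \<longlonglongrightarrow> D x" if x: "x > 0" for x
  proof -
    have "(\<lambda>n. barnes_log_term \<sigma> \<tau> (x + \<tau>) m n - barnes_log_term \<sigma> \<tau> x m n) sums
       ((\<Sum>n. barnes_log_term \<sigma> \<tau> (x + \<tau>) m n) - (\<Sum>n. barnes_log_term \<sigma> \<tau> x m n))"
      using x assms by (intro sums_diff summable_sums summable_barnes_log_term) auto
    then have "(\<lambda>N. \<Sum>n<Suc N. barnes_log_term \<sigma> \<tau> (x + \<tau>) m n - barnes_log_term \<sigma> \<tau> x m n) \<longlonglongrightarrow>
       ((\<Sum>n. barnes_log_term \<sigma> \<tau> (x + \<tau>) m n) - (\<Sum>n. barnes_log_term \<sigma> \<tau> x m n))"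
      unfolding sums_def by (rule LIMSEQ_Suc)
    moreover have "(\<lambda>N. ln ((x + real m * \<sigma>) + real (Suc N) * \<tau>) - ln (real (Suc N) * \<tau>)) \<longlonglongrightarrow> 0"
      by (rule LIMSEQ_Suc[OF tendsto_ln_add_diff]) fact
    ultimately have "(\<lambda>N. (\<Sum>n<Suc N. barnes_log_term \<sigma> \<tau> (x + \<tau>) m n - barnes_log_term \<sigma> \<tau> x m n)
       - (ln ((x + real m * \<sigma>) + real (Suc N) * \<tau>) - ln (real (Suc N) * \<tau>)) + ln (x + real m * \<sigma> + (if m = 0 then \<tau> else 0))) \<longlonglongrightarrow>
       ((\<Sum>n. barnes_log_term \<sigma> \<tau> (x + \<tau>) m n) - (\<Sum>n. barnes_log_term \<sigma> \<tau> x m n)) - 0 + ln (x + real m * \<sigma> + (if m = 0 then \<tau> else 0))"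
      by (intro tendsto_intros)
    then show ?thesis
      by (subst (asm) barnes_row_shift_partial[OF assms x]) (simp add: D_def p_def q_def algebra_simps)
  qed
  from affine_limit[OF this] obtain P Q where "\<And>x. x > 0 \<Longrightarrow> D x = P + Q * x" by blast
  then show ?thesis by (intro that[of P Q]) (auto simp: D_def algebra_simps)
qed

text \<open>Row m contributes \<open>- ln (x + m * \<sigma>)\<close> up to an affine function,
  except that row 0 contributes \<open>- ln (x + \<tau>)\<close>; the two explicit logarithms on the
  left exchange the latter for \<open>- ln x\<close>. Together these are, again up to affine
  functions, the terms of the series of \<open>ln_Gamma\<close> at
  \<open>x / \<sigma>\<close>.\<close>

lemma barnes_log_sum_shift:
  assumes "\<sigma> > 0" "\<tau> > 0"
  obtains p q where "\<And>x. x > 0 \<Longrightarrow>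
    barnes_log_sum \<sigma> \<tau> (x + \<tau>) + ln (x + \<tau>) - (barnes_log_sum \<sigma> \<tau> x + ln x) = ln_Gamma (x / \<sigma>) + p + q * x"
proof -
  define r where "r x m = (\<Sum>n. barnes_log_term \<sigma> \<tau> (x + \<tau>) m n) - (\<Sum>n. barnes_log_term \<sigma> \<tau> x m n)" for x m
  have "\<exists>p q. \<forall>x>0. r x m = p + q * x - ln (x + real m * \<sigma> + (if m = 0 then \<tau> else 0))" for m
    using barnes_row_shift[OF assms, of m] unfolding r_def by metis
  then obtain p q where pq: "\<And>m x. x > 0 \<Longrightarrow> r x m = p m + q m * x - ln (x + real m * \<sigma> + (if m = 0 then \<tau> else 0))"
    by metis
  define D where "D x = barnes_log_sum \<sigma> \<tau> (x + \<tau>) + ln (x + \<tau>) - (barnes_log_sum \<sigma> \<tau> x + ln x) - ln_Gamma (x / \<sigma>)" for x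
  define c where "c N = (\<Sum>k=1..N. ln (real k * \<sigma>))" for N
  have partial: "(\<Sum>m<Suc N. r x m) + ln (x + \<tau>) - ln x - ln_Gamma_series (x / \<sigma>) N =
     ((\<Sum>m<Suc N. p m) - c N - ln \<sigma>) + ((\<Sum>m<Suc N. q m) - ln (real N) / \<sigma>) * x" if x: "x > 0" for x N
  proof -
    have 1: "(\<Sum>m<Suc N. r x m) = (\<Sum>m<Suc N. p m) + (\<Sum>m<Suc N. q m) * x
      - (\<Sum>m<Suc N. ln (x + real m * \<sigma> + (if m = 0 then \<tau> else 0)))"
      by (simp add: pq[OF x] sum.distrib sum_subtractf sum_distrib_left algebra_simps del: sum.lessThan_Suc)
    have 2: "(\<Sum>m<Suc N. ln (x + real m * \<sigma> + (if m = 0 then \<tau> else 0))) = ln (x + \<tau>) + (\<Sum>m=1..N. ln (x + real m * \<sigma>))"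
      by (induction N) auto
    have 3: "(\<Sum>k=1..N. ln (x / \<sigma> / real k + 1)) = (\<Sum>m=1..N. ln (x + real m * \<sigma>)) - c N"
      unfolding c_def sum_subtractf[symmetric]
    proof (intro sum.cong refl)
      fix k assume "k \<in> {1..N}"
      then have k: "real k > 0" by auto
      have "x / \<sigma> / real k + 1 = (x + real k * \<sigma>) / (real k * \<sigma>)"
        using x assms k by (simp add: field_simps)
      moreover have "0 < x + real k * \<sigma>" "0 < real k * \<sigma>"
        using x assms k by (auto intro: add_pos_pos)
      ultimately show "ln (x / \<sigma> / real k + 1) = ln (x + real k * \<sigma>) - ln (real k * \<sigma>)"
        by (simp only: ln_div) auto
    qed
    have 4: "ln (x / \<sigma>) = ln x - ln \<sigma>" using x assms by (simp add: ln_div)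
    show ?thesis unfolding ln_Gamma_series_def 1 2 3 4 by (simp add: algebra_simps)
  qed
  have "(\<lambda>N. ((\<Sum>m<Suc N. p m) - c N - ln \<sigma>) + ((\<Sum>m<Suc N. q m) - ln (real N) / \<sigma>) * x) \<longlonglongrightarrow> D x" if x: "x > 0" for x
  proof -
    have "r x sums (barnes_log_sum \<sigma> \<tau> (x + \<tau>) - barnes_log_sum \<sigma> \<tau> x)"
      unfolding r_def barnes_log_sum_def using x assms
      by (intro sums_diff summable_sums summable_barnes_log_term) auto
    then have "(\<lambda>N. \<Sum>m<Suc N. r x m) \<longlonglongrightarrow> (barnes_log_sum \<sigma> \<tau> (x + \<tau>) - barnes_log_sum \<sigma> \<tau> x)"
      unfolding sums_def by (rule LIMSEQ_Suc)
    moreover have "ln_Gamma_series (x / \<sigma>) \<longlonglongrightarrow> ln_Gamma (x / \<sigma>)"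
      using x assms by (intro ln_Gamma_real_LIMSEQ) auto
    ultimately have "(\<lambda>N. (\<Sum>m<Suc N. r x m) + ln (x + \<tau>) - ln x - ln_Gamma_series (x / \<sigma>) N) \<longlonglongrightarrow>
       (barnes_log_sum \<sigma> \<tau> (x + \<tau>) - barnes_log_sum \<sigma> \<tau> x) + ln (x + \<tau>) - ln x - ln_Gamma (x / \<sigma>)"
      by (intro tendsto_intros)
    then show ?thesis unfolding partial[OF x] by (simp add: D_def algebra_simps)
  qed
  from affine_limit[OF this] obtain P Q where "\<And>x. x > 0 \<Longrightarrow> D x = P + Q * x" by blast
  then show ?thesis by (intro that[of P Q]) (auto simp: D_def algebra_simps)
qed

section \<open>Raabe's formula and the multiplier of the second functional equation\<close>

lemma Raabe_antiderivative:
  fixes \<Lambda> :: "real \<Rightarrow> real"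
  assumes \<Lambda>: "\<And>x. x > 0 \<Longrightarrow> (\<Lambda> has_real_derivative ln_Gamma x) (at x)" and x: "x > 0"
  shows "\<Lambda> (x + 1) - \<Lambda> x = ln (2 * pi) / 2 + x * ln x - x"
proof -
  have shift: "((\<lambda>y. \<Lambda> (y + a)) has_real_derivative ln_Gamma (y + a)) (at y)" if "y > 0" "a \<ge> 0" for y a
    using DERIV_shift[of \<Lambda> "ln_Gamma (y + a)" y a] \<Lambda>[of "y + a"] that by (simp add: add.commute)
  have const: "\<exists>c. \<forall>y>0. f y = c" if "\<And>y. y > 0 \<Longrightarrow> (f has_real_derivative 0) (at y)" for f :: "real \<Rightarrow> real"
  proof -
    have "\<exists>c. \<forall>y\<in>{0<..}. f y = c"
      by (rule has_field_derivative_zero_constant) (auto intro: has_field_derivative_at_within that)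
    then show ?thesis by auto
  qed
  have lG: "ln_Gamma (y + 1) = ln y + ln_Gamma y" if "y > 0" for y :: real
  proof -
    have "y \<notin> \<int>\<^sub>\<le>\<^sub>0" using that by (auto simp: nonpos_Ints_def)
    moreover have "Gamma y \<noteq> 0" using Gamma_real_pos[OF that] by linarith
    ultimately show ?thesis
      using that by (subst (1 2) ln_Gamma_real_pos) (auto simp: Gamma_plus1 ln_mult)
  qed
  \<comment> \<open>The derivative is \<open>ln_Gamma (y + 1) - ln_Gamma y - ln y = 0\<close>. The
    value of the constant K will come from integrating Legendre's duplication formula.\<close>
  have "\<exists>K. \<forall>y>0. \<Lambda> (y + 1) - \<Lambda> y - (y * ln y - y) = K"
  proof (rule const)
    fix y :: real assume y: "y > 0"
    show "((\<lambda>y. \<Lambda> (y + 1) - \<Lambda> y - (y * ln y - y)) has_real_derivative 0) (at y)"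
      using y lG[OF y] by (auto intro!: derivative_eq_intros shift \<Lambda>)
  qed
  then obtain K where K: "\<And>y. y > 0 \<Longrightarrow> \<Lambda> (y + 1) - \<Lambda> y - (y * ln y - y) = K" by blast
  have dup: "ln_Gamma y + ln_Gamma (y + 1/2) = (1 - 2 * y) * ln 2 + ln pi / 2 + ln_Gamma (2 * y)" if y: "y > 0" for y :: real
  proof -
    have "complex_of_real (Gamma y * Gamma (y + 1/2)) = complex_of_real (exp ((1 - 2 * y) * ln 2) * sqrt pi * Gamma (2 * y))"
    proof -
      have "complex_of_real y \<notin> \<int>\<^sub>\<le>\<^sub>0" "complex_of_real (y + 1/2) \<notin> \<int>\<^sub>\<le>\<^sub>0"
        unfolding of_real_in_nonpos_Ints_iff using y by (auto elim!: nonpos_Ints_cases)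
      then have "Gamma (complex_of_real y) * Gamma (complex_of_real (y + 1/2)) =
         complex_of_real (exp ((1 - 2 * y) * ln 2)) * complex_of_real (sqrt pi) * Gamma (complex_of_real (2 * y))"
        using Gamma_legendre_duplication[of "complex_of_real y"] by (simp add: exp_of_real[symmetric])
      then show ?thesis unfolding Gamma_complex_of_real by simp
    qed
    then have "Gamma y * Gamma (y + 1/2) = exp ((1 - 2 * y) * ln 2) * sqrt pi * Gamma (2 * y)"
      using of_real_eq_iff by blast
    then have "ln (Gamma y * Gamma (y + 1/2)) = ln (exp ((1 - 2 * y) * ln 2) * sqrt pi * Gamma (2 * y))" by simp
    moreover have "Gamma y \<noteq> 0" "Gamma (y + 1/2) \<noteq> 0" "Gamma (2 * y) \<noteq> 0"
      using y Gamma_real_pos[of y] Gamma_real_pos[of "y+1/2"] Gamma_real_pos[of "2*y"] by linarith+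
    ultimately show ?thesis
      using y
      by (simp add: ln_mult ln_Gamma_real_pos ln_sqrt)
  qed
  have "\<exists>c. \<forall>y>0. \<Lambda> y + \<Lambda> (y + 1/2) - \<Lambda> (2 * y) / 2 - ((y - y\<^sup>2) * ln 2 + y * ln pi / 2) = c"
  proof (rule const)
    fix y :: real assume y: "y > 0"
    have "((\<lambda>y. \<Lambda> (2 * y)) has_real_derivative ln_Gamma (2 * y) * 2) (at y)"
      using y by (intro DERIV_chain2[OF \<Lambda>]) (auto intro!: derivative_eq_intros)
    then show "((\<lambda>y. \<Lambda> y + \<Lambda> (y + 1/2) - \<Lambda> (2 * y) / 2 - ((y - y\<^sup>2) * ln 2 + y * ln pi / 2)) has_real_derivative 0) (at y)"
      using y dup[OF y] by (auto intro!: derivative_eq_intros shift \<Lambda> simp: algebra_simps)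
  qed
  then obtain c where c: "\<And>y. y > 0 \<Longrightarrow> \<Lambda> y + \<Lambda> (y + 1/2) - \<Lambda> (2 * y) / 2 - ((y - y\<^sup>2) * ln 2 + y * ln pi / 2) = c" by blast
  have h: "(1/2 + 1/2 :: real) = 1" by simp
  \<comment> \<open>At y = 1/2 and y = 1 the integrated duplication formula involves \<Lambda> only
    at 1/2, 1, 3/2 and 2. Subtracting the two instances leaves the increments over [1/2, 3/2] and
    [1, 2], both known in terms of K, and the resulting linear equation determines K.\<close>
  have c1: "\<Lambda> (1/2) + \<Lambda> 1 - \<Lambda> 1 / 2 - ((1/2 - (1/2)\<^sup>2) * ln 2 + (1/2) * ln pi / 2) = c"
    using c[of "1/2"] unfolding h by (simp add: power2_eq_square)
  have c2: "\<Lambda> 1 + \<Lambda> (3/2) - \<Lambda> 2 / 2 - ((1 - 1\<^sup>2) * ln 2 + 1 * ln pi / 2) = c"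
    using c[of 1] by simp
  have k1: "\<Lambda> 2 - \<Lambda> 1 + 1 = K" using K[of 1] by simp
  have "(1/2 + 1 :: real) = 3/2" by simp
  then have k2: "\<Lambda> (3/2) - \<Lambda> (1/2) - (1/2 * ln (1/2) - 1/2) = K" using K[of "1/2"] by simp
  have "ln (1/2 :: real) = - ln 2" by (simp add: ln_div)
  then have "K = ln 2 / 2 + ln pi / 2"
    using c1 c2 k1 k2 by (simp add: power2_eq_square field_simps)
  also have "\<dots> = ln (2 * pi) / 2" by (simp add: ln_mult)
  finally show ?thesis using K[OF x] by simp
qed

lemma antiderivative_exists:
  fixes f :: "real \<Rightarrow> real"
  assumes "continuous_on {0<..} f"
  obtains F where "\<And>x. x > 0 \<Longrightarrow> (F has_real_derivative f x) (at x)"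
proof -
  define F where "F x = (LBINT y=ereal 1..ereal x. f y :: real)" for x
  have "(F has_real_derivative f x) (at x)" if x: "x > 0" for x
  proof -
    define a b where "a = min x 1 / 2" and "b = max x 1 + 1"
    have ab: "0 < a" "a < x" "x < b" "a < 1" "1 < b" using x by (auto simp: a_def b_def)
    have "((\<lambda>u. LBINT y=ereal 1..ereal u. f y) has_vector_derivative (f x)) (at x within {a..b})"
      by (rule interval_integral_FTC2) (use ab in \<open>auto intro: continuous_on_subset[OF assms]\<close>)
    then have "(F has_real_derivative f x) (at x within {a..b})"
      by (simp add: has_real_derivative_iff_has_vector_derivative F_def[abs_def])
    then have "(F has_real_derivative f x) (at x within {a<..<b})"
      by (rule DERIV_subset) auto
    then show ?thesis using ab by (subst (asm) at_within_open) auto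
  qed
  then show ?thesis using that by blast
qed

lemma ln_Gamma_continuous_on: "continuous_on {0<..} (ln_Gamma :: real \<Rightarrow> real)"
proof -
  have "continuous_on {0<..} (\<lambda>x::real. ln (Gamma x))"
    by (intro continuous_intros) (auto simp: nonpos_Ints_def Gamma_real_pos less_imp_neq[symmetric])
  then show ?thesis
    by (subst continuous_on_cong[OF refl, of _ _ "\<lambda>x. ln (Gamma x)"]) (auto simp: ln_Gamma_real_pos)
qed

text \<open>The multiplier of the second functional equation: its slope is forced by computing
  \<open>H (x + 1 + \<tau>)\<close> in two ways, its value by integrating over \<open>[x, x + 1] \<times> [x, x + \<tau>]\<close> and Raabe's formula.\<close>

lemma barnes_multiplier:
  fixes H :: "real \<Rightarrow> real"
  assumes \<tau>: "\<tau> > 0" and cont: "continuous_on {0<..} H"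
    and H1: "\<And>x. x > 0 \<Longrightarrow> H (x + 1) - H x = ln_Gamma (x / \<tau>)"
    and H2: "\<And>x. x > 0 \<Longrightarrow> H (x + \<tau>) - H x = ln_Gamma x + c + d * x"
  shows "d = - ln \<tau>" "c = (\<tau> - 1) / 2 * ln (2 * pi) + ln \<tau> / 2"
proof -
  have lG: "ln_Gamma (y + 1) = ln y + ln_Gamma y" if "y > 0" for y :: real
  proof -
    have "y \<notin> \<int>\<^sub>\<le>\<^sub>0" using that by (auto simp: nonpos_Ints_def)
    moreover have "Gamma y \<noteq> 0" using Gamma_real_pos[OF that] by linarith
    ultimately show ?thesis
      using that by (subst (1 2) ln_Gamma_real_pos) (auto simp: Gamma_plus1 ln_mult)
  qed
  have "ln_Gamma ((1 + \<tau>) / \<tau>) = ln (1 / \<tau>) + ln_Gamma (1 / \<tau>)"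
    using lG[of "1 / \<tau>"] \<tau> by (simp add: field_simps)
  moreover have "ln_Gamma (1 + 1) = ln 1 + ln_Gamma (1::real)" by (rule lG) simp
  ultimately show d: "d = - ln \<tau>"
    using H1[of "1 + \<tau>"] H1[of 1] H2[of 1] H2[of "1 + 1"] \<tau> by (simp add: ln_div algebra_simps)
  obtain \<Lambda> where \<Lambda>: "\<And>x. x > 0 \<Longrightarrow> (\<Lambda> has_real_derivative H x) (at x)"
    using antiderivative_exists[OF cont] by blast
  obtain \<Gamma>' where \<Gamma>': "\<And>x. x > 0 \<Longrightarrow> (\<Gamma>' has_real_derivative ln_Gamma x) (at x)"
    using antiderivative_exists[OF ln_Gamma_continuous_on] by blast
  have shift: "((\<lambda>y. \<Lambda> (y + a)) has_real_derivative H (y + a)) (at y)" if "y > 0" "a \<ge> 0" for y a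
    using DERIV_shift[of \<Lambda> "H (y + a)" y a] \<Lambda>[of "y + a"] that by (simp add: add.commute)
  have const: "\<exists>c. \<forall>y>0. f y = c" if "\<And>y. y > 0 \<Longrightarrow> (f has_real_derivative 0) (at y)" for f :: "real \<Rightarrow> real"
  proof -
    have "\<exists>c. \<forall>y\<in>{0<..}. f y = c"
      by (rule has_field_derivative_zero_constant) (auto intro: has_field_derivative_at_within that)
    then show ?thesis by auto
  qed
  have "\<exists>c. \<forall>y>0. \<Lambda> (y + 1) - \<Lambda> y - \<tau> * \<Gamma>' (y / \<tau>) = c"
  proof (rule const)
    fix y :: real assume y: "y > 0"
    have "((\<lambda>y. \<Gamma>' (y / \<tau>)) has_real_derivative ln_Gamma (y / \<tau>) * (1 / \<tau>)) (at y)"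
      using y \<tau> by (intro DERIV_chain2[OF \<Gamma>']) (auto intro!: derivative_eq_intros)
    then show "((\<lambda>y. \<Lambda> (y + 1) - \<Lambda> y - \<tau> * \<Gamma>' (y / \<tau>)) has_real_derivative 0) (at y)"
      using y H1[OF y] \<tau> by (auto intro!: derivative_eq_intros shift \<Lambda>)
  qed
  then obtain k1 where k1: "\<And>y. y > 0 \<Longrightarrow> \<Lambda> (y + 1) - \<Lambda> y - \<tau> * \<Gamma>' (y / \<tau>) = k1" by blast
  have "\<exists>c'. \<forall>y>0. \<Lambda> (y + \<tau>) - \<Lambda> y - (\<Gamma>' y + c * y + d * y\<^sup>2 / 2) = c'"
  proof (rule const)
    fix y :: real assume y: "y > 0"
    show "((\<lambda>y. \<Lambda> (y + \<tau>) - \<Lambda> y - (\<Gamma>' y + c * y + d * y\<^sup>2 / 2)) has_real_derivative 0) (at y)"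
      using y H2[OF y] \<tau> by (auto intro!: derivative_eq_intros shift \<Lambda> \<Gamma>')
  qed
  then obtain k2 where k2: "\<And>y. y > 0 \<Longrightarrow> \<Lambda> (y + \<tau>) - \<Lambda> y - (\<Gamma>' y + c * y + d * y\<^sup>2 / 2) = k2" by blast
  \<comment> \<open>The point \<open>2 * \<tau> + 1\<close> is reached from \<tau> through
    \<open>\<tau> + 1\<close> or through \<open>2 * \<tau>\<close>. Equating the two routes cancels
    \<open>k1\<close> and \<open>k2\<close> and leaves only increments of the antiderivative of
    \<open>ln_Gamma\<close>, which Raabe's formula evaluates.\<close>
  have a1: "\<Lambda> (\<tau> + 1) - \<Lambda> \<tau> - \<tau> * \<Gamma>' 1 = k1" using k1[of \<tau>] \<tau> by simp
  have a2: "\<Lambda> (2 * \<tau> + 1) - \<Lambda> (2 * \<tau>) - \<tau> * \<Gamma>' 2 = k1" using k1[of "2 * \<tau>"] \<tau> by simp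
  have b1: "\<Lambda> (2 * \<tau>) - \<Lambda> \<tau> - (\<Gamma>' \<tau> + c * \<tau> + d * \<tau>\<^sup>2 / 2) = k2" using k2[of \<tau>] \<tau> by simp
  have b2: "\<Lambda> (2 * \<tau> + 1) - \<Lambda> (\<tau> + 1) - (\<Gamma>' (\<tau> + 1) + c * (\<tau> + 1) + d * (\<tau> + 1)\<^sup>2 / 2) = k2"
    using k2[of "\<tau> + 1"] \<tau> by (simp add: algebra_simps)
  have r1: "\<Gamma>' 2 - \<Gamma>' 1 = ln (2 * pi) / 2 - 1"
    using Raabe_antiderivative[OF \<Gamma>', of 1] by simp
  have r2: "\<Gamma>' (\<tau> + 1) - \<Gamma>' \<tau> = ln (2 * pi) / 2 + \<tau> * ln \<tau> - \<tau>"
    using Raabe_antiderivative[OF \<Gamma>', of \<tau>] \<tau> by simp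
  have "\<tau> * (\<Gamma>' 2 - \<Gamma>' 1) = \<Gamma>' (\<tau> + 1) - \<Gamma>' \<tau> + c + d * (\<tau> + 1 / 2)"
    using a1 a2 b1 b2 by (simp add: power2_eq_square field_simps)
  then show "c = (\<tau> - 1) / 2 * ln (2 * pi) + ln \<tau> / 2"
    unfolding r1 r2 d by (simp add: field_simps)
qed

section \<open>The Barnes double gamma function as an entire function\<close>

definition barnes_factor :: "real \<Rightarrow> nat \<Rightarrow> nat \<Rightarrow> complex \<Rightarrow> complex" where
  "barnes_factor \<tau> m n z = (if m = 0 \<and> n = 0 then 1
     else (let w = z / of_real (real m * \<tau> + real n) in (1 + w) * exp (- w + w\<^sup>2 / 2)))"

definition barnes_row :: "real \<Rightarrow> nat \<Rightarrow> complex \<Rightarrow> complex" where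
  "barnes_row \<tau> m z = (\<Prod>n. barnes_factor \<tau> m n z)"

lemma barnes_product_eq:
  "barnes_product a b \<tau> z =
     z / of_real \<tau> * exp (of_real a * (z / of_real \<tau>) + of_real b * (z\<^sup>2 / (2 * of_real \<tau>))) *
     (\<Prod>m. barnes_row \<tau> m z)"
  by (simp add: barnes_product_def barnes_row_def barnes_factor_def)

lemma barnes_factor_weierstrass:
  assumes "m \<noteq> 0 \<or> n \<noteq> 0"
  shows "barnes_factor \<tau> m n z = weierstrass_factor 2 (- z / of_real (lat \<tau> 1 m n))"
proof -
  have "{1..2::nat} = {1, 2}" by auto
  then show ?thesis
    using assms by (auto simp: barnes_factor_def weierstrass_factor_def Let_def lat_def)
qed

lemma barnes_factor_holomorphic: "barnes_factor \<tau> m n holomorphic_on A"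
proof (cases "m = 0 \<and> n = 0")
  case True
  then have "barnes_factor \<tau> m n = (\<lambda>_. 1)" by (auto simp: barnes_factor_def)
  then show ?thesis by simp
next
  case False
  then have "barnes_factor \<tau> m n = (\<lambda>z. weierstrass_factor 2 (- z * inverse (of_real (lat \<tau> 1 m n))))"
    by (auto simp: barnes_factor_weierstrass divide_inverse)
  moreover have "(\<lambda>z. weierstrass_factor 2 (- z * inverse (of_real (lat \<tau> 1 m n)))) holomorphic_on A"
    by (rule weierstrass_factor_holomorphic, intro holomorphic_on_mult holomorphic_on_minus holomorphic_on_ident holomorphic_on_const)
  ultimately show ?thesis by (simp only:)
qed

text \<open>The primary factor of genus 2 differs from 1 by at most \<open>3 * norm w ^ 3\<close>
  for \<open>norm w \<le> 1 / 2\<close>. The hypothesis on z holds for all but finitely many lattice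
  points, uniformly for z in a disc.\<close>

lemma barnes_factor_bound:
  assumes \<tau>: "\<tau> > 0"
  obtains K where "K > 0"
    "\<And>m n z. 2 * norm z \<le> real m * \<tau> + real n \<Longrightarrow>
       norm (barnes_factor \<tau> m n z - 1) \<le> K * norm z ^ 3 * cube_weight m * cube_weight n"
proof -
  obtain K where K: "K > 0" "\<And>m n. m \<noteq> 0 \<or> n \<noteq> 0 \<Longrightarrow> 1 / lat \<tau> 1 m n ^ 3 \<le> K * cube_weight m * cube_weight n"
    using lat_cube_bound[of \<tau> 1] assms by auto
  have *: "norm (barnes_factor \<tau> m n z - 1) \<le> (3 * K) * norm z ^ 3 * cube_weight m * cube_weight n"
    if z: "2 * norm z \<le> real m * \<tau> + real n" for m n z
  proof (cases "m = 0 \<and> n = 0")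
    case True
    then show ?thesis using K by (simp add: barnes_factor_def)
  next
    case False
    then have p: "lat \<tau> 1 m n > 0" using lat_pos[of \<tau> 1 m n] \<tau> by auto
    have "norm (- z / of_real (lat \<tau> 1 m n)) \<le> 1 / 2"
    proof -
      have "norm (- z / of_real (lat \<tau> 1 m n)) = norm z / lat \<tau> 1 m n"
        using p by (simp add: norm_divide)
      moreover have "2 * norm z \<le> lat \<tau> 1 m n" using z by (simp add: lat_def)
      ultimately show ?thesis using p by (simp only: divide_le_eq) (simp add: field_simps)
    qed
    then have "norm (weierstrass_factor 2 (- z / of_real (lat \<tau> 1 m n)) - 1) \<le> 3 * norm (- z / of_real (lat \<tau> 1 m n)) ^ 3"
      using weierstrass_factor_bound[of "- z / of_real (lat \<tau> 1 m n)" 2] by (simp add: numeral_3_eq_3)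
    also have "\<dots> = 3 * norm z ^ 3 * (1 / lat \<tau> 1 m n ^ 3)"
      using p by (simp add: norm_divide power_divide)
    also have "\<dots> \<le> 3 * norm z ^ 3 * (K * cube_weight m * cube_weight n)"
      using K False by (intro mult_left_mono) auto
    finally show ?thesis using False by (subst barnes_factor_weierstrass) (auto simp: mult_ac)
  qed
  have "3 * K > 0" using K(1) by simp
  then show ?thesis using * by (rule that)
qed

lemma ev_le_lat: "\<tau> > 0 \<Longrightarrow> eventually (\<lambda>n. r \<le> real m * \<tau> + real n) sequentially"
proof -
  assume "\<tau> > 0"
  have "eventually (\<lambda>n. r \<le> real n) sequentially" by real_asymp
  then show ?thesis by eventually_elim (use \<open>\<tau> > 0\<close> in \<open>auto intro: add_increasing\<close>)
qed

lemma barnes_row_convergent: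
  assumes \<tau>: "\<tau> > 0"
  shows "convergent_prod (\<lambda>n. barnes_factor \<tau> m n z)"
proof -
  obtain K where K: "K > 0" "\<And>m n z. 2 * norm z \<le> real m * \<tau> + real n \<Longrightarrow>
       norm (barnes_factor \<tau> m n z - 1) \<le> K * norm z ^ 3 * cube_weight m * cube_weight n"
    by (rule barnes_factor_bound[OF \<tau>]) (rule that)
  have "summable (\<lambda>n. norm (barnes_factor \<tau> m n z - 1))"
  proof (rule summable_comparison_test_ev)
    show "\<forall>\<^sub>F n in sequentially. norm (norm (barnes_factor \<tau> m n z - 1)) \<le> K * norm z ^ 3 * cube_weight m * cube_weight n"
      using ev_le_lat[OF \<tau>, of "2 * norm z" m] by eventually_elim (use K in auto)
  qed (intro summable_mult summable_cube_weight)
  then show ?thesis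
    by (intro abs_convergent_prod_imp_convergent_prod) (simp add: abs_convergent_prod_conv_summable)
qed

lemma barnes_row_holomorphic:
  assumes \<tau>: "\<tau> > 0"
  shows "barnes_row \<tau> m holomorphic_on UNIV"
proof -
  obtain K where K: "K > 0" "\<And>m n z. 2 * norm z \<le> real m * \<tau> + real n \<Longrightarrow>
       norm (barnes_factor \<tau> m n z - 1) \<le> K * norm z ^ 3 * cube_weight m * cube_weight n"
    by (rule barnes_factor_bound[OF \<tau>]) (rule that)
  have ul: "uniform_limit (cball 0 R) (\<lambda>N z. \<Prod>n<N. barnes_factor \<tau> m n z) (barnes_row \<tau> m) sequentially" for R
  proof -
    have "uniformly_convergent_on (cball 0 R) (\<lambda>N z. \<Prod>n<N. barnes_factor \<tau> m n z)"
    proof (rule uniformly_convergent_on_prod')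
      show "uniformly_convergent_on (cball 0 R) (\<lambda>N z. \<Sum>n<N. norm (barnes_factor \<tau> m n z - 1))"
      proof (rule Weierstrass_m_test'_ev)
        show "\<forall>\<^sub>F n in sequentially. \<forall>z\<in>cball 0 R. norm (norm (barnes_factor \<tau> m n z - 1)) \<le> K * R ^ 3 * cube_weight m * cube_weight n"
          using ev_le_lat[OF \<tau>, of "2 * R" m]
        proof eventually_elim
          case (elim n)
          show ?case
          proof
            fix z :: complex assume z: "z \<in> cball 0 R"
            then have "norm (barnes_factor \<tau> m n z - 1) \<le> K * norm z ^ 3 * cube_weight m * cube_weight n"
              using elim by (intro K) auto
            also have "\<dots> \<le> K * R ^ 3 * cube_weight m * cube_weight n"
              using z K by (intro mult_right_mono mult_left_mono power_mono) auto
            finally show "norm (norm (barnes_factor \<tau> m n z - 1)) \<le> K * R ^ 3 * cube_weight m * cube_weight n" by simp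
          qed
        qed
      qed (intro summable_mult summable_cube_weight)
    qed (intro holomorphic_on_imp_continuous_on barnes_factor_holomorphic compact_cball)+
    then obtain g where g: "uniform_limit (cball 0 R) (\<lambda>N z. \<Prod>n<N. barnes_factor \<tau> m n z) g sequentially"
      by (auto simp: uniformly_convergent_on_def)
    have eq: "g z = barnes_row \<tau> m z" if "z \<in> cball 0 R" for z
    proof (rule LIMSEQ_unique)
      show "(\<lambda>n. \<Prod>k<Suc n. barnes_factor \<tau> m k z) \<longlonglongrightarrow> g z"
        using tendsto_uniform_limitI[OF g that] by (rule LIMSEQ_Suc)
      show "(\<lambda>n. \<Prod>k<Suc n. barnes_factor \<tau> m k z) \<longlonglongrightarrow> barnes_row \<tau> m z"
        using convergent_prod_LIMSEQ[OF barnes_row_convergent[OF \<tau>]]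
        unfolding barnes_row_def lessThan_Suc_atMost .
    qed
    show ?thesis by (rule uniform_limit_cong[THEN iffD1, OF _ _ g]) (auto simp: eq)
  qed
  show ?thesis
  proof (rule holomorphic_uniform_sequence)
    fix z :: complex
    have "uniform_limit (cball z 1) (\<lambda>N z. \<Prod>n<N. barnes_factor \<tau> m n z) (barnes_row \<tau> m) sequentially"
      by (rule uniform_limit_on_subset[OF ul[of "norm z + 1"]]) (simp add: cball_subset_cball_iff)
    then show "\<exists>d>0. cball z d \<subseteq> UNIV \<and> uniform_limit (cball z d) (\<lambda>N z. \<Prod>n<N. barnes_factor \<tau> m n z) (barnes_row \<tau> m) sequentially"
      by (intro exI[of _ 1]) auto
  next
    show "(\<lambda>z. \<Prod>n<N. barnes_factor \<tau> m n z) holomorphic_on UNIV" for N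
      by (rule holomorphic_on_prod) (rule barnes_factor_holomorphic)
  qed simp
qed

text \<open>A product of factors \<open>1 + u n\<close> differs from 1 by at most
  \<open>exp (\<Sum>n. norm (u n)) - 1\<close>. The hypothesis makes the factor bound available
  along the whole row at once; summing over n then leaves a single weight in m.\<close>

lemma barnes_row_bound:
  assumes \<tau>: "\<tau> > 0"
  obtains K where "K > 0"
    "\<And>m z. 2 * norm z \<le> real m * \<tau> \<Longrightarrow> norm (barnes_row \<tau> m z - 1) \<le> exp (K * norm z ^ 3 * cube_weight m) - 1"
proof -
  obtain K where K: "K > 0" "\<And>m n z. 2 * norm z \<le> real m * \<tau> + real n \<Longrightarrow>
       norm (barnes_factor \<tau> m n z - 1) \<le> K * norm z ^ 3 * cube_weight m * cube_weight n"
    by (rule barnes_factor_bound[OF \<tau>]) (rule that)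
  define S where "S = suminf cube_weight"
  have S: "sum cube_weight A \<le> S" if "finite A" for A
    unfolding S_def using that by (intro sum_le_suminf summable_cube_weight) auto
  have "S > 0" using S[of "{0}"] by (simp add: cube_weight_def)
  have *: "norm (barnes_row \<tau> m z - 1) \<le> exp ((K * S) * norm z ^ 3 * cube_weight m) - 1" if z: "2 * norm z \<le> real m * \<tau>" for m z
  proof (rule LIMSEQ_le_const2)
    show "(\<lambda>N. norm ((\<Prod>n\<le>N. barnes_factor \<tau> m n z) - 1)) \<longlonglongrightarrow> norm (barnes_row \<tau> m z - 1)"
      unfolding barnes_row_def by (intro tendsto_intros convergent_prod_LIMSEQ barnes_row_convergent \<tau>)
    have "norm ((\<Prod>n\<le>N. barnes_factor \<tau> m n z) - 1) \<le> exp ((K * S) * norm z ^ 3 * cube_weight m) - 1" for N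
    proof -
      have "norm ((\<Prod>n\<le>N. 1 + (barnes_factor \<tau> m n z - 1)) - 1) \<le> (\<Prod>n\<le>N. 1 + norm (barnes_factor \<tau> m n z - 1)) - 1"
        by (rule norm_prod_minus1_le_prod_minus1)
      also have "\<dots> \<le> exp (\<Sum>n\<le>N. norm (barnes_factor \<tau> m n z - 1)) - 1"
        by (simp add: prod_le_exp_sum)
      also have "(\<Sum>n\<le>N. norm (barnes_factor \<tau> m n z - 1)) \<le> (\<Sum>n\<le>N. K * norm z ^ 3 * cube_weight m * cube_weight n)"
        by (intro sum_mono K) (use z in auto)
      also have "\<dots> = K * norm z ^ 3 * cube_weight m * sum cube_weight {..N}" by (simp add: sum_distrib_left)
      also have "\<dots> \<le> K * norm z ^ 3 * cube_weight m * S"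
        using K by (intro mult_left_mono S) auto
      finally show ?thesis by (simp add: mult_ac)
    qed
    then show "\<exists>N. \<forall>n\<ge>N. norm ((\<Prod>n\<le>n. barnes_factor \<tau> m n z) - 1) \<le> exp ((K * S) * norm z ^ 3 * cube_weight m) - 1"
      by blast
  qed
  have "K * S > 0" using K(1) \<open>S > 0\<close> by simp
  then show ?thesis using * by (rule that)
qed

lemma exp_minus_one_le:
  assumes "0 \<le> x" "x \<le> (1::real)"
  shows "exp x - 1 \<le> 2 * x"
proof -
  have "x\<^sup>2 \<le> x" using assms mult_left_le[of x x] unfolding power2_eq_square by blast
  then show ?thesis using exp_bound[of x] assms by linarith
qed

text \<open>For large m the exponent in the row bound is below 1, where
  \<open>exp x - 1 \<le> 2 * x\<close>; this linearization produces a summable majorant that is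
  uniform on discs.\<close>

lemma barnes_row_ev_bound:
  assumes \<tau>: "\<tau> > 0"
  obtains K where "K > 0"
    "\<forall>\<^sub>F m in sequentially. \<forall>z\<in>cball 0 R. norm (barnes_row \<tau> m z - 1) \<le> K * cube_weight m"
proof -
  obtain K where K: "K > 0" "\<And>m z. 2 * norm z \<le> real m * \<tau> \<Longrightarrow> norm (barnes_row \<tau> m z - 1) \<le> exp (K * norm z ^ 3 * cube_weight m) - 1"
    by (rule barnes_row_bound[OF \<tau>]) (rule that)
  define R' where "R' = max R 1"
  have "(\<lambda>m. K * R' ^ 3 * cube_weight m) \<longlonglongrightarrow> K * R' ^ 3 * 0"
    by (intro tendsto_intros summable_LIMSEQ_zero summable_cube_weight)
  then have "\<forall>\<^sub>F m in sequentially. K * R' ^ 3 * cube_weight m < 1"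
    by (intro order_tendstoD) auto
  moreover have "\<forall>\<^sub>F m in sequentially. 2 * R' \<le> real m * \<tau>"
    using \<tau> by real_asymp
  ultimately have *: "\<forall>\<^sub>F m in sequentially. \<forall>z\<in>cball 0 R. norm (barnes_row \<tau> m z - 1) \<le> (2 * K * R' ^ 3) * cube_weight m"
  proof eventually_elim
    case (elim m)
    show ?case
    proof
      fix z :: complex assume "z \<in> cball 0 R"
      then have z: "norm z \<le> R'" by (simp add: R'_def)
      then have "norm (barnes_row \<tau> m z - 1) \<le> exp (K * norm z ^ 3 * cube_weight m) - 1"
        using elim by (intro K) auto
      also have "\<dots> \<le> exp (K * R' ^ 3 * cube_weight m) - 1"
        using K z by (auto intro!: mult_right_mono mult_left_mono power_mono)
      also have "\<dots> \<le> 2 * (K * R' ^ 3 * cube_weight m)"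
        using elim K by (intro exp_minus_one_le) (auto simp: R'_def)
      finally show "norm (barnes_row \<tau> m z - 1) \<le> (2 * K * R' ^ 3) * cube_weight m" by (simp add: mult_ac)
    qed
  qed
  have "2 * K * R' ^ 3 > 0" using K(1) by (simp add: R'_def)
  then show ?thesis using * by (rule that)
qed

lemma barnes_rows_convergent:
  assumes \<tau>: "\<tau> > 0"
  shows "convergent_prod (\<lambda>m. barnes_row \<tau> m z)"
proof -
  obtain K where K: "K > 0" "\<forall>\<^sub>F m in sequentially. \<forall>z\<in>cball 0 (norm z). norm (barnes_row \<tau> m z - 1) \<le> K * cube_weight m"
    by (rule barnes_row_ev_bound[OF \<tau>]) (rule that)
  have "summable (\<lambda>m. norm (barnes_row \<tau> m z - 1))"
  proof (rule summable_comparison_test_ev)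
    show "\<forall>\<^sub>F m in sequentially. norm (norm (barnes_row \<tau> m z - 1)) \<le> K * cube_weight m"
      using K(2) by eventually_elim auto
  qed (intro summable_mult summable_cube_weight)
  then show ?thesis
    by (intro abs_convergent_prod_imp_convergent_prod) (simp add: abs_convergent_prod_conv_summable)
qed

lemma barnes_rows_holomorphic:
  assumes \<tau>: "\<tau> > 0"
  shows "(\<lambda>z. \<Prod>m. barnes_row \<tau> m z) holomorphic_on UNIV"
proof -
  have hol: "barnes_row \<tau> m holomorphic_on A" for m A
    using barnes_row_holomorphic[OF \<tau>] holomorphic_on_subset by blast
  have ul: "uniform_limit (cball 0 R) (\<lambda>N z. \<Prod>m<N. barnes_row \<tau> m z) (\<lambda>z. \<Prod>m. barnes_row \<tau> m z) sequentially" for R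
  proof -
    obtain K where K: "K > 0" "\<forall>\<^sub>F m in sequentially. \<forall>z\<in>cball 0 R. norm (barnes_row \<tau> m z - 1) \<le> K * cube_weight m"
      by (rule barnes_row_ev_bound[OF \<tau>]) (rule that)
    have "uniformly_convergent_on (cball 0 R) (\<lambda>N z. \<Prod>m<N. barnes_row \<tau> m z)"
    proof (rule uniformly_convergent_on_prod')
      show "uniformly_convergent_on (cball 0 R) (\<lambda>N z. \<Sum>m<N. norm (barnes_row \<tau> m z - 1))"
        by (rule Weierstrass_m_test'_ev[where M="\<lambda>m. K * cube_weight m"])
           (use K in \<open>auto intro!: summable_mult summable_cube_weight\<close>)
    qed (intro holomorphic_on_imp_continuous_on hol compact_cball)+
    then obtain g where g: "uniform_limit (cball 0 R) (\<lambda>N z. \<Prod>m<N. barnes_row \<tau> m z) g sequentially"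
      by (auto simp: uniformly_convergent_on_def)
    have eq: "g z = (\<Prod>m. barnes_row \<tau> m z)" if "z \<in> cball 0 R" for z
    proof (rule LIMSEQ_unique)
      show "(\<lambda>n. \<Prod>m<Suc n. barnes_row \<tau> m z) \<longlonglongrightarrow> g z"
        using tendsto_uniform_limitI[OF g that] by (rule LIMSEQ_Suc)
      show "(\<lambda>n. \<Prod>m<Suc n. barnes_row \<tau> m z) \<longlonglongrightarrow> (\<Prod>m. barnes_row \<tau> m z)"
        using convergent_prod_LIMSEQ[OF barnes_rows_convergent[OF \<tau>]]
        unfolding lessThan_Suc_atMost .
    qed
    show ?thesis by (rule uniform_limit_cong[THEN iffD1, OF _ _ g]) (auto simp: eq)
  qed
  show ?thesis
  proof (rule holomorphic_uniform_sequence)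
    fix z :: complex
    have "uniform_limit (cball z 1) (\<lambda>N z. \<Prod>m<N. barnes_row \<tau> m z) (\<lambda>z. \<Prod>m. barnes_row \<tau> m z) sequentially"
      by (rule uniform_limit_on_subset[OF ul[of "norm z + 1"]]) (simp add: cball_subset_cball_iff)
    then show "\<exists>d>0. cball z d \<subseteq> UNIV \<and> uniform_limit (cball z d) (\<lambda>N z. \<Prod>m<N. barnes_row \<tau> m z) (\<lambda>z. \<Prod>m. barnes_row \<tau> m z) sequentially"
      by (intro exI[of _ 1]) auto
  next
    show "(\<lambda>z. \<Prod>m<N. barnes_row \<tau> m z) holomorphic_on UNIV" for N
      by (rule holomorphic_on_prod) (rule hol)
  qed simp
qed

lemma barnes_factor_of_real:
  assumes "\<tau> > 0" "x > 0"
  shows "barnes_factor \<tau> m n (of_real x) = exp (of_real (barnes_log_term \<tau> 1 x m n))"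
proof (cases "m = 0 \<and> n = 0")
  case False
  define u where "u = x / lat \<tau> 1 m n"
  have "lat \<tau> 1 m n > 0" using False assms lat_pos[of \<tau> 1 m n] by auto
  then have u: "u > 0" using assms by (simp add: u_def)
  have "barnes_factor \<tau> m n (of_real x) = of_real ((1 + u) * exp (- u + u\<^sup>2 / 2))"
    using False by (auto simp: barnes_factor_def Let_def u_def lat_def exp_of_real[symmetric])
  also have "(1 + u) * exp (- u + u\<^sup>2 / 2) = exp (ln_tail u)"
  proof -
    have "ln_tail u = ln (1 + u) + (- u + u\<^sup>2 / 2)" by (simp add: ln_tail_def)
    then show ?thesis using u by (simp only: exp_add exp_ln)
  qed
  finally show ?thesis using False by (auto simp: barnes_log_term_def u_def exp_of_real)
qed (auto simp: barnes_factor_def barnes_log_term_def)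

lemma barnes_rows_of_real:
  assumes "\<tau> > 0" "x > 0"
  shows "(\<Prod>m. barnes_row \<tau> m (of_real x)) = of_real (exp (barnes_log_sum \<tau> 1 x))"
proof -
  have s: "summable (barnes_log_term \<tau> 1 x m)" "summable (\<lambda>m. \<Sum>n. barnes_log_term \<tau> 1 x m n)" for m
    using summable_barnes_log_term[of \<tau> 1 x] assms by auto
  have "barnes_row \<tau> m (of_real x) = exp (of_real (\<Sum>n. barnes_log_term \<tau> 1 x m n))" for m
    unfolding barnes_row_def barnes_factor_of_real[OF assms]
    by (subst prodinf_exp) (use s in \<open>auto simp: suminf_of_real summable_of_real\<close>)
  then have "(\<Prod>m. barnes_row \<tau> m (of_real x)) = (\<Prod>m. exp (complex_of_real (\<Sum>n. barnes_log_term \<tau> 1 x m n)))"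
    by simp
  also have "\<dots> = exp (of_real (barnes_log_sum \<tau> 1 x))"
    unfolding barnes_log_sum_def
    using prodinf_exp[OF summable_of_real[OF s(2)], where 'a=complex] s(2)
    by (simp add: suminf_of_real)
  finally show ?thesis by (simp add: exp_of_real)
qed

definition ln_barnes :: "real \<Rightarrow> real \<Rightarrow> real \<Rightarrow> real \<Rightarrow> real" where
  "ln_barnes a b \<tau> x = ln (x / \<tau>) + a * (x / \<tau>) + b * (x\<^sup>2 / (2 * \<tau>)) + barnes_log_sum \<tau> 1 x"

lemma barnes_product_of_real:
  assumes "\<tau> > 0" "x > 0"
  shows "barnes_product a b \<tau> (of_real x) = of_real (exp (ln_barnes a b \<tau> x))"
proof -
  have "exp (ln_barnes a b \<tau> x) = x / \<tau> * exp (a * (x / \<tau>) + b * (x\<^sup>2 / (2 * \<tau>))) * exp (barnes_log_sum \<tau> 1 x)"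
    using assms by (simp add: ln_barnes_def exp_add)
  then show ?thesis
    by (simp add: barnes_product_eq barnes_rows_of_real[OF assms] exp_of_real[symmetric])
qed

lemma barnes_product_holomorphic:
  assumes "\<tau> > 0"
  shows "barnes_product a b \<tau> holomorphic_on A"
proof -
  have "(\<lambda>z. \<Prod>m. barnes_row \<tau> m z) holomorphic_on A"
    using barnes_rows_holomorphic[OF assms] holomorphic_on_subset by blast
  then show ?thesis
    unfolding barnes_product_eq[abs_def] using assms by (intro holomorphic_intros) auto
qed

text \<open>Continuity is inherited from the holomorphic product, whose values on the positive
  half-line are the exponentials of \<open>ln_barnes\<close>; the double series of logarithms itself
  is only handled pointwise.\<close>

lemma ln_barnes_continuous_on:
  assumes "\<tau> > 0"
  shows "continuous_on {0<..} (ln_barnes a b \<tau>)"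
proof -
  have "continuous_on {0<..} (\<lambda>x. ln (Re (barnes_product a b \<tau> (of_real x))))"
    by (intro continuous_intros continuous_on_compose2[OF holomorphic_on_imp_continuous_on[OF barnes_product_holomorphic[OF assms, of a b UNIV]]])
       (auto simp: barnes_product_of_real assms)
  then show ?thesis
    by (subst continuous_on_cong[OF refl, of _ _ "\<lambda>x. ln (Re (barnes_product a b \<tau> (of_real x)))"])
       (auto simp: barnes_product_of_real assms)
qed

section \<open>Functional equations and existence of the constants\<close>

lemma entire_eq_of_pos_reals:
  assumes "f holomorphic_on UNIV" "g holomorphic_on UNIV" "\<And>x. x > 0 \<Longrightarrow> f (of_real x) = g (of_real x)"
  shows "f z = g (z :: complex)"
proof -
  have "f z - g z = 0"
  proof (rule analytic_continuation[where f="\<lambda>z. f z - g z" and S=UNIV and U="of_real ` {0<..}" and \<xi>=1])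
    show "(\<lambda>z. f z - g z) holomorphic_on UNIV" by (intro holomorphic_intros assms)
    have "(\<lambda>n. complex_of_real (1 + 1 / real (Suc n))) \<longlonglongrightarrow> of_real (1 + 0)"
      by (intro tendsto_of_real tendsto_add tendsto_const LIMSEQ_inverse_real_of_nat[unfolded inverse_eq_divide])
    moreover have "complex_of_real (1 + 1 / real (Suc n)) \<in> of_real ` {0<..} - {1}" for n
    proof -
      have "(1 + 1 / real (Suc n)) > 0" "(1 + 1 / real (Suc n)) \<noteq> 1" by (auto intro: add_pos_pos)
      then show ?thesis by (simp del: of_real_add of_nat_Suc)
    qed
    ultimately show "1 islimpt (of_real ` {0<..} :: complex set)"
      unfolding islimpt_sequential by (intro exI[of _ "\<lambda>n. complex_of_real (1 + 1 / real (Suc n))"]) auto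
  qed (use assms(3) in auto)
  then show ?thesis by simp
qed

text \<open>The exponential prefactor changes each shift of the logarithm by an affine function, and
  \<open>a\<close>, \<open>b\<close> are chosen to cancel the affine defect of the shift by 1. The
  affine defect of the shift by \<tau> is then no longer adjustable;
  \<open>barnes_multiplier\<close> shows that it has the required value.\<close>

lemma barnes_constants_exist:
  assumes \<tau>: "\<tau> > 0"
  shows "\<exists>a b. barnes_constants \<tau> a b"
proof -
  obtain p q where pq: "\<And>x. x > 0 \<Longrightarrow>
    barnes_log_sum \<tau> 1 (x + 1) + ln (x + 1) - (barnes_log_sum \<tau> 1 x + ln x) = ln_Gamma (x / \<tau>) + p + q * x"
    using barnes_log_sum_shift[OF \<tau>, of 1] by auto
  obtain p' q' where pq': "\<And>x. x > 0 \<Longrightarrow>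
    barnes_log_sum 1 \<tau> (x + \<tau>) + ln (x + \<tau>) - (barnes_log_sum 1 \<tau> x + ln x) = ln_Gamma (x / 1) + p' + q' * x"
    using barnes_log_sum_shift[OF _ \<tau>, of 1] by auto
  \<comment> \<open>The slope \<open>q\<close> fixes \<open>b\<close> through the quadratic term,
    and the constant \<open>p\<close> then fixes \<open>a\<close>; the correction
    \<open>b / 2\<close> is the part of the constant that the quadratic term already
    contributes.\<close>
  define b where "b = - q * \<tau>"
  define a where "a = - p * \<tau> - b / 2"
  define c where "c = p' + a + b * \<tau> / 2"
  define d where "d = q' + b"
  let ?H = "ln_barnes a b \<tau>"
  let ?G = "barnes_product a b \<tau>"
  have H1: "?H (x + 1) - ?H x = ln_Gamma (x / \<tau>)" if x: "x > 0" for x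
  proof -
    have "?H (x + 1) - ?H x = (ln_Gamma (x / \<tau>) + p + q * x) + a / \<tau> + b * (2 * x + 1) / (2 * \<tau>)"
    proof -
      have "ln ((x + 1) / \<tau>) = ln (x + 1) - ln \<tau>" "ln (x / \<tau>) = ln x - ln \<tau>"
        using x \<tau> by (simp_all add: ln_div)
      moreover have "a * ((x + 1) / \<tau>) = a * (x / \<tau>) + a / \<tau>"
        by (simp add: add_divide_distrib distrib_left)
      moreover have "b * ((x + 1)\<^sup>2 / (2 * \<tau>)) = b * (x\<^sup>2 / (2 * \<tau>)) + b * (2 * x + 1) / (2 * \<tau>)"
        by (simp add: add_divide_distrib[symmetric] power2_eq_square algebra_simps)
      ultimately show ?thesis using pq[OF x] unfolding ln_barnes_def by linarith
    qed
    also have "\<dots> = ln_Gamma (x / \<tau>)"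
    proof -
      have "a / \<tau> = - p - b / 2 / \<tau>" using \<tau> by (simp add: a_def diff_divide_distrib)
      moreover have "b * (2 * x + 1) / (2 * \<tau>) = - q * x + b / 2 / \<tau>"
        using \<tau> by (simp add: b_def divide_simps) (simp add: algebra_simps)
      ultimately show ?thesis by simp
    qed
    finally show ?thesis .
  qed
  have H2: "?H (x + \<tau>) - ?H x = ln_Gamma x + c + d * x" if x: "x > 0" for x
  proof -
    have e: "barnes_log_sum \<tau> 1 y = barnes_log_sum 1 \<tau> y" if "y > 0" for y
      using barnes_log_sum_commute[of \<tau> 1 y] that \<tau> by simp
    have "?H (x + \<tau>) - ?H x = (ln_Gamma (x / 1) + p' + q' * x) + a + b * (2 * x + \<tau>) / 2"
    proof -
      have "ln ((x + \<tau>) / \<tau>) = ln (x + \<tau>) - ln \<tau>" "ln (x / \<tau>) = ln x - ln \<tau>"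
        using x \<tau> by (simp_all add: ln_div)
      moreover have "a * ((x + \<tau>) / \<tau>) = a * (x / \<tau>) + a"
        using \<tau> by (simp add: add_divide_distrib distrib_left)
      moreover have "b * ((x + \<tau>)\<^sup>2 / (2 * \<tau>)) = b * (x\<^sup>2 / (2 * \<tau>)) + b * (2 * x + \<tau>) / 2"
        using \<tau> by (simp add: divide_simps power2_eq_square) (simp add: algebra_simps)
      moreover have "barnes_log_sum \<tau> 1 x = barnes_log_sum 1 \<tau> x" "barnes_log_sum \<tau> 1 (x + \<tau>) = barnes_log_sum 1 \<tau> (x + \<tau>)"
        using x \<tau> by (auto intro: e)
      ultimately show ?thesis using pq'[OF x] unfolding ln_barnes_def by linarith
    qed
    moreover have "b * (2 * x + \<tau>) / 2 = b * x + b * \<tau> / 2" by (simp add: distrib_left add_divide_distrib)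
    ultimately show ?thesis by (simp add: c_def d_def distrib_right)
  qed
  note cd = barnes_multiplier[OF \<tau> ln_barnes_continuous_on[OF \<tau>] H1 H2]
  \<comment> \<open>Dividing out the zero of G at 0 turns the first functional equation into
    \<open>G (z + 1) * rGamma (z / \<tau> + 1) = E z\<close>, an identity between entire functions
    that may be checked on the positive half-line and makes sense at z = 0.\<close>
  define E where "E z = exp (of_real a * (z / of_real \<tau>) + of_real b * (z\<^sup>2 / (2 * of_real \<tau>))) * (\<Prod>m. barnes_row \<tau> m z)" for z
  have GE: "?G z = z / of_real \<tau> * E z" for z
    by (simp add: barnes_product_eq E_def)
  have E_hol: "E holomorphic_on UNIV"
    unfolding E_def[abs_def] using \<tau> by (intro holomorphic_intros barnes_rows_holomorphic) auto
  have G_hol: "?G holomorphic_on A" for A by (rule barnes_product_holomorphic[OF \<tau>])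
  have shift_hol: "(\<lambda>z. ?G (z + w)) holomorphic_on UNIV" for w
  proof -
    have "(\<lambda>z. z + w) holomorphic_on UNIV" by (intro holomorphic_intros)
    from holomorphic_on_compose[OF this G_hol] show ?thesis by (simp add: o_def)
  qed
  have expG: "exp (ln_Gamma x) = Gamma x" if "x > 0" for x :: real
    using Gamma_real_pos_exp[OF that] by simp
  have shift1: "?G (z + 1) * rGamma (z / of_real \<tau> + 1) = E z" for z
  proof (rule entire_eq_of_pos_reals[where f="\<lambda>z. ?G (z + 1) * rGamma (z / of_real \<tau> + 1)", OF _ E_hol])
    show "(\<lambda>z. ?G (z + 1) * rGamma (z / of_real \<tau> + 1)) holomorphic_on UNIV"
      using \<tau> by (intro holomorphic_intros shift_hol) auto
    fix x :: real assume x: "x > 0"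
    have "exp (?H (x + 1)) = Gamma (x / \<tau>) * exp (?H x)"
      using H1[OF x] expG[of "x / \<tau>"] x \<tau> by (simp add: exp_add[symmetric] algebra_simps flip: expG)
    also have "\<dots> * rGamma (x / \<tau> + 1) * (x / \<tau>) = exp (?H x)"
    proof -
      have "Gamma (x / \<tau>) \<noteq> 0" using x \<tau> by (metis Gamma_real_pos divide_pos_pos less_irrefl)
      then have "Gamma (x / \<tau>) * (x / \<tau> * rGamma (x / \<tau> + 1)) = 1"
        unfolding rGamma_plus1 by (simp add: rGamma_inverse_Gamma)
      moreover have "Gamma (x / \<tau>) * exp (?H x) * rGamma (x / \<tau> + 1) * (x / \<tau>) =
        exp (?H x) * (Gamma (x / \<tau>) * (x / \<tau> * rGamma (x / \<tau> + 1)))" by (simp only: mult_ac)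
      ultimately show ?thesis by simp
    qed
    finally have "of_real (exp (?H (x + 1)) * rGamma (x / \<tau> + 1) * (x / \<tau>)) = complex_of_real (exp (?H x))" by simp
    then have "(?G (of_real x + 1) * rGamma (of_real x / of_real \<tau> + 1)) * (of_real x / of_real \<tau>) = ?G (of_real x)"
      using barnes_product_of_real[OF \<tau>, of "x + 1" a b] barnes_product_of_real[OF \<tau>, of x a b] x
        rGamma_complex_of_real[of "x / \<tau> + 1"] by simp
    then show "?G (of_real x + 1) * rGamma (of_real x / of_real \<tau> + 1) = E (of_real x)"
      unfolding GE[of "of_real x"] using x \<tau> by (simp add: mult.commute)
  qed
  \<comment> \<open>The normalization is not imposed: the identity just proved, taken at z = 0,
    reads \<open>G 1 = E 0\<close>, and every factor of E equals 1 at 0.\<close>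
  have G1: "?G 1 = 1"
  proof -
    have "barnes_factor \<tau> m n 0 = 1" for m n by (simp add: barnes_factor_def Let_def)
    then have "barnes_row \<tau> m 0 = 1" for m by (simp add: barnes_row_def)
    then show ?thesis using shift1[of 0] by (simp add: E_def)
  qed
  have feq1: "?G (z + 1) = Gamma (z / of_real \<tau>) * ?G z" if "z / of_real \<tau> \<notin> \<int>\<^sub>\<le>\<^sub>0" for z
  proof -
    have nz: "rGamma (z / of_real \<tau>) \<noteq> 0" using that by (simp add: rGamma_eq_zero_iff)
    have "?G (z + 1) * rGamma (z / of_real \<tau>) = ?G z"
      unfolding GE[of z] shift1[symmetric] rGamma_plus1[of "z / of_real \<tau>", symmetric] by (simp only: mult_ac)
    then show ?thesis using nz by (simp add: Gamma_def divide_simps mult.commute)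
  qed
  have shift2: "?G (z + of_real \<tau>) * rGamma z =
      of_real ((2 * pi) powr ((\<tau> - 1) / 2)) * of_real \<tau> powr (1 / 2 - z) * ?G z" for z
  proof (rule entire_eq_of_pos_reals[where f="\<lambda>z. ?G (z + of_real \<tau>) * rGamma z" and
      g="\<lambda>z. of_real ((2 * pi) powr ((\<tau> - 1) / 2)) * of_real \<tau> powr (1 / 2 - z) * ?G z"])
    show "(\<lambda>z. ?G (z + of_real \<tau>) * rGamma z) holomorphic_on UNIV"
      by (intro holomorphic_intros shift_hol)
    show "(\<lambda>z. of_real ((2 * pi) powr ((\<tau> - 1) / 2)) * of_real \<tau> powr (1 / 2 - z) * ?G z) holomorphic_on UNIV"
      using \<tau> by (intro holomorphic_intros G_hol) auto
    fix x :: real assume x: "x > 0"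
    have "exp (?H (x + \<tau>)) = exp (ln_Gamma x + c + d * x + ?H x)"
      using H2[OF x] by (simp add: algebra_simps)
    also have "\<dots> = Gamma x * (2 * pi) powr ((\<tau> - 1) / 2) * \<tau> powr (1 / 2 - x) * exp (?H x)"
      using \<tau> x by (simp add: cd exp_add exp_diff powr_def expG left_diff_distrib) (simp add: field_simps)
    also have "\<dots> * rGamma x = (2 * pi) powr ((\<tau> - 1) / 2) * \<tau> powr (1 / 2 - x) * exp (?H x)"
      using Gamma_real_pos[OF x] by (simp add: rGamma_inverse_Gamma field_simps)
    finally have "complex_of_real (exp (?H (x + \<tau>)) * rGamma x) = of_real ((2 * pi) powr ((\<tau> - 1) / 2) * \<tau> powr (1 / 2 - x) * exp (?H x))"
      by simp
    moreover have "complex_of_real (\<tau> powr (1 / 2 - x)) = of_real \<tau> powr (1 / 2 - of_real x)"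
      using \<tau> powr_of_real[of \<tau> "1 / 2 - x"] by simp
    ultimately show "?G (of_real x + of_real \<tau>) * rGamma (of_real x) =
      of_real ((2 * pi) powr ((\<tau> - 1) / 2)) * of_real \<tau> powr (1 / 2 - of_real x) * ?G (of_real x)"
      using barnes_product_of_real[OF \<tau>, of "x + \<tau>" a b] barnes_product_of_real[OF \<tau>, of x a b] x \<tau>
        rGamma_complex_of_real[of x] by simp
  qed
  have feq2: "?G (z + of_real \<tau>) = of_real ((2 * pi) powr ((\<tau> - 1) / 2)) * of_real \<tau> powr (1 / 2 - z) * Gamma z * ?G z"
    if "z \<notin> \<int>\<^sub>\<le>\<^sub>0" for z
  proof -
    have nz: "rGamma z \<noteq> 0" using that by (simp add: rGamma_eq_zero_iff)
    then show ?thesis using shift2[of z] by (simp add: Gamma_def divide_simps mult_ac)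
  qed
  have "barnes_constants \<tau> a b"
    unfolding barnes_constants_def Let_def using G1 feq1 feq2 by blast
  then show ?thesis by blast
qed

section \<open>Growth along vertical lines\<close>

text \<open>\<open>vertical_growth f x y t\<close> says that \<open>\<bar>f (x + \<i> t)\<bar> / \<bar>f (y + \<i> t)\<bar>\<close> is at least its value for \<open>t = 0\<close>.\<close>

definition vertical_growth :: "(complex \<Rightarrow> complex) \<Rightarrow> real \<Rightarrow> real \<Rightarrow> real \<Rightarrow> bool" where
  "vertical_growth f x y t \<longleftrightarrow>
     norm (f (Complex y t)) * norm (f (of_real x)) \<le> norm (f (Complex x t)) * norm (f (of_real y))"

lemma vertical_growth_mult:
  assumes "vertical_growth f x y t" "vertical_growth g x y t"
  shows "vertical_growth (\<lambda>z. f z * g z) x y t"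
  using mult_mono[OF assms[unfolded vertical_growth_def]]
  by (simp add: vertical_growth_def norm_mult mult_ac)

text \<open>Adding \<open>t^2\<close> to the squares of the two nonnegative numbers
  \<open>c + x \<le> c + y\<close> moves their ratio closer to 1, hence upwards.\<close>

lemma vertical_growth_linear:
  assumes "0 \<le> c + x" "x \<le> y"
  shows "vertical_growth (\<lambda>z. of_real c + z) x y t"
proof -
  have "(((c + y)\<^sup>2 + t\<^sup>2) * (c + x)\<^sup>2) \<le> (((c + x)\<^sup>2 + t\<^sup>2) * (c + y)\<^sup>2)"
  proof -
    have "(c + x)\<^sup>2 \<le> (c + y)\<^sup>2" using assms by (intro power_mono) auto
    then have "t\<^sup>2 * (c + x)\<^sup>2 \<le> t\<^sup>2 * (c + y)\<^sup>2" by (intro mult_left_mono) auto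
    then show ?thesis by (simp add: algebra_simps)
  qed
  then have "sqrt (((c + y)\<^sup>2 + t\<^sup>2) * (c + x)\<^sup>2) \<le> sqrt (((c + x)\<^sup>2 + t\<^sup>2) * (c + y)\<^sup>2)"
    by (rule real_sqrt_le_mono)
  moreover have "norm (of_real c + Complex u s) = sqrt ((c + u)\<^sup>2 + s\<^sup>2)" for u s
    by (simp add: cmod_def)
  moreover have "norm (complex_of_real c + of_real u) = sqrt ((c + u)\<^sup>2)" for u
    by (simp add: of_real_add[symmetric] del: of_real_add)
  ultimately show ?thesis
    by (simp add: vertical_growth_def real_sqrt_mult)
qed

text \<open>Equality holds: since q is real, \<open>Re (q * z^2) = q * (x^2 - t^2)\<close>, and the
  contribution of t is the same on both vertical lines. Hence neither the convergence factors nor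
  the constants \<open>a\<close>, \<open>b\<close> affect the comparison.\<close>

lemma vertical_growth_exp_quadratic:
  "vertical_growth (\<lambda>z. exp (of_real p * z + of_real q * z\<^sup>2)) x y t"
  unfolding vertical_growth_def norm_exp_eq_Re exp_add[symmetric]
  by (simp add: power2_eq_square algebra_simps)

lemma vertical_growth_const: "vertical_growth (\<lambda>z. c) x y t"
  by (simp add: vertical_growth_def)

text \<open>The cross-multiplied form of the comparison passes to limits without any nonvanishing of
  the denominators.\<close>

lemma vertical_growth_prodinf:
  assumes "\<And>n. vertical_growth (f n) x y t" "\<And>z. convergent_prod (\<lambda>n. f n z)"
  shows "vertical_growth (\<lambda>z. \<Prod>n. f n z) x y t"
  unfolding vertical_growth_def
proof (rule LIMSEQ_le)
  have lim: "(\<lambda>N. norm (\<Prod>n\<le>N. f n z)) \<longlonglongrightarrow> norm (\<Prod>n. f n z)" for z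
    by (intro tendsto_norm convergent_prod_LIMSEQ assms)
  show "(\<lambda>N. norm (\<Prod>n\<le>N. f n (Complex y t)) * norm (\<Prod>n\<le>N. f n (of_real x))) \<longlonglongrightarrow>
     norm (\<Prod>n. f n (Complex y t)) * norm (\<Prod>n. f n (of_real x))"
    by (intro tendsto_mult lim)
  show "(\<lambda>N. norm (\<Prod>n\<le>N. f n (Complex x t)) * norm (\<Prod>n\<le>N. f n (of_real y))) \<longlonglongrightarrow>
     norm (\<Prod>n. f n (Complex x t)) * norm (\<Prod>n. f n (of_real y))"
    by (intro tendsto_mult lim)
  have "norm (\<Prod>n\<le>N. f n (Complex y t)) * norm (\<Prod>n\<le>N. f n (of_real x)) \<le>
        norm (\<Prod>n\<le>N. f n (Complex x t)) * norm (\<Prod>n\<le>N. f n (of_real y))" for N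
    unfolding prod_norm[symmetric] prod.distrib[symmetric]
    by (intro prod_mono) (use assms(1) in \<open>auto simp: vertical_growth_def\<close>)
  then show "\<exists>N. \<forall>n\<ge>N. norm (\<Prod>n\<le>n. f n (Complex y t)) * norm (\<Prod>n\<le>n. f n (of_real x)) \<le>
        norm (\<Prod>n\<le>n. f n (Complex x t)) * norm (\<Prod>n\<le>n. f n (of_real y))" by blast
qed

lemma vertical_growth_barnes_product:
  assumes \<tau>: "\<tau> > 0" and xy: "0 \<le> x" "x \<le> y"
  shows "vertical_growth (barnes_product a b \<tau>) x y t"
proof -
  have factor: "vertical_growth (barnes_factor \<tau> m n) x y t" for m n
  proof (cases "m = 0 \<and> n = 0")
    case True
    then show ?thesis by (simp add: barnes_factor_def[abs_def] vertical_growth_const)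
  next
    case False
    define w where "w = lat \<tau> 1 m n"
    have w: "w > 0" using lat_pos[of \<tau> 1 m n] False \<tau> by (auto simp: w_def)
    have eq: "barnes_factor \<tau> m n = (\<lambda>z. of_real (1 / w) * ((of_real w + z) *
       exp (of_real (- 1 / w) * z + of_real (1 / (2 * w\<^sup>2)) * z\<^sup>2)))"
    proof
      fix z
      have "barnes_factor \<tau> m n z = (1 + z / of_real w) * exp (- (z / of_real w) + (z / of_real w)\<^sup>2 / 2)"
        using False by (auto simp: barnes_factor_def Let_def w_def lat_def)
      also have "1 + z / of_real w = of_real (1 / w) * (of_real w + z)"
        using w by (simp add: field_simps)
      also have "- (z / of_real w) + (z / of_real w)\<^sup>2 / 2 = of_real (- 1 / w) * z + of_real (1 / (2 * w\<^sup>2)) * z\<^sup>2"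
        using w by (simp add: field_simps)
      finally show "barnes_factor \<tau> m n z = of_real (1 / w) * ((of_real w + z) *
         exp (of_real (- 1 / w) * z + of_real (1 / (2 * w\<^sup>2)) * z\<^sup>2))" by (simp only: mult.assoc)
    qed
    show ?thesis
      unfolding eq
      by (intro vertical_growth_mult vertical_growth_const vertical_growth_linear vertical_growth_exp_quadratic)
         (use w xy in auto)
  qed
  have row: "vertical_growth (\<lambda>z. barnes_row \<tau> m z) x y t" for m
    unfolding barnes_row_def by (intro vertical_growth_prodinf factor barnes_row_convergent \<tau>)
  have eq: "barnes_product a b \<tau> = (\<lambda>z. (of_real (1 / \<tau>) * (of_real 0 + z)) *
     (exp (of_real (a / \<tau>) * z + of_real (b / (2 * \<tau>)) * z\<^sup>2)) * (\<Prod>m. barnes_row \<tau> m z))"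
    by (simp add: barnes_product_eq fun_eq_iff)
  show ?thesis
    unfolding eq
    by (intro vertical_growth_mult vertical_growth_prodinf vertical_growth_const vertical_growth_linear
          vertical_growth_exp_quadratic row barnes_rows_convergent \<tau>)
       (use xy in auto)
qed

lemma barnes_product_nonzero:
  assumes \<tau>: "\<tau> > 0" and z: "Re z > 0"
  shows "barnes_product a b \<tau> z \<noteq> 0"
proof -
  have factor: "barnes_factor \<tau> m n z \<noteq> 0" for m n
  proof (cases "m = 0 \<and> n = 0")
    case False
    define w where "w = lat \<tau> 1 m n"
    have w: "w > 0" using lat_pos[of \<tau> 1 m n] False \<tau> by (auto simp: w_def)
    have "Re (1 + z / of_real w) > 0" using w z by (simp add: add_pos_pos)
    then have "1 + z / of_real w \<noteq> 0" by (metis less_irrefl zero_complex.simps(1))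
    then show ?thesis using False by (auto simp: barnes_factor_def Let_def w_def lat_def)
  qed (simp add: barnes_factor_def)
  have "barnes_row \<tau> m z \<noteq> 0" for m
    unfolding barnes_row_def by (rule prodinf_nonzero[OF barnes_row_convergent[OF \<tau>] factor])
  then have "(\<Prod>m. barnes_row \<tau> m z) \<noteq> 0"
    by (rule prodinf_nonzero[OF barnes_rows_convergent[OF \<tau>]])
  moreover have "z \<noteq> 0" using z by auto
  ultimately show ?thesis using \<tau> by (simp add: barnes_product_eq)
qed

text \<open>The linear factors stand in the denominator of Euler's formula for \<Gamma>, so the
  comparison points the opposite way from that for G. The powers of n have a modulus that depends on
  the real part only and cancel.\<close>

lemma Gamma_vertical_growth:
  assumes "0 < x" "x \<le> y"
  shows "norm (Gamma (Complex x t)) * Gamma y \<le> norm (Gamma (Complex y t)) * Gamma x"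
proof (rule LIMSEQ_le)
  have lim: "(\<lambda>n. norm (Gamma_series z n)) \<longlonglongrightarrow> norm (Gamma z)" for z :: complex
    by (intro tendsto_norm Gamma_series_LIMSEQ)
  have Gr: "norm (Gamma (complex_of_real u)) = Gamma u" if "u > 0" for u :: real
    using Gamma_real_pos[OF that] by (simp add: Gamma_complex_of_real)
  show "(\<lambda>n. norm (Gamma_series (Complex x t) n) * norm (Gamma_series (complex_of_real y) n)) \<longlonglongrightarrow>
     norm (Gamma (Complex x t)) * Gamma y"
    using tendsto_mult[OF lim[of "Complex x t"] lim[of "of_real y"]] Gr[of y] assms by simp
  show "(\<lambda>n. norm (Gamma_series (Complex y t) n) * norm (Gamma_series (complex_of_real x) n)) \<longlonglongrightarrow>
     norm (Gamma (Complex y t)) * Gamma x"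
    using tendsto_mult[OF lim[of "Complex y t"] lim[of "of_real x"]] Gr[of x] assms by simp
  have "norm (Gamma_series (Complex x t) n) * norm (Gamma_series (complex_of_real y) n) \<le>
     norm (Gamma_series (Complex y t) n) * norm (Gamma_series (complex_of_real x) n)" for n
  proof -
    define P where "P z = norm (pochhammer z (n + 1))" for z :: complex
    have vg: "vertical_growth (\<lambda>z. \<Prod>k<N. of_real (real k) + z) x y t" for N
    proof (induction N)
      case (Suc N)
      then show ?case
        using vertical_growth_mult[OF Suc vertical_growth_linear[of "real N" x y t]] assms by simp
    qed (simp add: vertical_growth_const)
    have "vertical_growth (\<lambda>z. pochhammer z (n + 1)) x y t"
      unfolding pochhammer_prod using vg[of "n + 1"] by (simp add: add.commute lessThan_atLeast0)
    then have P: "P (Complex y t) * P (of_real x) \<le> P (Complex x t) * P (of_real y)"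
      by (simp add: vertical_growth_def P_def)
    have Pp: "P (Complex u s) > 0" if "u > 0" for u s
    proof -
      have "Complex u s \<noteq> - of_nat k" for k using that by (auto simp: complex_eq_iff)
      then show ?thesis by (auto simp: P_def pochhammer_eq_0_iff)
    qed
    have Pp': "P (of_real u) > 0" if "u > 0" for u
      using Pp[OF that, of 0] by (simp add: complex_of_real_def)
    have S: "norm (Gamma_series (Complex u s) n) = fact n * exp (u * ln (real n)) / P (Complex u s)" for u s
      by (simp add: Gamma_series_def norm_divide norm_mult P_def)
    have S': "norm (Gamma_series (complex_of_real u) n) = fact n * exp (u * ln (real n)) / P (of_real u)" for u
      by (simp add: Gamma_series_def norm_divide norm_mult P_def)
    have "1 / (P (Complex x t) * P (of_real y)) \<le> 1 / (P (Complex y t) * P (of_real x))"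
      using P Pp[of y t] Pp'[of x] Pp[of x t] Pp'[of y] assms by (intro divide_left_mono mult_pos_pos) auto
    then have "fact n * exp (x * ln (real n)) * (fact n * exp (y * ln (real n))) * (1 / (P (Complex x t) * P (of_real y)))
       \<le> fact n * exp (x * ln (real n)) * (fact n * exp (y * ln (real n))) * (1 / (P (Complex y t) * P (of_real x)))"
      by (rule mult_left_mono) simp
    then show ?thesis unfolding S S' by (simp add: mult_ac)
  qed
  then show "\<exists>N. \<forall>n\<ge>N. norm (Gamma_series (Complex x t) n) * norm (Gamma_series (complex_of_real y) n) \<le>
     norm (Gamma_series (Complex y t) n) * norm (Gamma_series (complex_of_real x) n)" by blast
qed

lemma not_nonpos_Int_of_Re_pos: "Re z > 0 \<Longrightarrow> z \<notin> \<int>\<^sub>\<le>\<^sub>0"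
  by (auto elim!: nonpos_Ints_cases)

section \<open>Properties of the double gamma function and bounds for its quotients\<close>

lemma double_gamma_obtain:
  assumes "\<tau> > 0"
  obtains a b where "barnes_constants \<tau> a b" "\<And>z. double_gamma z \<tau> = barnes_product a b \<tau> z"
proof -
  define ab where "ab = (SOME (a, b). barnes_constants \<tau> a b)"
  obtain a b where "ab = (a, b)" by force
  moreover have "(\<lambda>(a, b). barnes_constants \<tau> a b) ab"
    unfolding ab_def using barnes_constants_exist[OF assms] by (rule_tac someI_ex) auto
  ultimately show ?thesis
    by (rule_tac that[of a b]) (simp_all add: double_gamma_def ab_def[symmetric])
qed

lemma double_gamma_holomorphic:
  assumes "\<tau> > 0"
  shows "(\<lambda>z. double_gamma z \<tau>) holomorphic_on A"
  by (rule double_gamma_obtain[OF assms]) (use barnes_product_holomorphic[OF assms] in simp)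

lemma double_gamma_nonzero:
  assumes "\<tau> > 0" "Re z > 0"
  shows "double_gamma z \<tau> \<noteq> 0"
  by (rule double_gamma_obtain[OF assms(1)]) (use barnes_product_nonzero[OF assms] in simp)

lemma double_gamma_plus1:
  assumes "\<tau> > 0" "Re z > 0"
  shows "double_gamma (z + 1) \<tau> = Gamma (z / of_real \<tau>) * double_gamma z \<tau>"
proof -
  have "Re (z / of_real \<tau>) > 0" using assms by simp
  then have "z / of_real \<tau> \<notin> \<int>\<^sub>\<le>\<^sub>0" by (rule not_nonpos_Int_of_Re_pos)
  then show ?thesis
    by (rule_tac double_gamma_obtain[OF assms(1)]) (simp add: barnes_constants_def Let_def)
qed

lemma double_gamma_plus_tau:
  assumes "\<tau> > 0" "Re z > 0"
  shows "double_gamma (z + of_real \<tau>) \<tau> =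
    of_real ((2 * pi) powr ((\<tau> - 1) / 2)) * of_real \<tau> powr (1 / 2 - z) * Gamma z * double_gamma z \<tau>"
proof -
  have "z \<notin> \<int>\<^sub>\<le>\<^sub>0" by (rule not_nonpos_Int_of_Re_pos) fact
  then show ?thesis
    by (rule_tac double_gamma_obtain[OF assms(1)]) (simp add: barnes_constants_def Let_def)
qed

lemma double_gamma_vertical_growth:
  assumes "\<tau> > 0" "0 \<le> x" "x \<le> y"
  shows "vertical_growth (\<lambda>z. double_gamma z \<tau>) x y t"
  by (rule double_gamma_obtain[OF assms(1)]) (use vertical_growth_barnes_product[OF assms] in simp)

lemma double_gamma_quotient_lower_bound:
  assumes "\<tau> > 0" "0 < x" "x \<le> y"
  shows "norm (double_gamma (Complex x t) \<tau> / double_gamma (Complex y t) \<tau>)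
    \<ge> norm (double_gamma (of_real x) \<tau>) / norm (double_gamma (of_real y) \<tau>)"
proof -
  have ratio: "c / d \<le> a / b" if "c * b \<le> a * d" "0 < b" "0 < d" for a b c d :: real
  proof (rule mult_imp_div_pos_le[OF \<open>0 < d\<close>])
    show "c \<le> a / b * d" using mult_imp_le_div_pos[OF \<open>0 < b\<close> that(1)] by simp
  qed
  have "norm (double_gamma (Complex y t) \<tau>) > 0" "norm (double_gamma (of_real y) \<tau>) > 0"
    using assms double_gamma_nonzero[of \<tau> "Complex y t"] double_gamma_nonzero[of \<tau> "of_real y"] by auto
  moreover have "norm (double_gamma (of_real x) \<tau>) * norm (double_gamma (Complex y t) \<tau>) \<le>
      norm (double_gamma (Complex x t) \<tau>) * norm (double_gamma (of_real y) \<tau>)"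
    using double_gamma_vertical_growth[of \<tau> x y t] assms
    unfolding vertical_growth_def by (metis less_imp_le mult.commute)
  ultimately show ?thesis unfolding norm_divide by (intro ratio)
qed

text \<open>For \<open>x < y < x + \<tau>\<close> the quotient \<open>G (y + \<i> t) / G (x + \<i> t)\<close> is compared with
  \<open>G (x + \<tau> + \<i> t) / G (x + \<i> t)\<close>, which is a Gamma value by the second functional equation.\<close>

lemma double_gamma_quotient_lower_bound':
  assumes "\<tau> > 0" "0 < x" "0 < y" "y \<le> x + \<tau>"
  shows "norm (double_gamma (Complex y t) \<tau> / double_gamma (Complex x t) \<tau>)
    \<ge> norm (double_gamma (of_real y) \<tau>) / norm (double_gamma (of_real (x + \<tau>)) \<tau>)
       * ((2 * pi) powr ((\<tau> - 1) / 2) * \<tau> powr (1 / 2 - x)) * norm (Gamma (Complex x t))"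
proof -
  have nz: "double_gamma (Complex x t) \<tau> \<noteq> 0" "double_gamma (Complex (x + \<tau>) t) \<tau> \<noteq> 0"
    using double_gamma_nonzero[of \<tau> "Complex x t"] double_gamma_nonzero[of \<tau> "Complex (x + \<tau>) t"] assms by auto
  have "norm (double_gamma (Complex (x + \<tau>) t) \<tau> / double_gamma (Complex x t) \<tau>) =
     (2 * pi) powr ((\<tau> - 1) / 2) * \<tau> powr (1 / 2 - x) * norm (Gamma (Complex x t))"
  proof -
    have "Complex (x + \<tau>) t = Complex x t + of_real \<tau>" by (simp add: complex_eq_iff)
    then have "double_gamma (Complex (x + \<tau>) t) \<tau> / double_gamma (Complex x t) \<tau> =
      of_real ((2 * pi) powr ((\<tau> - 1) / 2)) * of_real \<tau> powr (1 / 2 - Complex x t) * Gamma (Complex x t)"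
      using nz double_gamma_plus_tau[of \<tau> "Complex x t"] assms by simp
    moreover have "norm (of_real \<tau> powr (1 / 2 - Complex x t)) = \<tau> powr (1 / 2 - x)"
      using assms by (subst norm_powr_real_powr) auto
    ultimately show ?thesis by (simp add: norm_mult)
  qed
  note gam = this
  have low: "norm (double_gamma (Complex y t) \<tau> / double_gamma (Complex (x + \<tau>) t) \<tau>)
    \<ge> norm (double_gamma (of_real y) \<tau>) / norm (double_gamma (of_real (x + \<tau>)) \<tau>)"
    using assms by (intro double_gamma_quotient_lower_bound) auto
  have "double_gamma (Complex y t) \<tau> / double_gamma (Complex x t) \<tau> =
    double_gamma (Complex y t) \<tau> / double_gamma (Complex (x + \<tau>) t) \<tau> *
    (double_gamma (Complex (x + \<tau>) t) \<tau> / double_gamma (Complex x t) \<tau>)"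
    using nz by simp
  then have "norm (double_gamma (Complex y t) \<tau> / double_gamma (Complex x t) \<tau>) =
    norm (double_gamma (Complex y t) \<tau> / double_gamma (Complex (x + \<tau>) t) \<tau>) *
    ((2 * pi) powr ((\<tau> - 1) / 2) * \<tau> powr (1 / 2 - x) * norm (Gamma (Complex x t)))"
    by (simp only: norm_mult gam)
  also have "\<dots> \<ge> norm (double_gamma (of_real y) \<tau>) / norm (double_gamma (of_real (x + \<tau>)) \<tau>) *
    ((2 * pi) powr ((\<tau> - 1) / 2) * \<tau> powr (1 / 2 - x) * norm (Gamma (Complex x t)))"
    by (rule mult_right_mono[OF low]) simp
  finally show ?thesis by (simp only: mult.assoc)
qed

text \<open>On the line Re z = 1/2 one has \<open>1 - z = cnj z\<close>, so the reflection formula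
  gives the modulus exactly.\<close>

lemma norm_Gamma_half: "norm (Gamma (Complex (1/2) t)) ^ 2 = pi / cosh (pi * t)"
proof -
  define z where "z = Complex (1/2) t"
  have "1 - z = cnj z" by (simp add: z_def complex_eq_iff)
  then have "Gamma z * Gamma (cnj z) = of_real pi / sin (of_real pi * z)"
    using Gamma_reflection_complex[of z] by simp
  moreover have "Gamma z * Gamma (cnj z) = of_real (norm (Gamma z) ^ 2)"
    using complex_norm_square[of "Gamma z"] by (simp add: cnj_Gamma)
  moreover have "sin (of_real pi * z) = of_real (cosh (pi * t))"
  proof -
    have "of_real pi * z = of_real (pi * t) * \<i> + of_real pi / 2" by (simp add: z_def complex_eq_iff)
    then have "sin (of_real pi * z) = cos (of_real (pi * t) * \<i>)"
      by (simp add: sin_add mult.commute)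
    also have "\<dots> = of_real (cosh (pi * t))"
      by (simp add: cos_exp_eq cosh_def exp_of_real[symmetric] scaleR_conv_of_real field_simps)
    finally show ?thesis .
  qed
  ultimately have "complex_of_real (norm (Gamma z) ^ 2) = of_real (pi / cosh (pi * t))" by simp
  then show ?thesis unfolding z_def of_real_eq_iff .
qed

text \<open>The exact modulus on the line Re z = 1/2 is carried to the abscissa
  \<open>x + 1\<close>, which lies to the right of 1/2, by the monotone comparison. Returning from
  \<open>x + 1\<close> to \<open>x\<close> divides by \<open>norm (Complex x t)\<close> and costs
  the factor \<open>1 + \<bar>t\<bar>\<close>. Taking the minimum of \<Gamma>(x + 1) makes the
  constant uniform in x.\<close>

lemma norm_Gamma_lower_bound:
  assumes "0 < u" "u \<le> v"
  obtains c where "c > 0" "\<And>t x. u \<le> x \<Longrightarrow> x \<le> v \<Longrightarrow> norm (Gamma (Complex x t)) \<ge> c * exp (- pi * \<bar>t\<bar> / 2) / (1 + \<bar>t\<bar>)"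
proof -
  obtain m where m: "m \<in> {u..v}" "\<And>x. x \<in> {u..v} \<Longrightarrow> Gamma (m + 1) \<le> Gamma (x + 1)"
  proof -
    have "continuous_on {u..v} (\<lambda>x. Gamma (x + 1))"
      using assms by (intro continuous_at_imp_continuous_on ballI isCont_Gamma continuous_intros) (auto elim!: nonpos_Ints_cases)
    then have "\<exists>x\<in>{u..v}. \<forall>y\<in>{u..v}. Gamma (x + 1) \<le> Gamma (y + 1)"
      by (rule continuous_attains_inf[rotated 2]) (use assms in auto)
    then show ?thesis using that by blast
  qed
  define c where "c = Gamma (m + 1) / Gamma (1/2) * sqrt pi / (1 + v)"
  have c: "c > 0" using m assms by (auto simp: c_def intro!: divide_pos_pos mult_pos_pos Gamma_real_pos)
  have "norm (Gamma (Complex x t)) \<ge> c * exp (- pi * \<bar>t\<bar> / 2) / (1 + \<bar>t\<bar>)" if x: "u \<le> x" "x \<le> v" for x t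
  proof -
    have cosh: "cosh (pi * t) \<le> exp (pi * \<bar>t\<bar>)"
    proof -
      have "pi * t \<le> pi * \<bar>t\<bar>" "pi * - t \<le> pi * \<bar>t\<bar>" by (intro mult_left_mono; simp)+
      then have "exp (pi * t) \<le> exp (pi * \<bar>t\<bar>)" "exp (- (pi * t)) \<le> exp (pi * \<bar>t\<bar>)" by auto
      then have "exp (pi * t) + exp (- (pi * t)) \<le> 2 * exp (pi * \<bar>t\<bar>)" by linarith
      then show ?thesis by (simp add: cosh_def)
    qed
    have half: "sqrt pi * exp (- pi * \<bar>t\<bar> / 2) \<le> norm (Gamma (Complex (1/2) t))"
    proof (rule power2_le_imp_le)
      have "(sqrt pi * exp (- pi * \<bar>t\<bar> / 2))\<^sup>2 = pi / exp (pi * \<bar>t\<bar>)"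
      proof -
        have "(exp (- pi * \<bar>t\<bar> / 2))\<^sup>2 = exp (2 * (- pi * \<bar>t\<bar> / 2))" by (rule exp_double[symmetric])
        also have "2 * (- pi * \<bar>t\<bar> / 2) = - (pi * \<bar>t\<bar>)" by simp
        finally have "(exp (- pi * \<bar>t\<bar> / 2))\<^sup>2 = inverse (exp (pi * \<bar>t\<bar>))" by (simp only: exp_minus)
        then show ?thesis unfolding power_mult_distrib by (simp only:) (simp add: inverse_eq_divide)
      qed
      also have "\<dots> \<le> pi / cosh (pi * t)"
        using cosh by (intro divide_left_mono) (auto intro: mult_pos_pos)
      finally show "(sqrt pi * exp (- pi * \<bar>t\<bar> / 2))\<^sup>2 \<le> (norm (Gamma (Complex (1/2) t)))\<^sup>2"
        by (simp add: norm_Gamma_half)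
    qed simp
    have G12: "Gamma (1/2 :: real) > 0" by (rule Gamma_real_pos) simp
    have "norm (Gamma (Complex (1/2) t)) * Gamma (x + 1) \<le> norm (Gamma (Complex (x + 1) t)) * Gamma (1/2)"
      using x assms by (intro Gamma_vertical_growth) auto
    then have "norm (Gamma (Complex (x + 1) t)) \<ge> Gamma (x + 1) / Gamma (1/2) * norm (Gamma (Complex (1/2) t))"
      using G12 by (simp add: field_simps)
    moreover have "Gamma (x + 1) / Gamma (1/2) * norm (Gamma (Complex (1/2) t)) \<ge>
        Gamma (m + 1) / Gamma (1/2) * (sqrt pi * exp (- pi * \<bar>t\<bar> / 2))"
      using m x half G12 assms by (intro mult_mono divide_right_mono) (auto intro!: less_imp_le Gamma_real_pos)
    ultimately have A: "Gamma (m + 1) / Gamma (1/2) * sqrt pi * exp (- pi * \<bar>t\<bar> / 2) \<le> norm (Gamma (Complex (x + 1) t))"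
      by simp
    have "Complex (x + 1) t = Complex x t + 1" by (simp add: complex_eq_iff)
    moreover have "Complex x t \<notin> \<int>\<^sub>\<le>\<^sub>0" using x assms by (intro not_nonpos_Int_of_Re_pos) auto
    ultimately have "norm (Gamma (Complex (x + 1) t)) = norm (Complex x t) * norm (Gamma (Complex x t))"
      by (simp add: Gamma_plus1 norm_mult)
    also have "norm (Complex x t) \<le> (1 + v) * (1 + \<bar>t\<bar>)"
    proof -
      have "norm (Complex x t) \<le> \<bar>x\<bar> + \<bar>t\<bar>" using cmod_le[of "Complex x t"] by simp
      also have "\<dots> \<le> (1 + v) * (1 + \<bar>t\<bar>)"
      proof -
        have "0 \<le> v * \<bar>t\<bar>" using assms by simp
        moreover have "(1 + v) * (1 + \<bar>t\<bar>) = 1 + v + \<bar>t\<bar> + v * \<bar>t\<bar>" by (simp add: algebra_simps)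
        moreover have "\<bar>x\<bar> = x" using x assms(1) by simp
        ultimately show ?thesis using x by linarith
      qed
      finally show ?thesis .
    qed
    finally have B: "norm (Gamma (Complex (x + 1) t)) \<le> (1 + v) * (1 + \<bar>t\<bar>) * norm (Gamma (Complex x t))"
      by (simp add: mult_right_mono)
    have "c * exp (- pi * \<bar>t\<bar> / 2) / (1 + \<bar>t\<bar>) =
      (Gamma (m + 1) / Gamma (1/2) * sqrt pi * exp (- pi * \<bar>t\<bar> / 2)) / ((1 + v) * (1 + \<bar>t\<bar>))"
      by (simp add: c_def)
    also have "\<dots> \<le> norm (Gamma (Complex x t))"
    proof (rule mult_imp_div_pos_le)
      show "0 < (1 + v) * (1 + \<bar>t\<bar>)" using assms by (intro mult_pos_pos) auto
      show "Gamma (m + 1) / Gamma (1/2) * sqrt pi * exp (- pi * \<bar>t\<bar> / 2) \<le>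
         norm (Gamma (Complex x t)) * ((1 + v) * (1 + \<bar>t\<bar>))"
        using order_trans[OF A B] by (simp only: mult.commute)
    qed
    finally show ?thesis .
  qed
  then show ?thesis using c by (intro that[of c]) auto
qed

section \<open>Periodic functions on a vertical strip\<close>

text \<open>Liouville's theorem on the cylinder: a function of period 1 that grows more slowly than
  \<open>exp (2 \<pi> \<bar>Im s\<bar>)\<close> is, as a function of \<open>exp (2 \<pi> \<i> s)\<close>, holomorphic on the punctured plane with removable
  singularities at 0 and \<open>\<infinity>\<close>.\<close>

lemma periodic_on_strip_constant:
  fixes F :: "complex \<Rightarrow> complex"
  assumes hol: "F holomorphic_on {s. 0 < Re s \<and> Re s < 1 + h}" and h: "h > 0"
    and per: "\<And>s. 0 < Re s \<Longrightarrow> Re s < h \<Longrightarrow> F (s + 1) = F s"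
    and c: "0 < c" "c < h"
    and bound: "\<And>s. c \<le> Re s \<Longrightarrow> Re s \<le> c + 1 \<Longrightarrow> norm (F s) \<le> K * exp (3 / 2 * pi * \<bar>Im s\<bar>)"
  obtains w where "\<And>s. 0 < Re s \<Longrightarrow> Re s < 1 + h \<Longrightarrow> F s = w"
proof -
  \<comment> \<open>The periodic extension of F to the plane: the real part is translated into [c, c
    + 1), where the growth bound is available.\<close>
  define E where "E s = F (s - of_int \<lfloor>Re s - c\<rfloor>)" for s
  \<comment> \<open>All translates of s lying in the strip of width 1 + h give the same value of F.
    Because neighbouring strips overlap, E is holomorphic across the lines where the floor function
    jumps.\<close>
  have E_local: "E s = F (s - of_int k)" if "0 < Re s - of_int k" "Re s - of_int k < 1 + h" for s k
  proof -
    define m where "m = \<lfloor>Re s - c\<rfloor>"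
    have m: "of_int m \<le> Re s - c" "Re s - c < of_int m + 1" unfolding m_def by linarith+
    have step: "F (s - of_int j) = F (s - of_int (j + 1))"
      if "0 < Re s - of_int (j + 1)" "Re s - of_int (j + 1) < h" for j
      using per[of "s - of_int (j + 1)"] that by (simp add: algebra_simps)
    have up: "F (s - of_int k) = F (s - of_int (k + int n))" if "Re s - of_int k - real n > 0" for n
      using that
    proof (induction n)
      case (Suc n)
      have "F (s - of_int (k + int n)) = F (s - of_int (k + int n + 1))"
        by (rule step) (use Suc.prems \<open>Re s - of_int k < 1 + h\<close> in auto)
      moreover have "F (s - of_int k) = F (s - of_int (k + int n))"
        by (rule Suc.IH) (use Suc.prems in auto)
      ultimately show ?case by (simp add: algebra_simps)
    qed simp
    have down: "F (s - of_int k) = F (s - of_int (k - int n))" if "Re s - of_int k + real n < 1 + h" for n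
      using that
    proof (induction n)
      case (Suc n)
      have "F (s - of_int (k - int n - 1)) = F (s - of_int (k - int n - 1 + 1))"
        by (rule step) (use Suc.prems \<open>0 < Re s - of_int k\<close> in auto)
      moreover have "F (s - of_int k) = F (s - of_int (k - int n))"
        by (rule Suc.IH) (use Suc.prems in auto)
      ultimately show ?case by (simp add: algebra_simps)
    qed simp
    show ?thesis
    proof (cases "k \<le> m")
      case True
      then obtain n where "m = k + int n" using zle_iff_zadd by blast
      then show ?thesis using up[of n] m c by (simp add: E_def m_def[symmetric])
    next
      case False
      then obtain n where n: "k = m + int n" using zle_iff_zadd[of m k] by auto
      then show ?thesis using down[of n] m c by (simp add: E_def m_def[symmetric])
    qed
  qed
  have E_int: "E (s + of_int k) = E s" for s k
  proof -
    have "\<lfloor>Re (s + of_int k) - c\<rfloor> = \<lfloor>(Re s - c) + of_int k\<rfloor>" by (simp add: algebra_simps)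
    also have "\<dots> = \<lfloor>Re s - c\<rfloor> + k" by (rule floor_add_int[symmetric])
    finally show ?thesis by (simp add: E_def)
  qed
  have E_hol: "E holomorphic_on UNIV"
  proof -
    have "E field_differentiable (at s)" for s
    proof -
      define k where "k = \<lfloor>Re s - c\<rfloor>"
      have k: "of_int k \<le> Re s - c" "Re s - c < of_int k + 1" unfolding k_def by linarith+
      define S where "S = {z. 0 < Re z - of_int k \<and> Re z - of_int k < 1 + h}"
      have S: "open S" unfolding S_def by (intro open_Collect_conj open_Collect_less continuous_intros)
      have sS: "s \<in> S" using k c by (auto simp: S_def)
      have "((\<lambda>z. F (z - of_int k))) holomorphic_on S"
      proof -
        have "(F \<circ> (\<lambda>z. z - of_int k)) holomorphic_on S"
          by (rule holomorphic_on_compose_gen[OF _ hol]) (auto intro: holomorphic_intros simp: S_def)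
        then show ?thesis by (simp add: o_def)
      qed
      then have "E holomorphic_on S"
        by (rule holomorphic_transform) (auto simp: S_def E_local)
      then show ?thesis using S sS holomorphic_on_imp_differentiable_at by blast
    qed
    then show ?thesis by (simp add: holomorphic_on_def field_differentiable_at_within)
  qed
  have E_bound: "norm (E s) \<le> K * exp (3 / 2 * pi * \<bar>Im s\<bar>)" for s
  proof -
    have "c \<le> Re s - of_int \<lfloor>Re s - c\<rfloor>" "Re s - of_int \<lfloor>Re s - c\<rfloor> \<le> c + 1" by linarith+
    then show ?thesis using bound[of "s - of_int \<lfloor>Re s - c\<rfloor>"] by (simp add: E_def)
  qed
  \<comment> \<open>E as a function of w = exp(2 \<pi> i s); by periodicity the branch of the
    logarithm does not influence the value.\<close>
  define g where "g w = E (Ln w / (2 * of_real pi * \<i>))" for w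
  have g_eq: "g w = E (l / (2 * of_real pi * \<i>))" if "exp l = w" for w l
  proof -
    have "w \<noteq> 0" using that by auto
    then have "exp (Ln w) = exp l" using that by simp
    then obtain n where "Ln w = l + (of_int (2 * n) * pi) * \<i>" unfolding exp_eq by blast
    then have "Ln w / (2 * of_real pi * \<i>) = l / (2 * of_real pi * \<i>) + of_int n"
      by (simp add: field_simps)
    then show ?thesis unfolding g_def by (simp add: E_int)
  qed
  have g_hol: "g holomorphic_on UNIV - {0}"
  proof -
    have "g field_differentiable (at w0)" if "w0 \<noteq> 0" for w0
    proof -
      have nz: "w / w0 \<notin> \<real>\<^sub>\<le>\<^sub>0" if "w \<in> ball w0 (norm w0)" for w
      proof
        assume "w / w0 \<in> \<real>\<^sub>\<le>\<^sub>0"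
        then obtain r where r: "r \<le> 0" "w / w0 = of_real r" by (auto elim!: nonpos_Reals_cases)
        then have "w = of_real r * w0" using \<open>w0 \<noteq> 0\<close> by (simp add: field_simps)
        then have "norm (w0 - w) = norm (of_real (1 - r) * w0)" by (simp add: algebra_simps)
        also have "\<dots> = (1 - r) * norm w0" using r by (simp add: norm_mult del: of_real_diff)
        also have "\<dots> \<ge> norm w0" using r by (simp add: algebra_simps mult_nonpos_nonneg)
        finally show False using that by (simp add: dist_norm)
      qed
      have "(\<lambda>w. (Ln (w / w0) + Ln w0) / (2 * of_real pi * \<i>)) holomorphic_on ball w0 (norm w0)"
        using nz that by (intro holomorphic_intros) auto
      from holomorphic_on_compose_gen[OF this E_hol]
      have "(\<lambda>w. E ((Ln (w / w0) + Ln w0) / (2 * of_real pi * \<i>))) holomorphic_on ball w0 (norm w0)"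
        by (simp add: o_def)
      then have "g holomorphic_on ball w0 (norm w0)"
      proof (rule holomorphic_transform)
        fix w assume w: "w \<in> ball w0 (norm w0)"
        have "w / w0 \<noteq> 0" using nz[OF w] by auto
        then have "exp (Ln (w / w0) + Ln w0) = w" using that by (simp add: exp_add)
        then show "E ((Ln (w / w0) + Ln w0) / (2 * of_real pi * \<i>)) = g w" by (simp add: g_eq)
      qed
      then show ?thesis using that holomorphic_on_imp_differentiable_at by (metis centre_in_ball open_ball zero_less_norm_iff)
    qed
    then show ?thesis by (auto simp: holomorphic_on_def field_differentiable_at_within)
  qed
  \<comment> \<open>Here |Im s| = |ln |w|| / (2 \<pi>), which turns the rate 3 \<pi> / 2 into the
    exponent 3/4. That it is below 1 is decisive at both 0 and infinity.\<close>
  have g_bound: "norm (g w) \<le> K * exp (3 / 4 * \<bar>ln (norm w)\<bar>)" if "w \<noteq> 0" for w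
  proof -
    have "Im (Ln w / (2 * of_real pi * \<i>)) = - ln (norm w) / (2 * pi)"
      using that by (simp add: Im_divide power2_eq_square)
    then show ?thesis using E_bound[of "Ln w / (2 * of_real pi * \<i>)"] unfolding g_def
      by (simp add: abs_divide)
  qed
  have K: "K \<ge> 0" using order_trans[OF norm_ge_zero g_bound[of 1]] by simp
  have small: "norm (g w * w) \<le> K * norm w powr (1/4)" if "w \<noteq> 0" "norm w \<le> 1" for w
  proof -
    have "norm (g w * w) \<le> K * exp (3 / 4 * \<bar>ln (norm w)\<bar>) * norm w"
      unfolding norm_mult by (intro mult_right_mono g_bound that) auto
    also have "\<dots> = K * (exp (3 / 4 * \<bar>ln (norm w)\<bar>) * exp (ln (norm w)))"
      using that by simp
    also have "\<dots> = K * exp (3 / 4 * \<bar>ln (norm w)\<bar> + ln (norm w))"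
      by (simp only: exp_add)
    also have "3 / 4 * \<bar>ln (norm w)\<bar> + ln (norm w) = 1 / 4 * ln (norm w)"
    proof -
      have "ln (norm w) \<le> 0" using that by simp
      then show ?thesis by simp
    qed
    finally show ?thesis using that by (simp add: powr_def)
  qed
  \<comment> \<open>Near 0 the function g is of order at most |w| to the power -3/4, so one factor w
    removes the singularity.\<close>
  define G where "G w = (if w = 0 then 0 else g w * w)" for w
  have G_hol: "G holomorphic_on UNIV"
    unfolding G_def
  proof (rule removable_singularity)
    show "(\<lambda>w. g w * w) holomorphic_on UNIV - {0}" by (intro holomorphic_intros g_hol)
    show "(\<lambda>w. g w * w) \<midarrow>0\<rightarrow> 0"
    proof (rule Lim_null_comparison)
      show "\<forall>\<^sub>F w in at 0. norm (g w * w) \<le> K * norm w powr (1/4)"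
        unfolding eventually_at by (intro exI[of _ 1]) (auto intro!: small)
      have "((\<lambda>w::complex. norm w powr (1/4)) \<longlongrightarrow> 0 powr (1/4)) (at 0)"
        by (intro tendsto_powr' tendsto_norm_zero tendsto_intros) auto
      then show "((\<lambda>w::complex. K * norm w powr (1/4)) \<longlongrightarrow> 0) (at 0)"
        by (auto intro!: tendsto_mult_right_zero)
    qed
  qed auto
  have G_growth: "norm (G w) \<le> K * norm w powr (7/4)" if "1 \<le> norm w" for w
  proof -
    have "w \<noteq> 0" using that by auto
    have "norm (g w * w) \<le> K * exp (3 / 4 * \<bar>ln (norm w)\<bar>) * norm w"
      unfolding norm_mult using \<open>w \<noteq> 0\<close> by (intro mult_right_mono g_bound) auto
    also have "\<dots> = K * (exp (3 / 4 * \<bar>ln (norm w)\<bar>) * exp (ln (norm w)))"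
      using \<open>w \<noteq> 0\<close> by simp
    also have "\<dots> = K * exp (3 / 4 * \<bar>ln (norm w)\<bar> + ln (norm w))"
      by (simp only: exp_add)
    also have "3 / 4 * \<bar>ln (norm w)\<bar> + ln (norm w) = 7 / 4 * ln (norm w)"
    proof -
      have "ln (norm w) \<ge> 0" using that by simp
      then show ?thesis by simp
    qed
    finally show ?thesis using \<open>w \<noteq> 0\<close> by (simp add: G_def powr_def)
  qed
  define d where "d k = (deriv ^^ k) G 0 / fact k" for k
  \<comment> \<open>The growth exponent 7/4 is first rounded up to 2, giving a polynomial of degree
    at most 2 that vanishes at 0; afterwards 7/4 < 2 rules out the quadratic term.\<close>
  have G_poly: "G w = d 1 * w + d 2 * w\<^sup>2" for w
  proof -
    have "norm (G w) \<le> K * norm w ^ 2" if "1 \<le> norm w" for w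
    proof -
      have "norm w powr (7/4) \<le> norm w powr 2" using that by (intro powr_mono) auto
      then show ?thesis using G_growth[OF that] K that
        by (simp add: powr_numeral) (meson mult_left_mono order_trans)
    qed
    then have *: "G w = (\<Sum>k\<le>2. d k * w ^ k)" for w
      unfolding d_def by (rule Liouville_polynomial[OF G_hol])
    have "G 0 = d 0" using *[of 0] by (simp add: numeral_2_eq_2)
    then have "d 0 = 0" by (simp add: G_def)
    then show ?thesis using *[of w] by (simp add: numeral_2_eq_2)
  qed
  have "d 2 = 0"
  proof -
    have "norm (d 2) * r \<le> K * r powr (3/4) + norm (d 1)" if r: "r \<ge> 1" for r
    proof -
      have "norm (d 2 * (of_real r)\<^sup>2) \<le> norm (G (of_real r)) + norm (d 1 * of_real r)"
        unfolding G_poly by (metis add_diff_cancel_left' norm_triangle_ineq4)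
      then have "norm (d 2) * r\<^sup>2 \<le> K * r powr (7/4) + norm (d 1) * r"
        using G_growth[of "of_real r"] r by (simp add: norm_mult norm_power)
      also have "r powr (7/4) = r powr (3/4) * r"
        using r powr_add[of r "3/4" 1] by simp
      finally have "(norm (d 2) * r) * r \<le> (K * r powr (3/4) + norm (d 1)) * r"
        by (simp add: power2_eq_square algebra_simps)
      from mult_right_le_imp_le[OF this] show ?thesis using r by simp
    qed
    then have lin: "norm (d 2) * r \<le> K * r powr (3/4) + norm (d 1)" if "r \<ge> 1" for r using that by blast
    have "eventually (\<lambda>r. norm (d 2) \<le> (K * r powr (3/4) + norm (d 1)) / r) at_top"
      using eventually_ge_at_top[of "1::real"]
    proof eventually_elim
      case (elim r)
      then show ?case using lin[OF elim] by (simp add: le_divide_eq)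
    qed
    moreover have "((\<lambda>r::real. (K * r powr (3/4) + norm (d 1)) / r) \<longlongrightarrow> 0) at_top"
      by real_asymp
    ultimately have "norm (d 2) \<le> 0"
      by (intro tendsto_lowerbound[where F=at_top]) auto
    then show ?thesis by simp
  qed
  then have G_lin: "G w = d 1 * w" for w using G_poly by simp
  have "F s = d 1" if "0 < Re s" "Re s < 1 + h" for s
  proof -
    define w where "w = exp (2 * of_real pi * \<i> * s)"
    have "w \<noteq> 0" by (simp add: w_def)
    have "F s = E s" using E_local[of s 0] that by simp
    also have "E s = g w" using g_eq[of "2 * of_real pi * \<i> * s" w] by (simp add: w_def)
    also have "\<dots> = d 1" using G_lin[of w] \<open>w \<noteq> 0\<close> by (simp add: G_def)
    finally show ?thesis .
  qed
  then show ?thesis by (rule that)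
qed

section \<open>The Markov property of killed Levy processes\<close>

definition dyadic :: "nat \<times> nat \<Rightarrow> real" where
  "dyadic p = real (snd p) / 2 ^ fst p"

lemma dyadic_nonneg [simp]: "0 \<le> dyadic p"
  by (simp add: dyadic_def)

text \<open>A pair (N, k) stands for the time k / 2^N. With countably many coordinates,
  finite-dimensional distributions determine the law, and for right-continuous paths functionals of
  the whole path are still measurable functions of the dyadic values.\<close>

definition path_space :: "(nat \<times> nat \<Rightarrow> real) measure" where
  "path_space = Pi\<^sub>M UNIV (\<lambda>_. borel)"

lemma measurable_path_component [measurable]: "(\<lambda>w. w p) \<in> borel_measurable path_space"
  unfolding path_space_def by measurable

locale levy =
  fixes M :: "'a measure" and Y :: "real \<Rightarrow> 'a \<Rightarrow> real"
  assumes levy_process: "levy_process M Y"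

sublocale levy \<subseteq> prob_space M
  using levy_process by (simp add: levy_process_def)

context levy
begin

lemma Y_measurable [measurable (raw)]: "0 \<le> t \<Longrightarrow> Y t \<in> borel_measurable M"
  using levy_process by (simp add: levy_process_def)

lemma Y_0: "AE \<omega> in M. Y 0 \<omega> = 0"
  using levy_process by (simp add: levy_process_def)

lemma indep_increments:
  assumes "0 \<le> t 0" "\<And>i. i < n \<Longrightarrow> t i \<le> t (Suc i)"
  shows "indep_vars (\<lambda>_. borel) (\<lambda>i \<omega>. Y (t (Suc i)) \<omega> - Y (t i) \<omega>) {..<n}"
  using levy_process assms unfolding levy_process_def by blast

lemma increment_law:
  assumes "0 \<le> s" "0 \<le> h"
  shows "distr M borel (\<lambda>\<omega>. Y (s + h) \<omega> - Y s \<omega>) = distr M borel (Y h)"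
  using levy_process assms unfolding levy_process_def by blast

lemma right_continuous:
  assumes "\<omega> \<in> space M" "0 \<le> t"
  shows "((\<lambda>s. Y s \<omega>) \<longlongrightarrow> Y t \<omega>) (at_right t)"
  using levy_process assms unfolding levy_process_def by blast

definition block :: "real \<Rightarrow> real \<Rightarrow> nat \<Rightarrow> 'a \<Rightarrow> nat \<Rightarrow> real" where
  "block u h K \<omega> = (\<lambda>i\<in>{..<K}. Y (u + real (Suc i) * h) \<omega> - Y (u + real i * h) \<omega>)"

lemma block_measurable [measurable]:
  assumes "0 \<le> u" "0 \<le> h"
  shows "block u h K \<in> measurable M (Pi\<^sub>M {..<K} (\<lambda>_. borel))"
  unfolding block_def[abs_def] using assms
  by (intro measurable_restrict borel_measurable_diff Y_measurable add_nonneg_nonneg mult_nonneg_nonneg) auto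

lemma block_law:
  assumes "0 \<le> u" "0 \<le> h" "0 < K"
  shows "distr M (Pi\<^sub>M {..<K} (\<lambda>_. borel)) (block u h K) = Pi\<^sub>M {..<K} (\<lambda>_. distr M borel (Y h))"
proof -
  define D where "D i \<omega> = Y (u + real (Suc i) * h) \<omega> - Y (u + real i * h) \<omega>" for i \<omega>
  have "indep_vars (\<lambda>_. borel) D {..<K}"
    unfolding D_def
    by (rule indep_increments[where t="\<lambda>i. u + real i * h"]) (use assms in \<open>auto simp: mult_right_mono\<close>)
  moreover have rv: "D i \<in> borel_measurable M" for i
    unfolding D_def using assms by (intro borel_measurable_diff Y_measurable add_nonneg_nonneg mult_nonneg_nonneg) auto
  moreover have "{..<K} \<noteq> {}" using assms by auto
  ultimately have "distr M (Pi\<^sub>M {..<K} (\<lambda>_. borel)) (\<lambda>\<omega>. \<lambda>i\<in>{..<K}. D i \<omega>) = Pi\<^sub>M {..<K} (\<lambda>i. distr M borel (D i))"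
    by (subst (asm) indep_vars_iff_distr_eq_PiM') auto
  moreover have "distr M borel (D i) = distr M borel (Y h)" for i
    using increment_law[of "u + real i * h" h] assms by (simp add: D_def[abs_def] algebra_simps)
  ultimately show ?thesis by (simp add: block_def[abs_def] D_def)
qed

text \<open>The increments over the times 0, u, u + h, u + 2h, ... are independent; the first of
  them equals \<open>Y u\<close> almost surely and the remaining ones form the block.\<close>

lemma prob_start_block:
  assumes "0 \<le> u" "0 \<le> h" "B \<in> sets borel" "C \<in> sets (Pi\<^sub>M {..<K} (\<lambda>_. borel))"
  shows "prob {\<omega> \<in> space M. Y u \<omega> \<in> B \<and> block u h K \<omega> \<in> C} =
    prob {\<omega> \<in> space M. Y u \<omega> \<in> B} * prob {\<omega> \<in> space M. block u h K \<omega> \<in> C}"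
proof -
  note assms(3,4)[measurable]
  note [measurable] = block_measurable[OF assms(1,2), of K] Y_measurable[OF assms(1)] Y_measurable[of 0, simplified]
  \<comment> \<open>Time 0 is put in front of the grid, which shifts the block indices by one:
    \<open>block u h K\<close> at i is the increment number \<open>Suc i\<close>.\<close>
  define t where "t i = (if i = 0 then 0 else u + real (i - 1) * h)" for i :: nat
  define D where "D i \<omega> = Y (t (Suc i)) \<omega> - Y (t i) \<omega>" for i \<omega>
  have ind: "indep_vars (\<lambda>_. borel) D {..<Suc K}"
    unfolding D_def
  proof (rule indep_increments)
    show "t i \<le> t (Suc i)" for i
      using assms by (cases i) (auto simp: t_def intro!: mult_right_mono)
  qed (simp add: t_def)
  have "indep_var (Pi\<^sub>M {0} (\<lambda>_. borel)) (\<lambda>\<omega>. restrict (\<lambda>i. D i \<omega>) {0}) (Pi\<^sub>M {Suc 0..<Suc K} (\<lambda>_. borel)) (\<lambda>\<omega>. restrict (\<lambda>i. D i \<omega>) {Suc 0..<Suc K})"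
    by (rule indep_var_restrict[OF ind]) auto
  moreover have "(\<lambda>x. x) \<in> measurable (Pi\<^sub>M {0::nat} (\<lambda>_. borel :: real measure)) (Pi\<^sub>M {0} (\<lambda>_. borel))"
    by simp
  moreover have "(\<lambda>x. \<lambda>i\<in>{..<K}. x (Suc i)) \<in> measurable (Pi\<^sub>M {Suc 0..<Suc K} (\<lambda>_. borel :: real measure)) (Pi\<^sub>M {..<K} (\<lambda>_. borel))"
    by (intro measurable_restrict measurable_component_singleton) auto
  ultimately have "indep_var (Pi\<^sub>M {0} (\<lambda>_. borel)) ((\<lambda>x. x) \<circ> (\<lambda>\<omega>. restrict (\<lambda>i. D i \<omega>) {0})) (Pi\<^sub>M {..<K} (\<lambda>_. borel))
     ((\<lambda>x. \<lambda>i\<in>{..<K}. x (Suc i)) \<circ> (\<lambda>\<omega>. restrict (\<lambda>i. D i \<omega>) {Suc 0..<Suc K}))"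
    by (rule indep_var_compose)
  also have "((\<lambda>x. x) \<circ> (\<lambda>\<omega>. restrict (\<lambda>i. D i \<omega>) {0})) = (\<lambda>\<omega>. restrict (\<lambda>i. D i \<omega>) {0})"
    by (simp add: fun_eq_iff)
  also have "((\<lambda>x. \<lambda>i\<in>{..<K}. x (Suc i)) \<circ> (\<lambda>\<omega>. restrict (\<lambda>i. D i \<omega>) {Suc 0..<Suc K})) = block u h K"
    by (auto simp: fun_eq_iff D_def t_def block_def)
  finally have ind2: "indep_var (Pi\<^sub>M {0} (\<lambda>_. borel)) (\<lambda>\<omega>. restrict (\<lambda>i. D i \<omega>) {0}) (Pi\<^sub>M {..<K} (\<lambda>_. borel)) (block u h K)" .
  define B' where "B' = {x \<in> space (Pi\<^sub>M {0::nat} (\<lambda>_. borel :: real measure)). x 0 \<in> B}"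
  have B': "B' \<in> sets (Pi\<^sub>M {0::nat} (\<lambda>_. borel :: real measure))"
    unfolding B'_def by measurable
  have B'_iff: "restrict (\<lambda>i. D i \<omega>) {0} \<in> B' \<longleftrightarrow> Y u \<omega> - Y 0 \<omega> \<in> B" for \<omega>
    by (auto simp: B'_def D_def t_def space_PiM)
  have "prob ((\<lambda>\<omega>. (restrict (\<lambda>i. D i \<omega>) {0}, block u h K \<omega>)) -` (B' \<times> C) \<inter> space M) =
    prob ((\<lambda>\<omega>. restrict (\<lambda>i. D i \<omega>) {0}) -` B' \<inter> space M) * prob (block u h K -` C \<inter> space M)"
    by (rule indep_varD[OF ind2 B' assms(4)])
  moreover have "(\<lambda>\<omega>. (restrict (\<lambda>i. D i \<omega>) {0}, block u h K \<omega>)) -` (B' \<times> C) \<inter> space M =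
    (\<lambda>\<omega>. (Y u \<omega> - Y 0 \<omega>, block u h K \<omega>)) -` (B \<times> C) \<inter> space M"
    using B'_iff by auto
  moreover have "(\<lambda>\<omega>. restrict (\<lambda>i. D i \<omega>) {0}) -` B' \<inter> space M = (\<lambda>\<omega>. Y u \<omega> - Y 0 \<omega>) -` B \<inter> space M"
    using B'_iff by auto
  moreover have "prob ((\<lambda>\<omega>. (Y u \<omega> - Y 0 \<omega>, block u h K \<omega>)) -` (B \<times> C) \<inter> space M) =
     prob {\<omega> \<in> space M. Y u \<omega> \<in> B \<and> block u h K \<omega> \<in> C}"
  proof (rule measure_eq_AE)
    show "AE x in M. (x \<in> (\<lambda>\<omega>. (Y u \<omega> - Y 0 \<omega>, block u h K \<omega>)) -` (B \<times> C) \<inter> space M) = (x \<in> {\<omega> \<in> space M. Y u \<omega> \<in> B \<and> block u h K \<omega> \<in> C})"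
      using Y_0 by eventually_elim auto
    have "(\<lambda>\<omega>. (Y u \<omega> - Y 0 \<omega>, block u h K \<omega>)) -` (B \<times> C) \<inter> space M = {\<omega> \<in> space M. Y u \<omega> - Y 0 \<omega> \<in> B \<and> block u h K \<omega> \<in> C}"
      by auto
    then show "(\<lambda>\<omega>. (Y u \<omega> - Y 0 \<omega>, block u h K \<omega>)) -` (B \<times> C) \<inter> space M \<in> events" by simp
  qed simp
  moreover have "prob ((\<lambda>\<omega>. Y u \<omega> - Y 0 \<omega>) -` B \<inter> space M) = prob {\<omega> \<in> space M. Y u \<omega> \<in> B}"
  proof (rule measure_eq_AE)
    show "AE x in M. (x \<in> (\<lambda>\<omega>. Y u \<omega> - Y 0 \<omega>) -` B \<inter> space M) = (x \<in> {\<omega> \<in> space M. Y u \<omega> \<in> B})"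
      using Y_0 by eventually_elim auto
  qed measurable
  moreover have "block u h K -` C \<inter> space M = {\<omega> \<in> space M. block u h K \<omega> \<in> C}" by auto
  ultimately show ?thesis by simp
qed

definition shift :: "real \<Rightarrow> 'a \<Rightarrow> nat \<times> nat \<Rightarrow> real" where
  "shift u \<omega> p = Y (u + dyadic p) \<omega> - Y u \<omega>"

lemma shift_measurable [measurable]:
  assumes "0 \<le> u"
  shows "shift u \<in> measurable M path_space"
  unfolding path_space_def shift_def[abs_def] using assms
  by (intro measurable_PiM_single' borel_measurable_diff Y_measurable add_nonneg_nonneg) (auto simp: space_PiM)

text \<open>Both sides are finite measures in E on a countable product, so cylinder sets suffice.
  The finitely many dyadic lags of a cylinder lie on one grid of mesh 2^(-N), on which the shifted
  path consists of partial sums of a block; the block is independent of \<open>Y u\<close>, and its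
  law does not depend on u.\<close>

lemma emeasure_start_shift:
  assumes u: "0 \<le> u" and B: "B \<in> sets borel" and E: "E \<in> sets path_space"
  shows "emeasure M {\<omega> \<in> space M. Y u \<omega> \<in> B \<and> shift u \<omega> \<in> E} =
    emeasure M {\<omega> \<in> space M. Y u \<omega> \<in> B} * emeasure M {\<omega> \<in> space M. shift 0 \<omega> \<in> E}"
proof -
  note [measurable] = Y_measurable[OF u] B shift_measurable[OF u] shift_measurable[OF order_refl]
  define S where "S = {\<omega> \<in> space M. Y u \<omega> \<in> B}"
  have S [measurable]: "S \<in> events" unfolding S_def by measurable
  define P where "P = distr (density M (indicator S)) path_space (shift u)"
  define Q where "Q = density (distr M path_space (shift 0)) (\<lambda>_. emeasure M S)"
  have P: "emeasure P E = emeasure M (S \<inter> {\<omega> \<in> space M. shift u \<omega> \<in> E})" if [measurable]: "E \<in> sets path_space" for E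
  proof -
    have "shift u -` E \<inter> space M = {\<omega> \<in> space M. shift u \<omega> \<in> E}" by auto
    then show ?thesis unfolding P_def
      by (subst emeasure_distr) (auto simp: emeasure_restricted)
  qed
  have Q: "emeasure Q E = emeasure M S * emeasure M {\<omega> \<in> space M. shift 0 \<omega> \<in> E}" if [measurable]: "E \<in> sets path_space" for E
  proof -
    have "shift 0 -` E \<inter> space M = {\<omega> \<in> space M. shift 0 \<omega> \<in> E}" by auto
    then show ?thesis unfolding Q_def
      by (subst emeasure_density_const) (auto simp: emeasure_distr)
  qed
  have "P = Q"
  proof (rule measure_eqI_PiM_infinite[where I=UNIV and M="\<lambda>_. borel"])
    show "sets P = Pi\<^sub>M UNIV (\<lambda>_. borel)" "sets Q = Pi\<^sub>M UNIV (\<lambda>_. borel)"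
      by (simp_all add: P_def Q_def path_space_def)
    show "finite_measure P"
    proof (rule finite_measureI)
      have "space P = space path_space" by (simp add: P_def)
      then show "emeasure P (space P) \<noteq> \<infinity>" by (simp only: P[OF sets.top]) simp
    qed
    fix A :: "nat \<times> nat \<Rightarrow> real set" and J :: "(nat \<times> nat) set"
    assume J: "finite J" and A: "\<And>i. i \<in> J \<Longrightarrow> A i \<in> sets borel"
    define E where "E = prod_emb UNIV (\<lambda>_. borel) J (Pi\<^sub>E J A)"
    have E_eq: "E = {w. \<forall>j\<in>J. w j \<in> A j}"
      by (auto simp: E_def prod_emb_def PiE_iff)
    have E [measurable]: "E \<in> sets path_space"
      unfolding E_def path_space_def using J A by (intro sets_PiM_I) auto
    define N where "N = Max (insert 0 (fst ` J))"
    have N: "fst j \<le> N" if "j \<in> J" for j unfolding N_def using J that by (intro Max_ge) auto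
    define h :: real where "h = 1 / 2 ^ N"
    define \<kappa> where "\<kappa> j = snd j * 2 ^ (N - fst j)" for j :: "nat \<times> nat"
    \<comment> \<open>K bounds every grid index in use; the successor keeps the block nonempty, as
      \<open>block_law\<close> demands, also when J is empty.\<close>
    define K where "K = Suc (\<Sum>j\<in>J. \<kappa> j)"
    have \<kappa>: "\<kappa> j \<le> K" if "j \<in> J" for j
      using member_le_sum[of j J \<kappa>] J that by (simp add: K_def)
    have dy: "dyadic j = real (\<kappa> j) * h" if "j \<in> J" for j
    proof -
      have "(2::real) ^ N = 2 ^ (N - fst j) * 2 ^ fst j" using N[OF that] by (simp add: power_add[symmetric])
      then show ?thesis by (simp add: dyadic_def \<kappa>_def h_def field_simps)
    qed
    have sum_block: "shift v \<omega> j = (\<Sum>i<\<kappa> j. block v h K \<omega> i)" if "j \<in> J" for v \<omega> j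
    proof -
      have "(\<Sum>i<\<kappa> j. block v h K \<omega> i) = (\<Sum>i<\<kappa> j. Y (v + real (Suc i) * h) \<omega> - Y (v + real i * h) \<omega>)"
        using \<kappa>[OF that] by (intro sum.cong) (auto simp: block_def)
      also have "\<dots> = Y (v + real (\<kappa> j) * h) \<omega> - Y (v + real 0 * h) \<omega>"
        by (rule sum_lessThan_telescope[where f="\<lambda>i. Y (v + real i * h) \<omega>"])
      finally show ?thesis using dy[OF that] by (simp add: shift_def)
    qed
    define C where "C = {x \<in> space (Pi\<^sub>M {..<K} (\<lambda>_. borel :: real measure)). \<forall>j\<in>J. (\<Sum>i<\<kappa> j. x i) \<in> A j}"
    have C: "C \<in> sets (Pi\<^sub>M {..<K} (\<lambda>_. borel))"
      unfolding C_def
    proof (rule sets.sets_Collect_finite_All[OF _ J])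
      fix j assume j: "j \<in> J"
      note A[OF j, measurable]
      have "(\<lambda>x. \<Sum>i<\<kappa> j. x i) \<in> borel_measurable (Pi\<^sub>M {..<K} (\<lambda>_. borel :: real measure))"
        using \<kappa>[OF j] by (intro borel_measurable_sum measurable_component_singleton) auto
      then show "{x \<in> space (Pi\<^sub>M {..<K} (\<lambda>_. borel)). (\<Sum>i<\<kappa> j. x i) \<in> A j} \<in> sets (Pi\<^sub>M {..<K} (\<lambda>_. borel))"
        by measurable
    qed
    have h: "h \<ge> 0" by (simp add: h_def)
    have E_block: "shift v \<omega> \<in> E \<longleftrightarrow> block v h K \<omega> \<in> C" for v \<omega>
      by (auto simp: E_eq C_def sum_block space_PiM block_def)
    have "prob {\<omega> \<in> space M. block v h K \<omega> \<in> C} = measure (Pi\<^sub>M {..<K} (\<lambda>_. distr M borel (Y h))) C" if v: "v \<ge> 0" for v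
    proof -
      have "prob {\<omega> \<in> space M. block v h K \<omega> \<in> C} = prob (block v h K -` C \<inter> space M)"
        by (intro arg_cong[where f=prob]) auto
      also have "\<dots> = measure (distr M (Pi\<^sub>M {..<K} (\<lambda>_. borel)) (block v h K)) C"
        using C by (simp add: measure_distr block_measurable v h)
      finally show ?thesis using block_law[OF v h, of K] by (simp add: K_def)
    qed
    then have bl: "prob {\<omega> \<in> space M. block u h K \<omega> \<in> C} = prob {\<omega> \<in> space M. block 0 h K \<omega> \<in> C}"
      using u by simp
    have "emeasure P E = emeasure M {\<omega> \<in> space M. Y u \<omega> \<in> B \<and> block u h K \<omega> \<in> C}"
      unfolding P[OF E] by (intro arg_cong[where f="emeasure M"]) (auto simp: S_def E_block)
    also have "\<dots> = ennreal (prob S * prob {\<omega> \<in> space M. block 0 h K \<omega> \<in> C})"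
      unfolding emeasure_eq_measure prob_start_block[OF u h B C] bl by (simp add: S_def)
    also have "\<dots> = emeasure Q E"
      unfolding Q[OF E] E_block by (simp add: emeasure_eq_measure ennreal_mult)
    finally show "emeasure P (prod_emb UNIV (\<lambda>_. borel) J (Pi\<^sub>E J A)) = emeasure Q (prod_emb UNIV (\<lambda>_. borel) J (Pi\<^sub>E J A))"
      by (simp add: E_def)
  qed
  then have "emeasure P E = emeasure Q E" by simp
  moreover have "S \<inter> {\<omega> \<in> space M. shift u \<omega> \<in> E} = {\<omega> \<in> space M. Y u \<omega> \<in> B \<and> shift u \<omega> \<in> E}"
    by (auto simp: S_def)
  ultimately show ?thesis unfolding P[OF E] Q[OF E] by (simp add: S_def)
qed

lemma start_shift_law:
  assumes u: "0 \<le> u"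
  shows "distr M (borel \<Otimes>\<^sub>M path_space) (\<lambda>\<omega>. (Y u \<omega>, shift u \<omega>)) =
    distr M borel (Y u) \<Otimes>\<^sub>M distr M path_space (shift 0)"
proof (rule pair_measure_eqI[symmetric])
  note [measurable] = Y_measurable[OF u] shift_measurable[OF u] shift_measurable[OF order_refl]
  show "sigma_finite_measure (distr M borel (Y u))" "sigma_finite_measure (distr M path_space (shift 0))"
    by (intro finite_measure.axioms(1) prob_space.axioms(1) prob_space_distr; measurable)+
  show "sets (distr M borel (Y u) \<Otimes>\<^sub>M distr M path_space (shift 0)) =
    sets (distr M (borel \<Otimes>\<^sub>M path_space) (\<lambda>\<omega>. (Y u \<omega>, shift u \<omega>)))"
    by (simp cong: sets_pair_measure_cong)
  fix B E assume "B \<in> sets (distr M borel (Y u))" "E \<in> sets (distr M path_space (shift 0))"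
  then have [measurable]: "B \<in> sets borel" "E \<in> sets path_space" by auto
  have "emeasure (distr M (borel \<Otimes>\<^sub>M path_space) (\<lambda>\<omega>. (Y u \<omega>, shift u \<omega>))) (B \<times> E) =
     emeasure M {\<omega> \<in> space M. Y u \<omega> \<in> B \<and> shift u \<omega> \<in> E}"
    by (subst emeasure_distr) (auto intro!: arg_cong[where f="emeasure M"])
  also have "\<dots> = emeasure M {\<omega> \<in> space M. Y u \<omega> \<in> B} * emeasure M {\<omega> \<in> space M. shift 0 \<omega> \<in> E}"
    by (rule emeasure_start_shift[OF u]) measurable
  also have "{\<omega> \<in> space M. Y u \<omega> \<in> B} = Y u -` B \<inter> space M" by auto
  also have "{\<omega> \<in> space M. shift 0 \<omega> \<in> E} = shift 0 -` E \<inter> space M" by auto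
  finally show "emeasure (distr M borel (Y u)) B * emeasure (distr M path_space (shift 0)) E =
     emeasure (distr M (borel \<Otimes>\<^sub>M path_space) (\<lambda>\<omega>. (Y u \<omega>, shift u \<omega>))) (B \<times> E)"
    by (simp add: emeasure_distr)
qed

end

text \<open>For \<open>t \<ge> 0\<close> this is the index of the first dyadic number of level N
  strictly to the right of t. Strictness makes the approximation stay in \<open>at_right\<close>,
  where right continuity applies.\<close>

definition grid :: "nat \<Rightarrow> real \<Rightarrow> nat" where
  "grid N t = nat \<lfloor>t * 2 ^ N\<rfloor> + 1"

lemma measurable_grid [measurable]: "grid N \<in> measurable borel (count_space UNIV)"
  unfolding grid_def[abs_def] by measurable

lemma dyadic_grid:
  assumes "0 \<le> t"
  shows "t < dyadic (N, grid N t)" "dyadic (N, grid N t) \<le> t + 1 / 2 ^ N"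
proof -
  have "real (grid N t) = of_int \<lfloor>t * 2 ^ N\<rfloor> + 1" using assms by (simp add: grid_def)
  then have *: "t * 2 ^ N < real (grid N t)" "real (grid N t) \<le> t * 2 ^ N + 1" by linarith+
  then show "t < dyadic (N, grid N t)" by (simp add: dyadic_def less_divide_eq)
  have "real (grid N t) / 2 ^ N \<le> (t * 2 ^ N + 1) / 2 ^ N" using * by (intro divide_right_mono) auto
  then show "dyadic (N, grid N t) \<le> t + 1 / 2 ^ N" by (simp add: dyadic_def add_divide_distrib)
qed

lemma dyadic_grid_tendsto:
  assumes "0 \<le> t"
  shows "filterlim (\<lambda>N. u + dyadic (N, grid N t)) (at_right (u + t)) sequentially"
proof (rule tendsto_imp_filterlim_at_right)
  have "(\<lambda>N. dyadic (N, grid N t)) \<longlonglongrightarrow> t"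
  proof (rule tendsto_sandwich[where f="\<lambda>_. t" and h="\<lambda>N. t + 1 / 2 ^ N"])
    show "(\<lambda>N. t + 1 / 2 ^ N) \<longlonglongrightarrow> t" by real_asymp
  qed (use dyadic_grid[OF assms] in \<open>auto intro!: always_eventually less_imp_le\<close>)
  then show "(\<lambda>N. u + dyadic (N, grid N t)) \<longlonglongrightarrow> u + t" by (intro tendsto_intros)
qed (use dyadic_grid[OF assms] in auto)

text \<open>The integrand of the exponential functional as a function on \<open>path_space\<close>; the lower limit recovers
  \<open>exp (- \<alpha> w\<^sub>v)\<close> for right-continuous paths and is measurable in general.\<close>

definition exp_path :: "real \<Rightarrow> (nat \<times> nat \<Rightarrow> real) \<Rightarrow> real \<Rightarrow> ennreal" where
  "exp_path \<alpha> w v = liminf (\<lambda>N. ennreal (exp (- \<alpha> * w (N, grid N v))))"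

lemma measurable_exp_path [measurable]:
  "(\<lambda>(w, v). exp_path \<alpha> w v) \<in> borel_measurable (path_space \<Otimes>\<^sub>M borel)"
proof -
  have [measurable]: "(\<lambda>x. fst x (N, grid N (snd x))) \<in> borel_measurable (path_space \<Otimes>\<^sub>M (borel :: real measure))" for N
    by (rule measurable_compose_countable[where f="\<lambda>k x. fst x (N, k)" and g="\<lambda>x. grid N (snd x)"]) measurable
  show ?thesis unfolding exp_path_def case_prod_beta by measurable
qed

definition path_functional :: "real \<Rightarrow> (nat \<times> nat \<Rightarrow> real) \<Rightarrow> ennreal \<Rightarrow> ennreal" where
  "path_functional \<alpha> w z = (\<integral>\<^sup>+v. exp_path \<alpha> w v * indicator {v. 0 \<le> v \<and> ennreal v < z} v \<partial>lborel)"

lemma measurable_path_functional [measurable]: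
  "(\<lambda>(w, z). path_functional \<alpha> w z) \<in> borel_measurable (path_space \<Otimes>\<^sub>M borel)"
proof -
  have "(\<lambda>x. exp_path \<alpha> (fst (fst x)) (snd x)) \<in> borel_measurable ((path_space \<Otimes>\<^sub>M (borel :: ennreal measure)) \<Otimes>\<^sub>M lborel)"
    using measurable_compose[OF _ measurable_exp_path[of \<alpha>], of "\<lambda>x. (fst (fst x), snd x)"] by simp
  moreover have "(\<lambda>x. indicator {v. 0 \<le> v \<and> ennreal v < snd (fst x)} (snd x) :: ennreal) \<in> borel_measurable ((path_space \<Otimes>\<^sub>M (borel :: ennreal measure)) \<Otimes>\<^sub>M lborel)"
    unfolding indicator_def by measurable
  ultimately have "(\<lambda>x. exp_path \<alpha> (fst (fst x)) (snd x) * indicator {v. 0 \<le> v \<and> ennreal v < snd (fst x)} (snd x)) \<in> borel_measurable ((path_space \<Otimes>\<^sub>M (borel :: ennreal measure)) \<Otimes>\<^sub>M lborel)"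
    by (rule borel_measurable_times_ennreal)
  then show ?thesis
    unfolding path_functional_def case_prod_beta
    by (intro lborel.borel_measurable_nn_integral) (simp add: case_prod_beta)
qed

context levy
begin

lemma Y_grid_tendsto:
  assumes "\<omega> \<in> space M" "0 \<le> u" "0 \<le> t"
  shows "(\<lambda>N. Y (u + dyadic (N, grid N t)) \<omega>) \<longlonglongrightarrow> Y (u + t) \<omega>"
  using filterlim_compose[OF right_continuous dyadic_grid_tendsto] assms by simp

lemma exp_path_shift:
  assumes "\<omega> \<in> space M" "0 \<le> u" "0 \<le> v"
  shows "exp_path \<alpha> (shift u \<omega>) v = ennreal (exp (- \<alpha> * (Y (u + v) \<omega> - Y u \<omega>)))"
  unfolding exp_path_def shift_def
  by (rule lim_imp_Liminf) (auto intro!: tendsto_intros Y_grid_tendsto assms)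

definition Ym :: "real \<Rightarrow> 'a \<Rightarrow> real" where
  "Ym t \<omega> = (if 0 \<le> t then Y t \<omega> else 0)"

text \<open>By right continuity the process is a pointwise limit of processes that are constant in
  time on dyadic intervals, and these are jointly measurable because the grid index takes countably
  many values.\<close>

lemma Ym_measurable [measurable]: "(\<lambda>(t, \<omega>). Ym t \<omega>) \<in> borel_measurable (borel \<Otimes>\<^sub>M M)"
  unfolding case_prod_beta
proof (rule borel_measurable_LIMSEQ_real)
  fix x :: "real \<times> 'a" assume "x \<in> space (borel \<Otimes>\<^sub>M M)"
  then have "snd x \<in> space M" by (auto simp: space_pair_measure)
  then show "(\<lambda>N. if 0 \<le> fst x then Y (dyadic (N, grid N (fst x))) (snd x) else 0) \<longlonglongrightarrow> Ym (fst x) (snd x)"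
    using Y_grid_tendsto[of "snd x" 0 "fst x"] by (simp add: Ym_def)
next
  fix N
  have Yk: "Y (dyadic (N, k)) \<in> borel_measurable M" for k by (rule Y_measurable) simp
  have "(\<lambda>x. Y (dyadic (N, grid N (fst x))) (snd x)) \<in> borel_measurable (borel \<Otimes>\<^sub>M M)"
    by (rule measurable_compose_countable[where f="\<lambda>k x. Y (dyadic (N, k)) (snd x)" and g="\<lambda>x. grid N (fst x)"])
       (auto intro: measurable_compose[OF measurable_snd Yk])
  then show "(\<lambda>x. if 0 \<le> fst x then Y (dyadic (N, grid N (fst x))) (snd x) else 0) \<in> borel_measurable (borel \<Otimes>\<^sub>M M)"
    by measurable
qed

lemma Ym_measurable_fst: "\<omega> \<in> space M \<Longrightarrow> (\<lambda>t. Ym t \<omega>) \<in> borel_measurable borel"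
  using measurable_compose[OF measurable_Pair2' Ym_measurable] by simp

lemma Ym_measurable_snd [measurable]: "Ym t \<in> borel_measurable M"
  unfolding Ym_def[abs_def] by (cases "0 \<le> t") (auto intro: Y_measurable)

definition tail :: "real \<Rightarrow> real \<Rightarrow> ennreal \<Rightarrow> 'a \<Rightarrow> ennreal" where
  "tail \<alpha> u z \<omega> = (\<integral>\<^sup>+t. ennreal (exp (- \<alpha> * Ym t \<omega>)) * indicator {t. u \<le> t \<and> ennreal t < z} t \<partial>lborel)"

text \<open>Substituting t = u + v and factoring out exp(- \<alpha> Y_u) leaves the same functional
  of the path restarted at u, with remaining lifetime z - u.\<close>

lemma tail_eq:
  assumes "\<omega> \<in> space M" "0 \<le> u" "ennreal u < z"
  shows "tail \<alpha> u z \<omega> = ennreal (exp (- \<alpha> * Y u \<omega>)) * path_functional \<alpha> (shift u \<omega>) (z - ennreal u)"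
proof -
  note [measurable] = Ym_measurable_fst[OF assms(1)]
  have ind: "indicator {t. u \<le> t \<and> ennreal t < z} (u + v) = (indicator {v. 0 \<le> v \<and> ennreal v < z - ennreal u} v :: ennreal)" for v
  proof (cases "0 \<le> v")
    case True
    have "ennreal (u + v) < z \<longleftrightarrow> ennreal v < z - ennreal u"
    proof (cases z)
      case (real r)
      then show ?thesis using True assms by (auto simp: ennreal_less_iff ennreal_minus simp del: ennreal_plus)
    qed simp
    then show ?thesis using True by (simp add: indicator_def)
  qed (simp add: indicator_def)
  have "tail \<alpha> u z \<omega> = (\<integral>\<^sup>+v. ennreal (exp (- \<alpha> * Ym (u + v) \<omega>)) * indicator {t. u \<le> t \<and> ennreal t < z} (u + v) \<partial>lborel)"
    unfolding tail_def
    using nn_integral_real_affine[of "\<lambda>t. ennreal (exp (- \<alpha> * Ym t \<omega>)) * indicator {t. u \<le> t \<and> ennreal t < z} t" 1 u]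
    by (simp add: mult.commute)
  also have "\<dots> = (\<integral>\<^sup>+v. ennreal (exp (- \<alpha> * Y u \<omega>)) * (exp_path \<alpha> (shift u \<omega>) v * indicator {v. 0 \<le> v \<and> ennreal v < z - ennreal u} v) \<partial>lborel)"
  proof (intro nn_integral_cong)
    fix v :: real
    show "ennreal (exp (- \<alpha> * Ym (u + v) \<omega>)) * indicator {t. u \<le> t \<and> ennreal t < z} (u + v) =
      ennreal (exp (- \<alpha> * Y u \<omega>)) * (exp_path \<alpha> (shift u \<omega>) v * indicator {v. 0 \<le> v \<and> ennreal v < z - ennreal u} v)"
    proof (cases "0 \<le> v")
      case True
      then have "ennreal (exp (- \<alpha> * Ym (u + v) \<omega>)) = ennreal (exp (- \<alpha> * Y u \<omega>)) * exp_path \<alpha> (shift u \<omega>) v"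
        using assms by (simp add: exp_path_shift Ym_def ennreal_mult[symmetric] exp_add[symmetric] algebra_simps)
      then show ?thesis by (simp add: ind mult.assoc)
    next
      case False
      then show ?thesis by (simp add: indicator_def)
    qed
  qed
  also have "\<dots> = ennreal (exp (- \<alpha> * Y u \<omega>)) * path_functional \<alpha> (shift u \<omega>) (z - ennreal u)"
    unfolding path_functional_def
  proof (rule nn_integral_cmult)
    have "shift u \<omega> \<in> space path_space" by (simp add: path_space_def space_PiM)
    then have [measurable]: "exp_path \<alpha> (shift u \<omega>) \<in> borel_measurable borel"
      using measurable_compose[OF measurable_Pair1' measurable_exp_path] by simp
    show "(\<lambda>v. exp_path \<alpha> (shift u \<omega>) v * indicator {v. 0 \<le> v \<and> ennreal v < z - ennreal u} v) \<in> borel_measurable lborel"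
    proof (rule borel_measurable_times_ennreal)
      have "{v. 0 \<le> v \<and> ennreal v < z - ennreal u} \<in> sets borel" by measurable
      then show "(indicator {v. 0 \<le> v \<and> ennreal v < z - ennreal u} :: real \<Rightarrow> ennreal) \<in> borel_measurable lborel"
        by simp
    qed simp
  qed
  finally show ?thesis .
qed

lemma expectation_exp_add:
  assumes "0 \<le> s" "0 \<le> t"
  shows "(\<integral>\<^sup>+\<omega>. ennreal (exp (c * Y (s + t) \<omega>)) \<partial>M) =
    (\<integral>\<^sup>+\<omega>. ennreal (exp (c * Y s \<omega>)) \<partial>M) * (\<integral>\<^sup>+\<omega>. ennreal (exp (c * Y t \<omega>)) \<partial>M)"
proof -
  define T where "T i = (if i = 0 then 0 else if i = 1 then s else s + t)" for i :: nat
  define D where "D i \<omega> = Y (T (Suc i)) \<omega> - Y (T i) \<omega>" for i \<omega>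
  have T: "0 \<le> T i" for i using assms by (simp add: T_def)
  have "indep_vars (\<lambda>_. borel) D {..<2}"
    unfolding D_def by (rule indep_increments) (use assms in \<open>auto simp: T_def less_2_cases_iff\<close>)
  then have "indep_vars (\<lambda>_. borel) (\<lambda>i \<omega>. ennreal (exp (c * D i \<omega>))) {..<2}"
    by (rule indep_vars_compose2[where Y="\<lambda>i x. ennreal (exp (c * x))"]) measurable
  then have "(\<integral>\<^sup>+\<omega>. (\<Prod>i<2. ennreal (exp (c * D i \<omega>))) \<partial>M) = (\<Prod>i<2. \<integral>\<^sup>+\<omega>. ennreal (exp (c * D i \<omega>)) \<partial>M)"
    by (intro indep_vars_nn_integral) auto
  then have "(\<integral>\<^sup>+\<omega>. ennreal (exp (c * D 0 \<omega>)) * ennreal (exp (c * D 1 \<omega>)) \<partial>M) =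
     (\<integral>\<^sup>+\<omega>. ennreal (exp (c * D 0 \<omega>)) \<partial>M) * (\<integral>\<^sup>+\<omega>. ennreal (exp (c * D 1 \<omega>)) \<partial>M)"
    by (simp add: numeral_2_eq_2)
  moreover have "(\<integral>\<^sup>+\<omega>. ennreal (exp (c * D 0 \<omega>)) * ennreal (exp (c * D 1 \<omega>)) \<partial>M) = (\<integral>\<^sup>+\<omega>. ennreal (exp (c * Y (s + t) \<omega>)) \<partial>M)"
  proof (rule nn_integral_cong_AE)
    show "AE \<omega> in M. ennreal (exp (c * D 0 \<omega>)) * ennreal (exp (c * D 1 \<omega>)) = ennreal (exp (c * Y (s + t) \<omega>))"
      using Y_0 by eventually_elim (simp add: D_def T_def ennreal_mult[symmetric] exp_add[symmetric] algebra_simps)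
  qed
  moreover have "(\<integral>\<^sup>+\<omega>. ennreal (exp (c * D 0 \<omega>)) \<partial>M) = (\<integral>\<^sup>+\<omega>. ennreal (exp (c * Y s \<omega>)) \<partial>M)"
  proof (rule nn_integral_cong_AE)
    show "AE \<omega> in M. ennreal (exp (c * D 0 \<omega>)) = ennreal (exp (c * Y s \<omega>))"
      using Y_0 by eventually_elim (simp add: D_def T_def)
  qed
  moreover have "(\<integral>\<^sup>+\<omega>. ennreal (exp (c * D 1 \<omega>)) \<partial>M) = (\<integral>\<^sup>+\<omega>. ennreal (exp (c * Y t \<omega>)) \<partial>M)"
  proof -
    note [measurable] = Y_measurable[OF assms(2)] Y_measurable[OF assms(1)] Y_measurable[of "s + t"]
    have "(\<integral>\<^sup>+\<omega>. ennreal (exp (c * D 1 \<omega>)) \<partial>M) = (\<integral>\<^sup>+x. ennreal (exp (c * x)) \<partial>distr M borel (\<lambda>\<omega>. Y (s + t) \<omega> - Y s \<omega>))"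
      using assms by (subst nn_integral_distr) (auto simp: D_def T_def)
    also have "\<dots> = (\<integral>\<^sup>+\<omega>. ennreal (exp (c * Y t \<omega>)) \<partial>M)"
      unfolding increment_law[OF assms] by (subst nn_integral_distr) auto
    finally show ?thesis .
  qed
  ultimately show ?thesis by simp
qed

text \<open>Multiplicativity in t gives the formula at dyadic times, and Fatou's lemma along dyadic
  times decreasing to t gives the upper bound for every t.\<close>

lemma expectation_exp:
  assumes fin: "(\<integral>\<^sup>+\<omega>. ennreal (exp (c * Y 1 \<omega>)) \<partial>M) = ennreal (exp a)" and t: "0 \<le> t"
  shows "(\<integral>\<^sup>+\<omega>. ennreal (exp (c * Y t \<omega>)) \<partial>M) = ennreal (exp (a * t))"
proof -
  define \<phi> where "\<phi> t = (\<integral>\<^sup>+\<omega>. ennreal (exp (c * Y t \<omega>)) \<partial>M)" for t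
  have add: "\<phi> (s + t) = \<phi> s * \<phi> t" if "0 \<le> s" "0 \<le> t" for s t
    unfolding \<phi>_def by (rule expectation_exp_add[OF that])
  have zero: "\<phi> 0 = 1"
  proof -
    have "\<phi> 0 = (\<integral>\<^sup>+\<omega>. 1 \<partial>M)"
      unfolding \<phi>_def using Y_0 by (intro nn_integral_cong_AE) (auto elim!: eventually_mono)
    then show ?thesis by (simp add: emeasure_space_1)
  qed
  have mult: "\<phi> (real k * h) = \<phi> h ^ k" if "0 \<le> h" for k h
  proof (induction k)
    case (Suc k)
    have "real (Suc k) * h = real k * h + h" by (simp add: algebra_simps)
    then show ?case using add[of "real k * h" h] that Suc by (simp add: mult.commute)
  qed (simp add: zero)
  have root: "\<phi> (1 / 2 ^ N) = ennreal (exp (a / 2 ^ N))" for N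
  proof -
    have p: "\<phi> (1 / 2 ^ N) ^ (2 ^ N) = ennreal (exp a)"
      using mult[of "1 / 2 ^ N" "2 ^ N"] fin by (simp add: \<phi>_def)
    then have "\<phi> (1 / 2 ^ N) \<noteq> \<infinity>" by (auto simp: power_eq_top_ennreal top_unique)
    then obtain r where r: "\<phi> (1 / 2 ^ N) = ennreal r" "0 \<le> r" by (cases "\<phi> (1 / 2 ^ N)") auto
    have "r ^ (2 ^ N) = exp a" using p r by (simp add: ennreal_power)
    also have "exp a = exp (a / 2 ^ N) ^ (2 ^ N)" by (simp add: exp_of_nat_mult[symmetric])
    finally have eq: "r ^ (2 ^ N) = exp (a / 2 ^ N) ^ (2 ^ N)" .
    have "r = exp (a / 2 ^ N)" by (rule power_eq_imp_eq_base[OF eq]) (use r in auto)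
    then show ?thesis using r by simp
  qed
  have dy: "\<phi> (dyadic p) = ennreal (exp (a * dyadic p))" for p
  proof -
    have "\<phi> (dyadic p) = \<phi> (1 / 2 ^ fst p) ^ snd p"
      using mult[of "1 / 2 ^ fst p" "snd p"] by (simp add: dyadic_def)
    also have "\<dots> = ennreal (exp (a / 2 ^ fst p) ^ snd p)" by (simp add: root ennreal_power)
    also have "exp (a / 2 ^ fst p) ^ snd p = exp (a * dyadic p)"
      by (simp add: dyadic_def exp_of_nat_mult[symmetric] mult.commute)
    finally show ?thesis .
  qed
  have upper: "\<phi> t \<le> ennreal (exp (a * t))" if t: "0 \<le> t" for t
  proof -
    have "\<phi> t = (\<integral>\<^sup>+\<omega>. liminf (\<lambda>N. ennreal (exp (c * Y (dyadic (N, grid N t)) \<omega>))) \<partial>M)"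
      unfolding \<phi>_def
    proof (intro nn_integral_cong lim_imp_Liminf[symmetric])
      fix \<omega> assume "\<omega> \<in> space M"
      then show "(\<lambda>N. ennreal (exp (c * Y (dyadic (N, grid N t)) \<omega>))) \<longlonglongrightarrow> ennreal (exp (c * Y t \<omega>))"
        using Y_grid_tendsto[of \<omega> 0 t] t by (intro tendsto_intros) auto
    qed simp
    also have "\<dots> \<le> liminf (\<lambda>N. \<integral>\<^sup>+\<omega>. ennreal (exp (c * Y (dyadic (N, grid N t)) \<omega>)) \<partial>M)"
    proof (rule nn_integral_liminf)
      show "(\<lambda>\<omega>. ennreal (exp (c * Y (dyadic (N, grid N t)) \<omega>))) \<in> borel_measurable M" for N
        using Y_measurable[of "dyadic (N, grid N t)"] by measurable
    qed
    also have "\<dots> = liminf (\<lambda>N. ennreal (exp (a * dyadic (N, grid N t))))"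
      using dy by (simp add: \<phi>_def)
    also have "\<dots> = ennreal (exp (a * t))"
    proof (rule lim_imp_Liminf)
      have "(\<lambda>N. dyadic (N, grid N t)) \<longlonglongrightarrow> t"
        using dyadic_grid_tendsto[OF t, of 0] by (auto simp: filterlim_at)
      then show "(\<lambda>N. ennreal (exp (a * dyadic (N, grid N t)))) \<longlonglongrightarrow> ennreal (exp (a * t))"
        by (intro tendsto_intros)
    qed simp
    finally show ?thesis .
  qed
  \<comment> \<open>The lower bound follows from the upper bound at the complementary time: the
    value at the integer k is known exactly and is the product of the values at t and at k -
    t.\<close>
  define k where "k = nat \<lceil>t\<rceil>"
  have k: "t \<le> real k" unfolding k_def by linarith
  have "ennreal (exp (a * real k)) = \<phi> (real k)" using dy[of "(0, k)"] by (simp add: dyadic_def)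
  also have "\<dots> = \<phi> t * \<phi> (real k - t)" using add[of t "real k - t"] t k by simp
  also have "\<dots> \<le> \<phi> t * ennreal (exp (a * (real k - t)))" using k by (intro mult_left_mono upper) auto
  finally have le: "ennreal (exp (a * real k)) \<le> \<phi> t * ennreal (exp (a * (real k - t)))" .
  obtain r where r: "\<phi> t = ennreal r" "0 \<le> r" using upper[OF t] by (cases "\<phi> t") (auto simp: top_unique)
  have "exp (a * real k) \<le> r * exp (a * (real k - t))"
    using le r by (simp add: ennreal_mult[symmetric] ennreal_le_iff)
  also have "exp (a * real k) = exp (a * t) * exp (a * (real k - t))" by (simp add: exp_add[symmetric] algebra_simps)
  finally have "exp (a * t) \<le> r" by simp
  moreover have "r \<le> exp (a * t)" using upper[OF t] r by (simp add: ennreal_le_iff)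
  ultimately show ?thesis using r by (simp add: \<phi>_def)
qed

end

section \<open>Killing at an independent exponential time\<close>

locale killed_levy = levy M Y for M :: "'a measure" and Y +
  fixes \<zeta> :: "'a \<Rightarrow> ennreal" and q :: real
  assumes \<zeta>_measurable [measurable]: "\<zeta> \<in> borel_measurable M"
    and \<zeta>_law: "\<And>t. 0 \<le> t \<Longrightarrow> measure M {\<omega> \<in> space M. ennreal t < \<zeta> \<omega>} = exp (- q * t)"
    and \<zeta>_indep: "prob_space.indep_set M
          (sets (vimage_algebra (space M) (\<lambda>\<omega>. \<lambda>t\<in>{0..}. Y t \<omega>) (Pi\<^sub>M {0..} (\<lambda>_. borel))))
          (sets (vimage_algebra (space M) \<zeta> borel))"
begin

lemma emeasure_\<zeta>: "0 \<le> t \<Longrightarrow> emeasure M {\<omega> \<in> space M. ennreal t < \<zeta> \<omega>} = ennreal (exp (- q * t))"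
  by (simp only: emeasure_eq_measure \<zeta>_law)

lemma \<zeta>_pos: "AE \<omega> in M. 0 < \<zeta> \<omega>"
proof -
  have "prob {\<omega> \<in> space M. 0 < \<zeta> \<omega>} = 1" using \<zeta>_law[of 0] by simp
  then show ?thesis by (subst (asm) prob_Collect_eq_1) auto
qed

definition history :: "'a measure" where
  "history = vimage_algebra (space M) (\<lambda>\<omega>. \<lambda>t\<in>{0..}. Y t \<omega>) (Pi\<^sub>M {0..} (\<lambda>_. borel))"

lemma space_history [simp]: "space history = space M"
  by (simp add: history_def)

lemma Y_history: "0 \<le> t \<Longrightarrow> Y t \<in> borel_measurable history"
proof -
  assume t: "0 \<le> t"
  have "(\<lambda>\<omega>. \<lambda>t\<in>{0..}. Y t \<omega>) \<in> measurable history (Pi\<^sub>M {0..} (\<lambda>_. borel))"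
    unfolding history_def by (rule measurable_vimage_algebra1) (auto simp: space_PiM)
  from measurable_compose[OF this measurable_component_singleton[of t]] t
  show ?thesis by simp
qed

lemma start_shift_history:
  assumes "0 \<le> u"
  shows "(\<lambda>\<omega>. (Y u \<omega>, shift u \<omega>)) \<in> measurable history (borel \<Otimes>\<^sub>M path_space)"
proof -
  have "shift u \<in> measurable history path_space"
    unfolding path_space_def shift_def[abs_def] using assms
    by (intro measurable_PiM_single' borel_measurable_diff Y_history add_nonneg_nonneg) (auto simp: space_PiM)
  then show ?thesis using Y_history[OF assms] by measurable
qed

lemma killed_law:
  assumes u: "0 \<le> u"
  shows "distr M ((borel \<Otimes>\<^sub>M path_space) \<Otimes>\<^sub>M borel) (\<lambda>\<omega>. ((Y u \<omega>, shift u \<omega>), \<zeta> \<omega>)) =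
    (distr M borel (Y u) \<Otimes>\<^sub>M distr M path_space (shift 0)) \<Otimes>\<^sub>M distr M borel \<zeta>"
  unfolding start_shift_law[OF u, symmetric]
proof (rule pair_measure_eqI[symmetric])
  note [measurable] = Y_measurable[OF u] shift_measurable[OF u]
  let ?W = "\<lambda>\<omega>. (Y u \<omega>, shift u \<omega>)"
  show "sigma_finite_measure (distr M (borel \<Otimes>\<^sub>M path_space) ?W)" "sigma_finite_measure (distr M borel \<zeta>)"
    by (intro finite_measure.axioms(1) prob_space.axioms(1) prob_space_distr; measurable)+
  show "sets (distr M (borel \<Otimes>\<^sub>M path_space) ?W \<Otimes>\<^sub>M distr M borel \<zeta>) =
    sets (distr M ((borel \<Otimes>\<^sub>M path_space) \<Otimes>\<^sub>M borel) (\<lambda>\<omega>. (?W \<omega>, \<zeta> \<omega>)))"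
    by (simp cong: sets_pair_measure_cong)
  fix A B assume "A \<in> sets (distr M (borel \<Otimes>\<^sub>M path_space) ?W)" "B \<in> sets (distr M borel \<zeta>)"
  then have A [measurable]: "A \<in> sets (borel \<Otimes>\<^sub>M path_space)" and B [measurable]: "B \<in> sets borel" by auto
  have a: "?W -` A \<inter> space M \<in> sets history"
    using measurable_sets[OF start_shift_history[OF u] A] by simp
  have b: "\<zeta> -` B \<inter> space M \<in> sets (vimage_algebra (space M) \<zeta> borel)"
    by (rule in_vimage_algebra) fact
  have "prob ((?W -` A \<inter> space M) \<inter> (\<zeta> -` B \<inter> space M)) = prob (?W -` A \<inter> space M) * prob (\<zeta> -` B \<inter> space M)"
    by (rule indep_setD[OF \<zeta>_indep]) (use a b in \<open>auto simp: history_def\<close>)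
  moreover have "(?W -` A \<inter> space M) \<inter> (\<zeta> -` B \<inter> space M) = (\<lambda>\<omega>. (?W \<omega>, \<zeta> \<omega>)) -` (A \<times> B) \<inter> space M" by auto
  ultimately have "emeasure M ((\<lambda>\<omega>. (?W \<omega>, \<zeta> \<omega>)) -` (A \<times> B) \<inter> space M) = emeasure M (?W -` A \<inter> space M) * emeasure M (\<zeta> -` B \<inter> space M)"
    by (simp add: emeasure_eq_measure ennreal_mult)
  then show "emeasure (distr M (borel \<Otimes>\<^sub>M path_space) ?W) A * emeasure (distr M borel \<zeta>) B =
     emeasure (distr M ((borel \<Otimes>\<^sub>M path_space) \<Otimes>\<^sub>M borel) (\<lambda>\<omega>. (?W \<omega>, \<zeta> \<omega>))) (A \<times> B)"
    by (simp add: emeasure_distr)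
qed

text \<open>The rays \<open>{x<..}\<close>, together with the whole space, are stable under
  intersection and generate the Borel sets; on them the claim is the functional equation of exp.
  Rays with finite x contain \<infinity>, so a lifetime concentrated at \<infinity> (q = 0) is
  covered as well.\<close>

lemma memoryless:
  assumes u: "0 \<le> u" and g [measurable]: "g \<in> borel_measurable borel"
  shows "(\<integral>\<^sup>+z. indicator {z. ennreal u < z} z * g (z - ennreal u) \<partial>distr M borel \<zeta>) =
    ennreal (exp (- q * u)) * (\<integral>\<^sup>+z. g z \<partial>distr M borel \<zeta>)"
proof -
  define S where "S = {z. ennreal u < z}"
  have S [measurable]: "S \<in> sets borel" unfolding S_def by measurable
  define P where "P = distr (density (distr M borel \<zeta>) (indicator S)) borel (\<lambda>z. z - ennreal u)"
  define Q where "Q = density (distr M borel \<zeta>) (\<lambda>_. ennreal (exp (- q * u)))"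
  have "P = Q"
  proof (rule measure_eqI_generator_eq[where E="insert UNIV (range greaterThan)" and \<Omega>=UNIV and A="\<lambda>_. UNIV"])
    show "Int_stable (insert UNIV (range greaterThan :: ennreal set set))"
    proof (rule Int_stableI)
      fix a b :: "ennreal set" assume "a \<in> insert UNIV (range greaterThan)" "b \<in> insert UNIV (range greaterThan)"
      moreover have "{x<..} \<inter> {y<..} = {max x y<..}" for x y :: ennreal by auto
      ultimately show "a \<inter> b \<in> insert UNIV (range greaterThan)" by auto
    qed
    have sig: "sigma_sets UNIV (insert UNIV (range greaterThan)) = sets (borel :: ennreal measure)"
    proof -
      have "sigma_sets UNIV (insert UNIV (range greaterThan)) = sigma_sets UNIV (range greaterThan :: ennreal set set)"
        by (intro sigma_sets_eqI) (auto intro: sigma_sets_top)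
      then show ?thesis by (subst borel_Ioi) simp
    qed
    show "sets P = sigma_sets UNIV (insert UNIV (range greaterThan))" "sets Q = sigma_sets UNIV (insert UNIV (range greaterThan))"
      by (simp_all add: P_def Q_def sig)
    have emP: "emeasure P X = emeasure M {\<omega> \<in> space M. ennreal u < \<zeta> \<omega> \<and> \<zeta> \<omega> - ennreal u \<in> X}" if [measurable]: "X \<in> sets borel" for X
    proof -
      have pre [measurable]: "(\<lambda>z. z - ennreal u) -` X \<in> sets borel"
        by (rule measurable_sets_borel) measurable
      have "emeasure P X = emeasure (density (distr M borel \<zeta>) (indicator S)) ((\<lambda>z. z - ennreal u) -` X \<inter> space borel)"
        unfolding P_def by (subst emeasure_distr) auto
      also have "\<dots> = emeasure (distr M borel \<zeta>) (S \<inter> ((\<lambda>z. z - ennreal u) -` X \<inter> space borel))"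
        by (rule emeasure_restricted) simp_all
      also have "\<dots> = emeasure M (\<zeta> -` (S \<inter> ((\<lambda>z. z - ennreal u) -` X \<inter> space borel)) \<inter> space M)"
        by (rule emeasure_distr) simp_all
      also have "\<zeta> -` (S \<inter> ((\<lambda>z. z - ennreal u) -` X \<inter> space borel)) \<inter> space M = {\<omega> \<in> space M. ennreal u < \<zeta> \<omega> \<and> \<zeta> \<omega> - ennreal u \<in> X}"
        by (auto simp: S_def)
      finally show ?thesis .
    qed
    have emQ: "emeasure Q X = ennreal (exp (- q * u)) * emeasure M {\<omega> \<in> space M. \<zeta> \<omega> \<in> X}" if [measurable]: "X \<in> sets borel" for X
    proof -
      have "\<zeta> -` X \<inter> space M = {\<omega> \<in> space M. \<zeta> \<omega> \<in> X}" by auto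
      then show ?thesis unfolding Q_def by (subst emeasure_density_const) (auto simp: emeasure_distr)
    qed
    have UNIV: "emeasure P UNIV = ennreal (exp (- q * u))" "emeasure Q UNIV = ennreal (exp (- q * u))"
      using emP[of UNIV] emQ[of UNIV] emeasure_\<zeta>[OF u] by (simp_all add: emeasure_space_1)
    show "emeasure P UNIV \<noteq> \<infinity>" by (simp add: UNIV)
    fix X :: "ennreal set" assume "X \<in> insert UNIV (range greaterThan)"
    then show "emeasure P X = emeasure Q X"
    proof
      assume "X \<in> range greaterThan"
      then obtain x where X: "X = {x<..}" by auto
      show ?thesis
      proof (cases x)
        case (real t)
        have "ennreal u < z \<and> x < z - ennreal u \<longleftrightarrow> ennreal (u + t) < z" for z
        proof (cases z)
          case (real r)
          then show ?thesis using \<open>x = ennreal t\<close> \<open>0 \<le> t\<close> u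
            by (auto simp: ennreal_less_iff ennreal_minus simp del: ennreal_plus)
        next
          case top
          then show ?thesis using \<open>x = ennreal t\<close> by simp
        qed
        then have "emeasure P X = emeasure M {\<omega> \<in> space M. ennreal (u + t) < \<zeta> \<omega>}"
          by (subst emP) (auto simp: X intro!: arg_cong[where f="emeasure M"])
        also have "\<dots> = ennreal (exp (- q * u)) * emeasure M {\<omega> \<in> space M. ennreal t < \<zeta> \<omega>}"
          using u real by (simp add: emeasure_\<zeta> ennreal_mult[symmetric] exp_add[symmetric] algebra_simps del: ennreal_plus)
        also have "\<dots> = emeasure Q X" by (subst emQ) (auto simp: X real)
        finally show ?thesis .
      next
        case top
        then have "X = {}" by (auto simp: X)
        then show ?thesis by simp
      qed
    qed (simp add: UNIV)
  qed auto
  then have "(\<integral>\<^sup>+z. g z \<partial>P) = (\<integral>\<^sup>+z. g z \<partial>Q)" by simp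
  moreover have "(\<integral>\<^sup>+z. g z \<partial>Q) = ennreal (exp (- q * u)) * (\<integral>\<^sup>+z. g z \<partial>distr M borel \<zeta>)"
    unfolding Q_def by (subst nn_integral_density) (auto simp: nn_integral_cmult)
  moreover have "(\<integral>\<^sup>+z. g z \<partial>P) = (\<integral>\<^sup>+z. g (z - ennreal u) \<partial>density (distr M borel \<zeta>) (indicator S))"
    unfolding P_def by (rule nn_integral_distr) auto
  moreover have "\<dots> = (\<integral>\<^sup>+z. indicator S z * g (z - ennreal u) \<partial>distr M borel \<zeta>)"
    by (rule nn_integral_density) auto
  ultimately show ?thesis by (simp add: S_def)
qed

text \<open>Starting value, restarted path and lifetime have a product law, so the integral splits
  by Fubini and the lifetime is restarted by memorylessness. The expectation of
  \<open>exp (c * Y u \<omega>)\<close> refers to the unkilled process; \<open>exp (- q * u)\<close>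
  is the probability of surviving until u.\<close>

lemma Markov:
  assumes u: "0 \<le> u" and F [measurable]: "(\<lambda>(w, z). F w z) \<in> borel_measurable (path_space \<Otimes>\<^sub>M borel)"
  shows "(\<integral>\<^sup>+\<omega>. indicator {\<omega>. ennreal u < \<zeta> \<omega>} \<omega> * ennreal (exp (c * Y u \<omega>)) * F (shift u \<omega>) (\<zeta> \<omega> - ennreal u) \<partial>M) =
    ennreal (exp (- q * u)) * (\<integral>\<^sup>+\<omega>. ennreal (exp (c * Y u \<omega>)) \<partial>M) * (\<integral>\<^sup>+\<omega>. F (shift 0 \<omega>) (\<zeta> \<omega>) \<partial>M)"
proof -
  note [measurable] = Y_measurable[OF u] shift_measurable[OF u] shift_measurable[OF order_refl]
  interpret L: prob_space "distr M borel \<zeta>" by (rule prob_space_distr) measurable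
  interpret S: prob_space "distr M path_space (shift 0)" by (rule prob_space_distr) measurable
  define e where "e y = ennreal (exp (c * y))" for y
  have [measurable]: "e \<in> borel_measurable borel" unfolding e_def by measurable
  have inner_meas: "(\<lambda>w. \<integral>\<^sup>+z. H w z \<partial>distr M borel \<zeta>) \<in> borel_measurable path_space"
    if "(\<lambda>(w, z). H w z) \<in> borel_measurable (path_space \<Otimes>\<^sub>M borel)" for H
    using that by (intro L.borel_measurable_nn_integral) (simp cong: measurable_cong_sets sets_pair_measure_cong)
  \<comment> \<open>Used twice: at time u with the exponential weight, and at time 0 with weight 1
    to turn the iterated integral back into an expectation over M.\<close>
  have key: "(\<integral>\<^sup>+\<omega>. a (Y v \<omega>) * H (shift v \<omega>) (\<zeta> \<omega>) \<partial>M) =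
      (\<integral>\<^sup>+\<omega>. a (Y v \<omega>) \<partial>M) * (\<integral>\<^sup>+w. (\<integral>\<^sup>+z. H w z \<partial>distr M borel \<zeta>) \<partial>distr M path_space (shift 0))"
    if v: "0 \<le> v" and a [measurable]: "a \<in> borel_measurable borel" and
      H [measurable]: "(\<lambda>(w, z). H w z) \<in> borel_measurable (path_space \<Otimes>\<^sub>M borel)" for v a H
  proof -
    note [measurable] = Y_measurable[OF v] shift_measurable[OF v]
    have H3: "(\<lambda>x. H (snd (fst x)) (snd x)) \<in> borel_measurable ((borel \<Otimes>\<^sub>M path_space) \<Otimes>\<^sub>M borel)"
      using measurable_compose[OF _ H, of "\<lambda>x. (snd (fst x), snd x)"] by simp
    have aH [measurable]: "(\<lambda>x. a (fst (fst x)) * H (snd (fst x)) (snd x)) \<in> borel_measurable ((borel \<Otimes>\<^sub>M path_space) \<Otimes>\<^sub>M borel)"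
      using H3 by measurable
    have h: "(\<lambda>w. \<integral>\<^sup>+z. H w z \<partial>distr M borel \<zeta>) \<in> borel_measurable path_space"
      by (rule inner_meas[OF H])
    have "(\<integral>\<^sup>+\<omega>. a (Y v \<omega>) * H (shift v \<omega>) (\<zeta> \<omega>) \<partial>M) =
      (\<integral>\<^sup>+x. a (fst (fst x)) * H (snd (fst x)) (snd x) \<partial>distr M ((borel \<Otimes>\<^sub>M path_space) \<Otimes>\<^sub>M borel) (\<lambda>\<omega>. ((Y v \<omega>, shift v \<omega>), \<zeta> \<omega>)))"
      by (subst nn_integral_distr) simp_all
    also have "\<dots> = (\<integral>\<^sup>+x. (\<integral>\<^sup>+z. a (fst x) * H (snd x) z \<partial>distr M borel \<zeta>) \<partial>(distr M borel (Y v) \<Otimes>\<^sub>M distr M path_space (shift 0)))"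
      unfolding killed_law[OF v]
      by (subst L.nn_integral_fst[symmetric]) (simp_all cong: measurable_cong_sets sets_pair_measure_cong)
    also have "\<dots> = (\<integral>\<^sup>+x. a (fst x) * (\<integral>\<^sup>+z. H (snd x) z \<partial>distr M borel \<zeta>) \<partial>(distr M borel (Y v) \<Otimes>\<^sub>M distr M path_space (shift 0)))"
    proof (intro nn_integral_cong nn_integral_cmult)
      fix x :: "real \<times> (nat \<times> nat \<Rightarrow> real)"
      have "snd x \<in> space path_space" by (simp add: path_space_def space_PiM)
      then show "H (snd x) \<in> borel_measurable (distr M borel \<zeta>)"
        using measurable_compose[OF measurable_Pair1' H] by simp
    qed
    also have "\<dots> = (\<integral>\<^sup>+y. (\<integral>\<^sup>+w. a y * (\<integral>\<^sup>+z. H w z \<partial>distr M borel \<zeta>) \<partial>distr M path_space (shift 0)) \<partial>distr M borel (Y v))"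
    proof -
      have "(\<lambda>x. a (fst x) * (\<integral>\<^sup>+z. H (snd x) z \<partial>distr M borel \<zeta>)) \<in> borel_measurable (borel \<Otimes>\<^sub>M path_space)"
        using measurable_compose[OF measurable_snd h] by measurable
      then show ?thesis
        by (subst S.nn_integral_fst[symmetric]) (simp_all cong: measurable_cong_sets sets_pair_measure_cong)
    qed
    also have "\<dots> = (\<integral>\<^sup>+y. a y * (\<integral>\<^sup>+w. (\<integral>\<^sup>+z. H w z \<partial>distr M borel \<zeta>) \<partial>distr M path_space (shift 0)) \<partial>distr M borel (Y v))"
    proof (intro nn_integral_cong nn_integral_cmult)
      show "(\<lambda>w. \<integral>\<^sup>+z. H w z \<partial>distr M borel \<zeta>) \<in> borel_measurable (distr M path_space (shift 0))"
        using h by (subst measurable_distr_eq1)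
    qed
    also have "\<dots> = (\<integral>\<^sup>+y. a y \<partial>distr M borel (Y v)) * (\<integral>\<^sup>+w. (\<integral>\<^sup>+z. H w z \<partial>distr M borel \<zeta>) \<partial>distr M path_space (shift 0))"
      by (rule nn_integral_multc) simp
    also have "(\<integral>\<^sup>+y. a y \<partial>distr M borel (Y v)) = (\<integral>\<^sup>+\<omega>. a (Y v \<omega>) \<partial>M)"
      by (rule nn_integral_distr) simp_all
    finally show ?thesis .
  qed
  define H where "H w z = indicator {z. ennreal u < z} z * F w (z - ennreal u)" for w z
  have H: "(\<lambda>(w, z). H w z) \<in> borel_measurable (path_space \<Otimes>\<^sub>M borel)"
  proof -
    have "(\<lambda>x. F (fst x) (snd x - ennreal u)) \<in> borel_measurable (path_space \<Otimes>\<^sub>M borel)"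
      using measurable_compose[OF _ F, of "\<lambda>x. (fst x, snd x - ennreal u)"] by simp
    moreover have "(\<lambda>x. indicator {z. ennreal u < z} (snd x) :: ennreal) \<in> borel_measurable (path_space \<Otimes>\<^sub>M borel)"
      unfolding indicator_def by measurable
    ultimately show ?thesis unfolding H_def case_prod_beta by (rule borel_measurable_times_ennreal[rotated])
  qed
  have "(\<integral>\<^sup>+\<omega>. indicator {\<omega>. ennreal u < \<zeta> \<omega>} \<omega> * ennreal (exp (c * Y u \<omega>)) * F (shift u \<omega>) (\<zeta> \<omega> - ennreal u) \<partial>M) =
    (\<integral>\<^sup>+\<omega>. e (Y u \<omega>) * H (shift u \<omega>) (\<zeta> \<omega>) \<partial>M)"
    by (intro nn_integral_cong) (simp add: e_def H_def indicator_def)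
  also have "\<dots> = (\<integral>\<^sup>+\<omega>. e (Y u \<omega>) \<partial>M) * (\<integral>\<^sup>+w. (\<integral>\<^sup>+z. H w z \<partial>distr M borel \<zeta>) \<partial>distr M path_space (shift 0))"
    by (rule key[OF u _ H]) measurable
  also have "(\<integral>\<^sup>+w. (\<integral>\<^sup>+z. H w z \<partial>distr M borel \<zeta>) \<partial>distr M path_space (shift 0)) =
     (\<integral>\<^sup>+w. ennreal (exp (- q * u)) * (\<integral>\<^sup>+z. F w z \<partial>distr M borel \<zeta>) \<partial>distr M path_space (shift 0))"
  proof (intro nn_integral_cong)
    fix w :: "nat \<times> nat \<Rightarrow> real"
    have "w \<in> space path_space" by (simp add: path_space_def space_PiM)
    then have "F w \<in> borel_measurable borel"
      using measurable_compose[OF measurable_Pair1' F] by simp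
    then show "(\<integral>\<^sup>+z. H w z \<partial>distr M borel \<zeta>) = ennreal (exp (- q * u)) * (\<integral>\<^sup>+z. F w z \<partial>distr M borel \<zeta>)"
      unfolding H_def by (rule memoryless[OF u])
  qed
  also have "\<dots> = ennreal (exp (- q * u)) * (\<integral>\<^sup>+w. (\<integral>\<^sup>+z. F w z \<partial>distr M borel \<zeta>) \<partial>distr M path_space (shift 0))"
  proof (rule nn_integral_cmult)
    show "(\<lambda>w. \<integral>\<^sup>+z. F w z \<partial>distr M borel \<zeta>) \<in> borel_measurable (distr M path_space (shift 0))"
      using inner_meas[OF F] by (subst measurable_distr_eq1)
  qed
  also have "(\<integral>\<^sup>+w. (\<integral>\<^sup>+z. F w z \<partial>distr M borel \<zeta>) \<partial>distr M path_space (shift 0)) = (\<integral>\<^sup>+\<omega>. F (shift 0 \<omega>) (\<zeta> \<omega>) \<partial>M)"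
    using key[of 0 "\<lambda>_. 1" F] F by (simp add: emeasure_space_1)
  finally show ?thesis by (simp add: e_def mult_ac)
qed

end

section \<open>A maximal inequality\<close>

lemma (in prob_space) indep_var_nn_integral:
  fixes f g :: "'a \<Rightarrow> ennreal"
  assumes "indep_var borel f borel g"
  shows "(\<integral>\<^sup>+x. f x * g x \<partial>M) = (\<integral>\<^sup>+x. f x \<partial>M) * (\<integral>\<^sup>+x. g x \<partial>M)"
proof -
  have "case_bool borel borel = (\<lambda>_::bool. borel :: ennreal measure)"
    by (auto simp: fun_eq_iff split: bool.split)
  then have "indep_vars (\<lambda>_. borel) (case_bool f g) UNIV"
    using assms unfolding indep_var_def by simp
  then have "(\<integral>\<^sup>+x. (\<Prod>i\<in>UNIV. case_bool f g i x) \<partial>M) = (\<Prod>i\<in>UNIV. \<integral>\<^sup>+x. case_bool f g i x \<partial>M)"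
    by (intro indep_vars_nn_integral) auto
  then show ?thesis by (simp add: UNIV_bool mult.commute)
qed

text \<open>The product process stopped when it first exceeds l: after that no further factor is
  multiplied in.\<close>

primrec stopped_prod :: "ennreal \<Rightarrow> nat \<Rightarrow> (nat \<Rightarrow> ennreal) \<Rightarrow> ennreal" where
  "stopped_prod l 0 x = 1"
| "stopped_prod l (Suc k) x = (if l < stopped_prod l k x then stopped_prod l k x else stopped_prod l k x * x k)"

lemma stopped_prod_exceeds:
  "((\<exists>j\<le>k. l < (\<Prod>i<j. x i)) \<longrightarrow> l < stopped_prod l k x) \<and>
   (\<not> (\<exists>j\<le>k. l < (\<Prod>i<j. x i)) \<longrightarrow> stopped_prod l k x = (\<Prod>i<k. x i))"
proof (induction k)
  case (Suc k)
  have ex: "(\<exists>j\<le>Suc k. l < (\<Prod>i<j. x i)) \<longleftrightarrow> (\<exists>j\<le>k. l < (\<Prod>i<j. x i)) \<or> l < (\<Prod>i<Suc k. x i)"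
    by (metis le_Suc_eq)
  show ?case
  proof (cases "\<exists>j\<le>k. l < (\<Prod>i<j. x i)")
    case True
    then have "l < stopped_prod l k x" using Suc by blast
    then show ?thesis using True ex by (simp add: ex)
  next
    case False
    then have eq: "stopped_prod l k x = (\<Prod>i<k. x i)" using Suc by blast
    moreover have "\<not> l < (\<Prod>i<k. x i)" using False by auto
    ultimately have "stopped_prod l (Suc k) x = (\<Prod>i<Suc k. x i)" by simp
    then show ?thesis using False ex by metis
  qed
qed auto

lemma stopped_prod_restrict: "k \<le> n \<Longrightarrow> stopped_prod l k (restrict x {..<n}) = stopped_prod l k x"
  by (induction k) auto

lemma measurable_stopped_prod:
  "k \<le> n \<Longrightarrow> stopped_prod l k \<in> borel_measurable (Pi\<^sub>M {..<n} (\<lambda>_. borel))"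
proof (induction k)
  case 0
  have "stopped_prod l 0 = (\<lambda>_. 1)" by (simp add: fun_eq_iff)
  then show ?case by simp
next
  case (Suc k)
  have [measurable]: "stopped_prod l k \<in> borel_measurable (Pi\<^sub>M {..<n} (\<lambda>_. borel))" using Suc by simp
  have [measurable]: "(\<lambda>x. x k) \<in> borel_measurable (Pi\<^sub>M {..<n} (\<lambda>_. borel))"
    using Suc by (intro measurable_component_singleton) auto
  have "stopped_prod l (Suc k) = (\<lambda>x. if l < stopped_prod l k x then stopped_prod l k x else stopped_prod l k x * x k)"
    by (simp add: fun_eq_iff)
  then show ?case by simp
qed

text \<open>Products of independent nonnegative factors of mean at most 1 form a supermartingale.
  Stopping it at the first exceedance keeps the mean at most 1, and Markov's inequality is applied
  to the stopped value. Working in \<open>ennreal\<close> avoids integrability conditions.\<close>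

lemma (in prob_space) maximal_inequality:
  fixes X :: "nat \<Rightarrow> 'a \<Rightarrow> ennreal"
  assumes indep: "indep_vars (\<lambda>_. borel) X {..<n}"
    and le1: "\<And>i. i < n \<Longrightarrow> (\<integral>\<^sup>+\<omega>. X i \<omega> \<partial>M) \<le> 1" and l: "l \<noteq> 0" "l \<noteq> \<infinity>"
  shows "emeasure M {\<omega> \<in> space M. \<exists>k\<le>n. l < (\<Prod>i<k. X i \<omega>)} \<le> 1 / l"
proof -
  have rv [measurable]: "X i \<in> borel_measurable M" if "i < n" for i
    using indep that by (auto simp: indep_vars_def)
  define S where "S k \<omega> = stopped_prod l k (\<lambda>i. X i \<omega>)" for k \<omega>
  have S_meas: "S k \<in> borel_measurable M" if "k \<le> n" for k
  proof -
    have "(\<lambda>\<omega>. \<lambda>i\<in>{..<n}. X i \<omega>) \<in> measurable M (Pi\<^sub>M {..<n} (\<lambda>_. borel))"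
      by (intro measurable_restrict) auto
    from measurable_compose[OF this measurable_stopped_prod[OF that, of l]]
    show ?thesis unfolding S_def[abs_def] by (simp add: stopped_prod_restrict that)
  qed
  have "(\<integral>\<^sup>+\<omega>. S k \<omega> \<partial>M) \<le> 1" if "k \<le> n" for k
    using that
  proof (induction k)
    case 0
    show ?case by (simp add: S_def emeasure_space_1)
  next
    case (Suc k)
    note [measurable] = S_meas[of k] rv[of k]
    \<comment> \<open>The part of the stopped product that has not exceeded l yet. It depends on the
      factors before k only and is therefore independent of \<open>X k\<close>; the complementary
      part \<open>b\<close> below is not multiplied any more.\<close>
    define a where "a x = (if l < stopped_prod l k x then 0 else stopped_prod l k x)" for x
    have a_meas: "a \<in> borel_measurable (Pi\<^sub>M {..<k} (\<lambda>_. borel))"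
      unfolding a_def using measurable_stopped_prod[OF order_refl, of l k] by measurable
    have "indep_var (Pi\<^sub>M {..<k} (\<lambda>_. borel)) (\<lambda>\<omega>. restrict (\<lambda>i. X i \<omega>) {..<k}) (Pi\<^sub>M {k} (\<lambda>_. borel)) (\<lambda>\<omega>. restrict (\<lambda>i. X i \<omega>) {k})"
      by (rule indep_var_restrict[OF indep]) (use Suc in auto)
    from indep_var_compose[OF this a_meas measurable_component_singleton[of k]]
    have "indep_var borel (\<lambda>\<omega>. a (restrict (\<lambda>i. X i \<omega>) {..<k})) borel (\<lambda>\<omega>. X k \<omega>)"
      by (simp add: o_def)
    have ind: "indep_var borel (\<lambda>\<omega>. a (\<lambda>i. X i \<omega>)) borel (\<lambda>\<omega>. X k \<omega>)"
    proof -
      have "a (restrict (\<lambda>i. X i \<omega>) {..<k}) = a (\<lambda>i. X i \<omega>)" for \<omega>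
        unfolding a_def stopped_prod_restrict[OF order_refl] ..
      then show ?thesis using \<open>indep_var borel (\<lambda>\<omega>. a (restrict (\<lambda>i. X i \<omega>) {..<k})) borel (\<lambda>\<omega>. X k \<omega>)\<close> by simp
    qed
    have "(\<integral>\<^sup>+\<omega>. a (\<lambda>i. X i \<omega>) * X k \<omega> \<partial>M) = (\<integral>\<^sup>+\<omega>. a (\<lambda>i. X i \<omega>) \<partial>M) * (\<integral>\<^sup>+\<omega>. X k \<omega> \<partial>M)"
      by (rule indep_var_nn_integral[OF ind])
    also have "\<dots> \<le> (\<integral>\<^sup>+\<omega>. a (\<lambda>i. X i \<omega>) \<partial>M) * 1"
      using Suc by (intro mult_left_mono le1) auto
    finally have *: "(\<integral>\<^sup>+\<omega>. a (\<lambda>i. X i \<omega>) * X k \<omega> \<partial>M) \<le> (\<integral>\<^sup>+\<omega>. a (\<lambda>i. X i \<omega>) \<partial>M)" by simp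
    define b where "b \<omega> = (if l < S k \<omega> then S k \<omega> else 0)" for \<omega>
    have a_eq: "a (\<lambda>i. X i \<omega>) = (if l < S k \<omega> then 0 else S k \<omega>)" for \<omega> by (simp add: a_def S_def)
    have km: "k \<le> n" "k < n" using Suc by auto
    have [measurable]: "S k \<in> borel_measurable M" "X k \<in> borel_measurable M" using S_meas rv km by auto
    have [measurable]: "(\<lambda>\<omega>. a (\<lambda>i. X i \<omega>)) \<in> borel_measurable M" "b \<in> borel_measurable M"
      unfolding a_eq b_def[abs_def] by measurable
    have "(\<integral>\<^sup>+\<omega>. S (Suc k) \<omega> \<partial>M) = (\<integral>\<^sup>+\<omega>. b \<omega> + a (\<lambda>i. X i \<omega>) * X k \<omega> \<partial>M)"
      by (intro nn_integral_cong) (auto simp: S_def a_def b_def)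
    also have "\<dots> = (\<integral>\<^sup>+\<omega>. b \<omega> \<partial>M) + (\<integral>\<^sup>+\<omega>. a (\<lambda>i. X i \<omega>) * X k \<omega> \<partial>M)"
      by (rule nn_integral_add) measurable
    also have "\<dots> \<le> (\<integral>\<^sup>+\<omega>. b \<omega> \<partial>M) + (\<integral>\<^sup>+\<omega>. a (\<lambda>i. X i \<omega>) \<partial>M)"
      using * by (intro add_left_mono)
    also have "\<dots> = (\<integral>\<^sup>+\<omega>. b \<omega> + a (\<lambda>i. X i \<omega>) \<partial>M)"
      by (rule nn_integral_add[symmetric]) measurable
    also have "\<dots> = (\<integral>\<^sup>+\<omega>. S k \<omega> \<partial>M)"
      by (intro nn_integral_cong) (auto simp: a_eq b_def)
    also have "\<dots> \<le> 1" using Suc by simp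
    finally show ?case .
  qed
  note S1 = this[OF order_refl]
  note [measurable] = S_meas[OF order_refl]
  have "emeasure M {\<omega> \<in> space M. \<exists>k\<le>n. l < (\<Prod>i<k. X i \<omega>)} \<le> emeasure M {\<omega> \<in> space M. 1 \<le> (1 / l) * S n \<omega>}"
  proof (rule emeasure_mono)
    show "{\<omega> \<in> space M. \<exists>k\<le>n. l < (\<Prod>i<k. X i \<omega>)} \<subseteq> {\<omega> \<in> space M. 1 \<le> (1 / l) * S n \<omega>}"
    proof safe
      fix \<omega> k assume "k \<le> n" "l < (\<Prod>i<k. X i \<omega>)"
      then have "l < S n \<omega>" using stopped_prod_exceeds[of n l "\<lambda>i. X i \<omega>"] unfolding S_def by blast
      then have "(1 / l) * l \<le> (1 / l) * S n \<omega>" by (intro mult_left_mono) auto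
      moreover have "(1 / l) * l = 1" using l by (simp add: ennreal_divide_times ennreal_divide_self top.not_eq_extremum)
      ultimately show "1 \<le> (1 / l) * S n \<omega>" by simp
    qed
  qed measurable
  also have "\<dots> \<le> (1 / l) * (\<integral>\<^sup>+\<omega>. S n \<omega> * indicator (space M) \<omega> \<partial>M)"
    using nn_integral_Markov_inequality[of "S n" "space M" M "1 / l"] by simp
  also have "\<dots> \<le> (1 / l) * 1"
    using S1 by (intro mult_left_mono) (auto cong: nn_integral_cong)
  finally show ?thesis by simp
qed

text \<open>Cutting the values into dyadic layers bounds the mean by \<rho> plus the sum of
  \<open>\<rho> * 2 ^ (n + 1) / 4 ^ n\<close>; the series has the sum 4 \<rho>.\<close>

lemma (in prob_space) nn_integral_le_of_weak_bound:
  fixes Z :: "'a \<Rightarrow> real"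
  assumes [measurable]: "Z \<in> borel_measurable M" and \<rho>: "\<rho> > 0"
    and tail: "\<And>n. emeasure M {\<omega> \<in> space M. 2 ^ n * \<rho> < Z \<omega>} \<le> ennreal (1 / 4 ^ n)"
  shows "(\<integral>\<^sup>+\<omega>. ennreal (Z \<omega>) \<partial>M) \<le> ennreal (5 * \<rho>)"
proof -
  have pw: "ennreal (Z \<omega>) \<le> ennreal \<rho> + (\<Sum>n. ennreal (\<rho> * 2 ^ (n + 1)) * indicator {\<omega> \<in> space M. 2 ^ n * \<rho> < Z \<omega>} \<omega>)"
    if \<omega>: "\<omega> \<in> space M" for \<omega>
  proof (cases "Z \<omega> \<le> \<rho>")
    case True
    then have "ennreal (Z \<omega>) \<le> ennreal \<rho>" by (rule ennreal_leI)
    then show ?thesis by (rule order_trans) simp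
  next
    case False
    have "\<exists>n. Z \<omega> \<le> 2 ^ n * \<rho>"
    proof -
      obtain n where "Z \<omega> / \<rho> < 2 ^ n" using real_arch_pow[of 2 "Z \<omega> / \<rho>"] by auto
      then show ?thesis using \<rho> by (intro exI[of _ n]) (simp add: field_simps less_imp_le)
    qed
    define m where "m = (LEAST n. Z \<omega> \<le> 2 ^ n * \<rho>)"
    have m: "Z \<omega> \<le> 2 ^ m * \<rho>" unfolding m_def by (rule LeastI_ex) fact
    have "m \<noteq> 0" using m False by (intro notI) simp
    then obtain k where k: "m = Suc k" by (cases m) auto
    have "\<not> Z \<omega> \<le> 2 ^ k * \<rho>" using not_less_Least[of k "\<lambda>n. Z \<omega> \<le> 2 ^ n * \<rho>"] k by (simp add: m_def)
    then have "\<omega> \<in> {\<omega> \<in> space M. 2 ^ k * \<rho> < Z \<omega>}" using \<omega> by simp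
    then have "ennreal (Z \<omega>) \<le> ennreal (\<rho> * 2 ^ (k + 1)) * indicator {\<omega> \<in> space M. 2 ^ k * \<rho> < Z \<omega>} \<omega>"
      using m k by (simp add: ennreal_leI mult.commute)
    also have "\<dots> \<le> (\<Sum>n. ennreal (\<rho> * 2 ^ (n + 1)) * indicator {\<omega> \<in> space M. 2 ^ n * \<rho> < Z \<omega>} \<omega>)"
    proof -
      define f where "f n = ennreal (\<rho> * 2 ^ (n + 1)) * indicator {\<omega> \<in> space M. 2 ^ n * \<rho> < Z \<omega>} \<omega>" for n
      have "sum f {k} \<le> suminf f" by (rule sum_le_suminf) auto
      then have "f k \<le> suminf f" by simp
      then show ?thesis unfolding f_def .
    qed
    finally show ?thesis by (rule order_trans) simp
  qed
  have geo: "(\<Sum>n. ennreal (\<rho> * 2 * (1 / 2) ^ n)) = ennreal (4 * \<rho>)"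
  proof -
    have "(\<lambda>n. \<rho> * 2 * (1 / 2) ^ n) sums (\<rho> * 2 * (1 / (1 - 1 / 2)))"
      by (intro sums_mult geometric_sums) simp
    then have "(\<lambda>n. \<rho> * 2 * (1 / 2) ^ n) sums (4 * \<rho>)" by simp
    then show ?thesis using \<rho> by (intro suminf_ennreal_eq) auto
  qed
  have "(\<integral>\<^sup>+\<omega>. ennreal (Z \<omega>) \<partial>M) \<le>
    (\<integral>\<^sup>+\<omega>. ennreal \<rho> + (\<Sum>n. ennreal (\<rho> * 2 ^ (n + 1)) * indicator {\<omega> \<in> space M. 2 ^ n * \<rho> < Z \<omega>} \<omega>) \<partial>M)"
    by (intro nn_integral_mono pw)
  also have "\<dots> = ennreal \<rho> + (\<Sum>n. ennreal (\<rho> * 2 ^ (n + 1)) * emeasure M {\<omega> \<in> space M. 2 ^ n * \<rho> < Z \<omega>})"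
    by (subst nn_integral_add) (auto simp: nn_integral_suminf nn_integral_cmult_indicator emeasure_space_1)
  also have "\<dots> \<le> ennreal \<rho> + (\<Sum>n. ennreal (\<rho> * 2 * (1 / 2) ^ n))"
  proof (intro add_left_mono suminf_le)
    fix n
    have "ennreal (\<rho> * 2 ^ (n + 1)) * emeasure M {\<omega> \<in> space M. 2 ^ n * \<rho> < Z \<omega>} \<le> ennreal (\<rho> * 2 ^ (n + 1)) * ennreal (1 / 4 ^ n)"
      by (intro mult_left_mono tail) simp
    also have "\<dots> = ennreal (\<rho> * 2 ^ (n + 1) * (1 / 4 ^ n))"
      using \<rho> by (subst ennreal_mult[symmetric]) auto
    also have "\<rho> * 2 ^ (n + 1) * (1 / 4 ^ n) = \<rho> * 2 * (1 / 2) ^ n"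
    proof -
      have "(4::real) ^ n = 2 ^ n * 2 ^ n" by (simp add: power_mult_distrib[symmetric])
      then show ?thesis by (simp add: power_divide field_simps)
    qed
    finally show "ennreal (\<rho> * 2 ^ (n + 1)) * emeasure M {\<omega> \<in> space M. 2 ^ n * \<rho> < Z \<omega>} \<le> ennreal (\<rho> * 2 * (1 / 2) ^ n)" .
  qed auto
  also have "\<dots> = ennreal (5 * \<rho>)" using \<rho> by (simp add: geo ennreal_plus[symmetric] del: ennreal_plus)
  finally show ?thesis .
qed

context levy
begin

text \<open>The exponent is c/2 although exponential moments of order c are used: the maximal
  inequality at order c only gives a tail of order 1/l, and passing to the square root makes the
  maximum integrable. The indices up to \<open>2 ^ N\<close> cover the time interval [0, 1].\<close>

definition grid_max :: "real \<Rightarrow> nat \<Rightarrow> 'a \<Rightarrow> real" where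
  "grid_max c N \<omega> = Max ((\<lambda>k. exp (- (c / 2) * Y (dyadic (N, k)) \<omega>)) ` {..2 ^ N})"

lemma grid_max_less_iff: "r < grid_max c N \<omega> \<longleftrightarrow> (\<exists>k\<le>2 ^ N. r < exp (- (c / 2) * Y (dyadic (N, k)) \<omega>))"
  unfolding grid_max_def by (subst Max_gr_iff) auto

lemma grid_max_ge: "k \<le> 2 ^ N \<Longrightarrow> exp (- (c / 2) * Y (dyadic (N, k)) \<omega>) \<le> grid_max c N \<omega>"
  unfolding grid_max_def by (intro Max_ge) auto

lemma grid_max_measurable [measurable]: "grid_max c N \<in> borel_measurable M"
proof (rule borel_measurableI_greater)
  fix r
  have [measurable]: "Y (dyadic (N, k)) \<in> borel_measurable M" for k by (rule Y_measurable) simp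
  show "{\<omega> \<in> space M. r < grid_max c N \<omega>} \<in> events"
    unfolding grid_max_less_iff by measurable
qed

lemma grid_max_mono: "grid_max c N \<omega> \<le> grid_max c (Suc N) \<omega>"
  unfolding grid_max_def[of c N]
proof (rule Max.boundedI)
  fix r assume "r \<in> (\<lambda>k. exp (- (c / 2) * Y (dyadic (N, k)) \<omega>)) ` {..2 ^ N}"
  then obtain k where k: "k \<le> 2 ^ N" "r = exp (- (c / 2) * Y (dyadic (N, k)) \<omega>)" by auto
  have "dyadic (N, k) = dyadic (Suc N, 2 * k)" by (simp add: dyadic_def)
  then show "r \<le> grid_max c (Suc N) \<omega>" using grid_max_ge[of "2 * k" "Suc N" c \<omega>] k by simp
qed auto

lemma expectation_grid_max:
  assumes fin: "(\<integral>\<^sup>+\<omega>. ennreal (exp (- c * Y 1 \<omega>)) \<partial>M) = ennreal (exp a)"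
  shows "(\<integral>\<^sup>+\<omega>. ennreal (grid_max c N \<omega>) \<partial>M) \<le> ennreal (5 * exp (\<bar>a\<bar> / 2))"
proof (rule nn_integral_le_of_weak_bound)
  fix n
  define h :: real where "h = 1 / 2 ^ N"
  have h: "h > 0" by (simp add: h_def)
  define D where "D i \<omega> = Y (real (Suc i) * h) \<omega> - Y (real i * h) \<omega>" for i \<omega>
  \<comment> \<open>Exponentials of increments, normalized to mean 1. Over k steps the normalization
    amounts to \<open>exp (a * h * k)\<close>, which is at most \<open>exp \<bar>a\<bar>\<close>
    because \<open>h * k \<le> 1\<close>; this explains the constant in the bound.\<close>
  define X where "X i \<omega> = ennreal (exp (- c * D i \<omega>) / exp (a * h))" for i \<omega>
  have "indep_vars (\<lambda>_. borel) D {..<2 ^ N}"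
    unfolding D_def by (rule indep_increments) (use h in \<open>auto intro!: mult_right_mono\<close>)
  then have ind: "indep_vars (\<lambda>_. borel) X {..<2 ^ N}"
    unfolding X_def by (rule indep_vars_compose2[where Y="\<lambda>i x. ennreal (exp (- c * x) / exp (a * h))"]) measurable
  have EX: "(\<integral>\<^sup>+\<omega>. X i \<omega> \<partial>M) \<le> 1" for i
  proof -
    have [measurable]: "Y (real i * h) \<in> borel_measurable M" "Y (real (Suc i) * h) \<in> borel_measurable M" "Y h \<in> borel_measurable M"
      using h by (auto intro!: Y_measurable)
    have [measurable]: "D i \<in> borel_measurable M" unfolding D_def by measurable
    have "(\<integral>\<^sup>+\<omega>. X i \<omega> \<partial>M) = (\<integral>\<^sup>+x. ennreal (exp (- c * x) / exp (a * h)) \<partial>distr M borel (D i))"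
      unfolding X_def by (subst nn_integral_distr) auto
    also have "distr M borel (D i) = distr M borel (Y h)"
      using increment_law[of "real i * h" h] h by (simp add: D_def[abs_def] algebra_simps)
    also have "(\<integral>\<^sup>+x. ennreal (exp (- c * x) / exp (a * h)) \<partial>distr M borel (Y h)) = (\<integral>\<^sup>+\<omega>. ennreal (exp (- c * Y h \<omega>)) / ennreal (exp (a * h)) \<partial>M)"
      by (subst nn_integral_distr) (auto simp: divide_ennreal)
    also have "\<dots> = (\<integral>\<^sup>+\<omega>. ennreal (exp (- c * Y h \<omega>)) \<partial>M) / ennreal (exp (a * h))"
      by (rule nn_integral_divide) measurable
    also have "\<dots> = ennreal (exp (a * h)) / ennreal (exp (a * h))"
      using expectation_exp[OF fin, of h] h by simp
    also have "\<dots> = 1" by (rule ennreal_divide_self) auto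
    finally show ?thesis by simp
  qed
  have prod: "(\<Prod>i<k. X i \<omega>) = ennreal (exp (- c * (Y (real k * h) \<omega> - Y 0 \<omega>)) / exp (a * h * real k))" for k \<omega>
  proof (induction k)
    case (Suc k)
    then show ?case
      by (simp add: X_def D_def ennreal_mult[symmetric] exp_add[symmetric] exp_diff[symmetric] algebra_simps)
  qed simp
  have "emeasure M {\<omega> \<in> space M. 2 ^ n * exp (\<bar>a\<bar> / 2) < grid_max c N \<omega>} \<le>
    emeasure M {\<omega> \<in> space M. \<exists>k\<le>2 ^ N. ennreal (4 ^ n) < (\<Prod>i<k. X i \<omega>)}"
  proof (rule emeasure_mono_AE)
    show "AE \<omega> in M. \<omega> \<in> {\<omega> \<in> space M. 2 ^ n * exp (\<bar>a\<bar> / 2) < grid_max c N \<omega>} \<longrightarrow>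
      \<omega> \<in> {\<omega> \<in> space M. \<exists>k\<le>2 ^ N. ennreal (4 ^ n) < (\<Prod>i<k. X i \<omega>)}"
      using Y_0
    proof eventually_elim
      case (elim \<omega>)
      show ?case
      proof
        assume "\<omega> \<in> {\<omega> \<in> space M. 2 ^ n * exp (\<bar>a\<bar> / 2) < grid_max c N \<omega>}"
        then obtain k where \<omega>: "\<omega> \<in> space M" and k: "k \<le> 2 ^ N" "2 ^ n * exp (\<bar>a\<bar> / 2) < exp (- (c / 2) * Y (dyadic (N, k)) \<omega>)"
          by (auto simp: grid_max_less_iff)
        have dk: "dyadic (N, k) = real k * h" by (simp add: dyadic_def h_def)
        have "(2 ^ n * exp (\<bar>a\<bar> / 2))\<^sup>2 < (exp (- (c / 2) * Y (real k * h) \<omega>))\<^sup>2"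
          using k dk by (intro power_strict_mono) auto
        moreover have "(2 ^ n * exp (\<bar>a\<bar> / 2))\<^sup>2 = 4 ^ n * exp \<bar>a\<bar>"
        proof -
          have "((2::real) ^ n)\<^sup>2 = 4 ^ n" by (simp add: power2_eq_square power_mult_distrib[symmetric])
          moreover have "(exp (\<bar>a\<bar> / 2))\<^sup>2 = exp \<bar>a\<bar>" by (simp add: exp_double[symmetric])
          ultimately show ?thesis by (simp add: power_mult_distrib)
        qed
        moreover have "(exp (- (c / 2) * Y (real k * h) \<omega>))\<^sup>2 = exp (- c * Y (real k * h) \<omega>)"
          by (simp add: exp_double[symmetric])
        ultimately have "4 ^ n * exp \<bar>a\<bar> < exp (- c * Y (real k * h) \<omega>)" by simp
        moreover have "exp (a * h * real k) \<le> exp \<bar>a\<bar>"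
        proof -
          have "h * real k \<le> 1" using k(1) by (simp add: h_def field_simps)
          then have "\<bar>a\<bar> * (h * real k) \<le> \<bar>a\<bar> * 1" by (intro mult_left_mono) auto
          moreover have "a * (h * real k) \<le> \<bar>a\<bar> * (h * real k)" using h by (intro mult_right_mono) auto
          ultimately show ?thesis by (simp add: mult.assoc)
        qed
        then have "4 ^ n * exp (a * h * real k) \<le> 4 ^ n * exp \<bar>a\<bar>" by (intro mult_left_mono) auto
        ultimately have "4 ^ n * exp (a * h * real k) < exp (- c * Y (real k * h) \<omega>)" by linarith
        then have "4 ^ n < exp (- c * Y (real k * h) \<omega>) / exp (a * h * real k)" by (subst less_divide_eq) simp
        then have "ennreal (4 ^ n) < (\<Prod>i<k. X i \<omega>)"
          unfolding prod using elim by (intro ennreal_lessI) auto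
        then show "\<omega> \<in> {\<omega> \<in> space M. \<exists>k\<le>2 ^ N. ennreal (4 ^ n) < (\<Prod>i<k. X i \<omega>)}" using \<omega> k by blast
      qed
    qed
    have [measurable]: "Y (real k * h) \<in> borel_measurable M" "Y 0 \<in> borel_measurable M" for k
      using h by (auto intro!: Y_measurable)
    show "{\<omega> \<in> space M. \<exists>k\<le>2 ^ N. ennreal (4 ^ n) < (\<Prod>i<k. X i \<omega>)} \<in> events"
      unfolding prod by measurable
  qed
  also have "\<dots> \<le> 1 / ennreal (4 ^ n)"
    by (rule maximal_inequality[OF ind EX]) auto
  also have "\<dots> = ennreal (1 / 4 ^ n)" by (simp add: divide_ennreal[symmetric])
  finally show "emeasure M {\<omega> \<in> space M. 2 ^ n * exp (\<bar>a\<bar> / 2) < grid_max c N \<omega>} \<le> ennreal (1 / 4 ^ n)" .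
qed auto

lemma expectation_SUP_grid_max:
  assumes "(\<integral>\<^sup>+\<omega>. ennreal (exp (- c * Y 1 \<omega>)) \<partial>M) = ennreal (exp a)"
  shows "(\<integral>\<^sup>+\<omega>. (SUP N. ennreal (grid_max c N \<omega>)) \<partial>M) \<le> ennreal (5 * exp (\<bar>a\<bar> / 2))"
proof -
  have "(\<integral>\<^sup>+\<omega>. (SUP N. ennreal (grid_max c N \<omega>)) \<partial>M) = (SUP N. \<integral>\<^sup>+\<omega>. ennreal (grid_max c N \<omega>) \<partial>M)"
  proof (rule nn_integral_monotone_convergence_SUP)
    show "incseq (\<lambda>N \<omega>. ennreal (grid_max c N \<omega>))"
      by (intro incseq_SucI le_funI ennreal_leI grid_max_mono)
  qed measurable
  also have "\<dots> \<le> ennreal (5 * exp (\<bar>a\<bar> / 2))"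
    by (intro SUP_least expectation_grid_max assms)
  finally show ?thesis .
qed

lemma exp_le_SUP_grid_max:
  assumes "\<omega> \<in> space M" "0 \<le> v" "v < 1"
  shows "ennreal (exp (- (c / 2) * Y v \<omega>)) \<le> (SUP N. ennreal (grid_max c N \<omega>))"
proof (rule LIMSEQ_le_const2)
  show "(\<lambda>N. ennreal (exp (- (c / 2) * Y (dyadic (N, grid N v)) \<omega>))) \<longlonglongrightarrow> ennreal (exp (- (c / 2) * Y v \<omega>))"
    using Y_grid_tendsto[of \<omega> 0 v] assms by (intro tendsto_intros) auto
  have "ennreal (exp (- (c / 2) * Y (dyadic (N, grid N v)) \<omega>)) \<le> (SUP N. ennreal (grid_max c N \<omega>))" for N
  proof -
    \<comment> \<open>Since v < 1, the dyadic approximation from the right stays in [0, 1], the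
      range of the maximum.\<close>
    have "v * 2 ^ N < 2 ^ N" using assms by simp
    then have "\<lfloor>v * 2 ^ N\<rfloor> < 2 ^ N" by (simp add: floor_less_iff)
    then have "nat \<lfloor>v * 2 ^ N\<rfloor> < nat (2 ^ N)" using assms by (subst nat_less_eq_zless) auto
    then have "nat \<lfloor>v * 2 ^ N\<rfloor> < 2 ^ N" by (simp only: nat_power_eq nat_numeral zero_le_numeral)
    then have "grid N v \<le> 2 ^ N" unfolding grid_def by (simp only: Suc_eq_plus1[symmetric] Suc_le_eq)
    then have "ennreal (exp (- (c / 2) * Y (dyadic (N, grid N v)) \<omega>)) \<le> ennreal (grid_max c N \<omega>)"
      by (intro ennreal_leI grid_max_ge)
    also have "\<dots> \<le> (SUP N. ennreal (grid_max c N \<omega>))" by (rule SUP_upper) simp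
    finally show ?thesis .
  qed
  then show "\<exists>N. \<forall>n\<ge>N. ennreal (exp (- (c / 2) * Y (dyadic (n, grid n v)) \<omega>)) \<le> (SUP N. ennreal (grid_max c N \<omega>))" by blast
qed

end

section \<open>Powers of an integral\<close>

text \<open>The probability integral transform for a finite measure without atoms. It suffices to
  compute the mass of the superlevel sets of the distribution function.\<close>

lemma distr_cdf_uniform:
  assumes "finite_borel_measure \<mu>" and cont: "\<And>x. measure \<mu> {x} = 0"
  shows "distr \<mu> borel (cdf \<mu>) = density lborel (indicator {0<..<measure \<mu> (space \<mu>)})"
proof -
  interpret finite_borel_measure \<mu> by fact
  define R where "R = measure \<mu> (space \<mu>)"
  let ?K = "cdf \<mu>"
  have K_cont: "isCont ?K x" for x using isCont_cdf cont by blast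
  have K_mono: "x \<le> y \<Longrightarrow> ?K x \<le> ?K y" for x y by (rule cdf_nondecreasing)
  have K_nonneg: "0 \<le> ?K x" for x by (rule cdf_nonneg)
  have K_le: "?K x \<le> R" for x unfolding R_def by (rule cdf_bounded)
  have sp: "space \<mu> = UNIV" by (rule borel_UNIV)
  have K_meas [measurable]: "?K \<in> borel_measurable borel"
    by (rule borel_measurable_continuous_onI) (use K_cont continuous_at_imp_continuous_on in blast)
  have K_meas' [measurable]: "?K \<in> measurable \<mu> borel" by (simp add: measurable_cong_sets[OF M_is_borel refl])
  have main: "emeasure \<mu> {u. x < ?K u} = ennreal (R - x)" if x: "0 \<le> x" "x < R" for x
  proof -
    define B where "B = {u. x < ?K u}"
    obtain b where b: "b \<in> B"
    proof -
      have "eventually (\<lambda>u. x < ?K u) at_top"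
        using order_tendstoD(1)[OF cdf_lim_at_top] x by (simp add: R_def)
      then show ?thesis using that by (auto simp: B_def eventually_at_top_linorder)
    qed
    have emB: "emeasure \<mu> {v<..} = ennreal (R - ?K v)" for v
    proof -
      have "measure \<mu> (UNIV - {..v}) = measure \<mu> UNIV - measure \<mu> {..v}"
        by (rule finite_measure_Diff) (auto simp: M_is_borel)
      moreover have "UNIV - {..v} = {v<..}" by auto
      ultimately have "measure \<mu> {v<..} = R - ?K v" by (simp add: R_def sp cdf_def)
      then show ?thesis by (simp add: emeasure_eq_measure)
    qed
    show ?thesis
    proof (cases "B = UNIV")
      case True
      have "x \<le> 0"
      proof (rule tendsto_lowerbound[OF cdf_lim_at_bot])
        show "\<forall>\<^sub>F u in at_bot. x \<le> ?K u" using True by (auto simp: B_def intro!: always_eventually less_imp_le)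
      qed simp
      then have "x = 0" using x by simp
      moreover have "{u. x < ?K u} = space \<mu>" using True sp by (simp add: B_def)
      ultimately show ?thesis by (simp add: R_def emeasure_eq_measure)
    next
      case False
      then obtain a where a: "a \<notin> B" by auto
      have up: "v \<in> B" if "u \<in> B" "u \<le> v" for u v using that K_mono[of u v] by (auto simp: B_def)
      have bdd: "bdd_below B" using a up by (intro bdd_belowI[of _ a]) (metis linear)
      \<comment> \<open>The left end of the superlevel set. By continuity the distribution function
        equals x there, being at least x from the right and at most x from the left; so the set is
        the open ray from v and has mass R - x, even if the function has flat pieces.\<close>
      define v where "v = Inf B"
      have gt: "u \<in> B" if vu: "v < u" for u
      proof -
        obtain w where "w \<in> B" "w < u" using cInf_lessD[of B u] b vu unfolding v_def by blast
        then show ?thesis using up[of w u] by simp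
      qed
      have vge: "x \<le> ?K v"
      proof (rule tendsto_lowerbound)
        show "(?K \<longlongrightarrow> ?K v) (at_right v)"
          using K_cont[of v] by (auto simp: isCont_def intro: filterlim_mono at_le)
        show "\<forall>\<^sub>F u in at_right v. x \<le> ?K u"
          unfolding eventually_at_right_field using gt by (intro exI[of _ "v + 1"]) (auto simp: B_def less_imp_le)
      qed simp
      have "?K v \<le> x"
      proof (rule tendsto_upperbound)
        show "(?K \<longlongrightarrow> ?K v) (at_left v)"
          using K_cont[of v] by (auto simp: isCont_def intro: filterlim_mono at_le)
        have "u \<notin> B" if "u < v" for u using that cInf_lower[OF _ bdd, of u] by (auto simp: v_def)
        then show "\<forall>\<^sub>F u in at_left v. ?K u \<le> x"
          unfolding eventually_at_left_field by (intro exI[of _ "v - 1"]) (auto simp: B_def not_less)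
      qed simp
      then have eq: "?K v = x" using vge by simp
      have "B = {v<..}"
      proof safe
        fix u assume "u \<in> B"
        then have "v \<le> u" using cInf_lower[OF _ bdd] by (simp add: v_def)
        moreover have "u \<noteq> v" using \<open>u \<in> B\<close> eq by (auto simp: B_def)
        ultimately show "u > v" by simp
      qed (use gt in auto)
      then show ?thesis using emB[of v] eq by (simp add: B_def)
    qed
  qed
  show ?thesis unfolding R_def[symmetric]
  proof (rule measure_eqI_lessThan)
    fix x
    have l: "emeasure (distr \<mu> borel ?K) {x<..} = emeasure \<mu> {u. x < ?K u}"
      by (subst emeasure_distr) (auto simp: sp intro!: arg_cong[where f="emeasure \<mu>"])
    have r: "emeasure (density lborel (indicator {0<..<R})) {x<..} = emeasure lborel ({0<..<R} \<inter> {x<..})"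
      by (rule emeasure_restricted) auto
    show "emeasure (distr \<mu> borel ?K) {x<..} < \<infinity>"
      unfolding l by (simp add: emeasure_eq_measure)
    consider "x < 0" | "0 \<le> x" "x < R" | "R \<le> x" "0 \<le> x" by linarith
    then show "emeasure (distr \<mu> borel ?K) {x<..} = emeasure (density lborel (indicator {0<..<R})) {x<..}"
    proof cases
      case 1
      then have "{u. x < ?K u} = space \<mu>" using K_nonneg by (auto simp: sp intro: less_le_trans)
      moreover have "{0<..<R} \<inter> {x<..} = {0<..<R}" using 1 by auto
      ultimately show ?thesis unfolding l r by (simp add: R_def emeasure_eq_measure)
    next
      case 2
      then have "{0<..<R} \<inter> {x<..} = {x<..<R}" by auto
      then show ?thesis unfolding l r using main[OF 2] 2 by simp
    next
      case 3
      then have "{u. x < ?K u} = {}" using K_le by (auto simp: not_less intro: order_trans)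
      moreover have "{0<..<R} \<inter> {x<..} = {}" using 3 by auto
      ultimately show ?thesis unfolding l r by simp
    qed
  qed auto
qed

text \<open>\<open>I\<^sup>s = s \<integral> f(u) (\<integral>\<^sub>u\<^sup>\<infinity> f)\<^sup>s\<^sup>-\<^sup>1 du\<close> without any continuity of \<open>f\<close>: under the measure \<open>f(u) du\<close> the tail integral
  is uniformly distributed.\<close>

lemma powr_total_integral:
  fixes f :: "real \<Rightarrow> real"
  assumes f [measurable]: "f \<in> borel_measurable borel" and nn: "\<And>x. 0 \<le> f x"
    and fin: "(\<integral>\<^sup>+x. ennreal (f x) \<partial>lborel) = ennreal R" and R: "0 < R" and s: "0 < s"
  shows "(\<integral>\<^sup>+u. ennreal (f u) * ennreal (enn2real (\<integral>\<^sup>+x. ennreal (f x) * indicator {u..} x \<partial>lborel) powr (s - 1)) \<partial>lborel)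
    = ennreal (R powr s / s)"
proof -
  define \<mu> where "\<mu> = density lborel f"
  have em: "emeasure \<mu> A = (\<integral>\<^sup>+x. ennreal (f x) * indicator A x \<partial>lborel)" if "A \<in> sets borel" for A
    unfolding \<mu>_def using that by (subst emeasure_density) auto
  have total: "emeasure \<mu> UNIV = ennreal R" using em[of UNIV] fin by simp
  have fbm: "finite_borel_measure \<mu>"
  proof (rule finite_borel_measure.intro)
    show "finite_measure \<mu>" by (rule finite_measureI) (use total in \<open>simp add: \<mu>_def\<close>)
    show "finite_borel_measure_axioms \<mu>" by unfold_locales (simp add: \<mu>_def)
  qed
  interpret finite_borel_measure \<mu> by (rule fbm)
  have R_eq: "measure \<mu> (space \<mu>) = R" using total R by (simp add: measure_def borel_UNIV)
  have atom: "measure \<mu> {x} = 0" for x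
  proof -
    have "AE y in lborel. ennreal (f y) * indicator {x} y = 0"
      using AE_lborel_singleton[of x] by eventually_elim (auto simp: indicator_def)
    then have "emeasure \<mu> {x} = 0" by (subst em) (auto simp: nn_integral_0_iff_AE)
    then show ?thesis by (simp add: measure_def)
  qed
  have tail: "enn2real (\<integral>\<^sup>+x. ennreal (f x) * indicator {u..} x \<partial>lborel) = R - cdf \<mu> u" for u
  proof -
    have "(\<integral>\<^sup>+x. ennreal (f x) * indicator {u..} x \<partial>lborel) = emeasure \<mu> {u..}" by (rule em[symmetric]) simp
    then have "enn2real (\<integral>\<^sup>+x. ennreal (f x) * indicator {u..} x \<partial>lborel) = measure \<mu> {u..}" by (simp add: measure_def)
    also have "measure \<mu> {u..} = measure \<mu> ({u} \<union> {u<..})" by (intro arg_cong[where f="measure \<mu>"]) auto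
    also have "\<dots> = measure \<mu> {u} + measure \<mu> {u<..}" by (rule finite_measure_Union) (auto simp: M_is_borel)
    also have "{u<..} = space \<mu> - {..u}" by (auto simp: borel_UNIV)
    also have "measure \<mu> (space \<mu> - {..u}) = R - cdf \<mu> u"
      by (subst finite_measure_compl) (auto simp: M_is_borel R_eq cdf_def)
    finally show ?thesis by (simp add: atom)
  qed
  have K_cont: "isCont (cdf \<mu>) x" for x using isCont_cdf atom by blast
  have K_meas [measurable]: "cdf \<mu> \<in> borel_measurable borel"
    by (rule borel_measurable_continuous_onI) (use K_cont continuous_at_imp_continuous_on in blast)
  have "(\<integral>\<^sup>+u. ennreal (f u) * ennreal (enn2real (\<integral>\<^sup>+x. ennreal (f x) * indicator {u..} x \<partial>lborel) powr (s - 1)) \<partial>lborel)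
    = (\<integral>\<^sup>+u. ennreal ((R - cdf \<mu> u) powr (s - 1)) \<partial>\<mu>)"
    unfolding tail unfolding \<mu>_def by (rule nn_integral_density[symmetric]) (auto simp: \<mu>_def[symmetric])
  also have "\<dots> = (\<integral>\<^sup>+y. ennreal ((R - y) powr (s - 1)) \<partial>distr \<mu> borel (cdf \<mu>))"
    by (rule nn_integral_distr[symmetric]) (auto simp: measurable_cong_sets[OF M_is_borel refl])
  also have "\<dots> = (\<integral>\<^sup>+y. indicator {0<..<R} y * ennreal ((R - y) powr (s - 1)) \<partial>lborel)"
    unfolding distr_cdf_uniform[OF fbm atom] R_eq by (rule nn_integral_density) auto
  also have "\<dots> = (\<integral>\<^sup>+y. indicator {0<..<R} (R + (-1) * y) * ennreal ((R - (R + (-1) * y)) powr (s - 1)) \<partial>lborel)"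
    using nn_integral_real_affine[of "\<lambda>y. indicator {0<..<R} y * ennreal ((R - y) powr (s - 1))" "-1" R] by simp
  also have "\<dots> = (\<integral>\<^sup>+y. ennreal (indicator {0..R} y * y powr (s - 1)) \<partial>lborel)"
  proof (rule nn_integral_cong_AE)
    show "AE y in lborel. indicator {0<..<R} (R + (-1) * y) * ennreal ((R - (R + (-1) * y)) powr (s - 1)) = ennreal (indicator {0..R} y * y powr (s - 1))"
      using AE_lborel_singleton[of 0] AE_lborel_singleton[of R]
      by eventually_elim (auto simp: indicator_def)
  qed
  also have "\<dots> = ennreal (R powr ((s - 1) + 1) / ((s - 1) + 1))"
    by (rule nn_integral_has_integral_lebesgue[OF _ has_integral_powr_from_0]) (use R s in auto)
  finally show ?thesis by simp
qed

definition ennpowr :: "ennreal \<Rightarrow> real \<Rightarrow> ennreal" where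
  "ennpowr x r = ennreal (enn2real x powr r)"

lemma measurable_ennpowr [measurable]: "(\<lambda>x. ennpowr x r) \<in> borel_measurable borel"
  unfolding ennpowr_def by measurable

lemma ennpowr_mult: "0 \<le> a \<Longrightarrow> ennpowr (ennreal a * x) r = ennreal (a powr r) * ennpowr x r"
  by (simp add: ennpowr_def enn2real_mult powr_mult ennreal_mult)

text \<open>\<open>ennpowr \<infinity> r = 0\<close>, because \<open>enn2real \<infinity> = 0\<close>; this variant maps \<open>\<infinity>\<close> to \<open>\<infinity>\<close>.\<close>

definition toppowr :: "ennreal \<Rightarrow> real \<Rightarrow> ennreal" where
  "toppowr x r = (if x = \<infinity> then \<infinity> else ennpowr x r)"

lemma measurable_toppowr [measurable]: "(\<lambda>x. toppowr x r) \<in> borel_measurable borel"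
  unfolding toppowr_def by measurable

lemma toppowr_mult:
  assumes "0 < a"
  shows "toppowr (ennreal a * x) r = ennreal (a powr r) * toppowr x r"
proof (cases "x = \<infinity>")
  case True
  then show ?thesis using assms by (simp add: toppowr_def ennreal_mult_top)
next
  case False
  then have "ennreal a * x \<noteq> \<infinity>" by (simp add: ennreal_mult_eq_top_iff)
  then show ?thesis using False assms by (simp add: toppowr_def ennpowr_mult)
qed

lemma toppowr_le_iff:
  assumes "0 < s" "0 \<le> R"
  shows "toppowr x s \<le> ennreal R \<longleftrightarrow> x \<le> ennreal (R powr (1 / s))"
proof (cases x)
  case (real r)
  have "r powr s \<le> R \<longleftrightarrow> r \<le> R powr (1 / s)"
  proof
    assume "r powr s \<le> R"
    then have "(r powr s) powr (1 / s) \<le> R powr (1 / s)" using assms by (intro powr_mono2) auto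
    then show "r \<le> R powr (1 / s)" using assms real by (simp add: powr_powr)
  next
    assume "r \<le> R powr (1 / s)"
    then have "r powr s \<le> (R powr (1 / s)) powr s" using assms real by (intro powr_mono2) auto
    then show "r powr s \<le> R" using assms by (simp add: powr_powr)
  qed
  then show ?thesis using real assms by (simp add: toppowr_def ennpowr_def)
qed (simp add: toppowr_def top_unique)

lemma powr_add_le:
  fixes x y :: real
  assumes "0 \<le> x" "0 \<le> y" "0 < s" "s \<le> 1"
  shows "(x + y) powr s \<le> x powr s + y powr s"
proof (cases "x + y = 0")
  case False
  then have p: "x + y > 0" using assms by auto
  have t: "t \<le> t powr s" if "0 \<le> t" "t \<le> 1" for t
    using powr_mono'[of s 1 t] that assms by (cases "t = 0") auto
  have "1 = x / (x + y) + y / (x + y)" using p by (simp add: add_divide_distrib[symmetric])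
  also have "\<dots> \<le> (x / (x + y)) powr s + (y / (x + y)) powr s"
    using p assms by (intro add_mono t) auto
  also have "\<dots> = (x powr s + y powr s) / (x + y) powr s"
    using p assms by (simp add: powr_divide add_divide_distrib)
  finally show ?thesis using p by (simp add: le_divide_eq)
qed (use assms in auto)

lemma toppowr_add_le:
  assumes "0 < s" "s \<le> 1"
  shows "toppowr (x + y) s \<le> toppowr x s + toppowr y s"
proof (cases "x = \<infinity> \<or> y = \<infinity>")
  case False
  then obtain a b where "x = ennreal a" "0 \<le> a" "y = ennreal b" "0 \<le> b"
    by (cases x; cases y) auto
  then show ?thesis using powr_add_le[of a b s] assms
    by (simp add: toppowr_def ennpowr_def ennreal_plus[symmetric] del: ennreal_plus)
qed (auto simp: toppowr_def)

text \<open>Subadditivity of a concave power, extended from finite to infinite sums. Instead of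
  continuity at \<infinity>, the proof uses that a bound on the power is equivalent to a bound on
  its argument, so a common bound on the partial sums is inherited by the series.\<close>

lemma toppowr_suminf_le:
  fixes f :: "nat \<Rightarrow> ennreal"
  assumes s: "0 < s" "s \<le> 1"
  shows "toppowr (\<Sum>n. f n) s \<le> (\<Sum>n. toppowr (f n) s)"
proof (cases "\<Sum>n. toppowr (f n) s")
  case (real R)
  have "(\<Sum>n<N. f n) \<le> ennreal (R powr (1 / s))" for N
  proof -
    have "toppowr (\<Sum>n<N. f n) s \<le> (\<Sum>n<N. toppowr (f n) s)"
    proof (induction N)
      case 0
      then show ?case by (simp add: toppowr_def ennpowr_def)
    next
      case (Suc N)
      have "toppowr (\<Sum>n<Suc N. f n) s \<le> toppowr (\<Sum>n<N. f n) s + toppowr (f N) s"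
        using toppowr_add_le[OF s] by simp
      also have "\<dots> \<le> (\<Sum>n<Suc N. toppowr (f n) s)" using Suc by (simp add: add_right_mono)
      finally show ?case .
    qed
    also have "\<dots> \<le> (\<Sum>n. toppowr (f n) s)" by (intro sum_le_suminf) auto
    finally show ?thesis unfolding real using toppowr_le_iff[OF s(1) real(1)] by simp
  qed
  then have "(\<Sum>n. f n) \<le> ennreal (R powr (1 / s))"
    by (subst suminf_eq_SUP) (auto intro: SUP_least)
  then show ?thesis unfolding real using toppowr_le_iff[OF s(1) real(1)] by simp
qed simp

section \<open>Moments of the exponential functional\<close>

text \<open>\<open>\<Psi> c\<close> stands for \<psi>(-c), the exponent of the killed process, and
  (0, \<theta>) for an interval on which it is negative, so that the corresponding exponential
  moments decay in time; for the hypergeometric process \<theta> is \<beta>'.\<close>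

locale negative_exponent = killed_levy M Y \<zeta> q for M :: "'a measure" and Y \<zeta> q +
  fixes \<alpha> \<theta> :: real and \<Psi> :: "real \<Rightarrow> real"
  assumes \<alpha>: "0 < \<alpha>" and \<theta>: "0 < \<theta>"
    and \<Psi>_neg: "\<And>c. 0 < c \<Longrightarrow> c < \<theta> \<Longrightarrow> \<Psi> c < 0"
    and laplace: "\<And>c. 0 < c \<Longrightarrow> c < \<theta> \<Longrightarrow>
      (\<integral>\<^sup>+\<omega>. indicator {\<omega>. 1 < \<zeta> \<omega>} \<omega> * ennreal (exp (- c * Y 1 \<omega>)) \<partial>M) = ennreal (exp (\<Psi> c))"
begin

lemma expectation_exp_1:
  assumes c: "0 < c" "c < \<theta>"
  shows "(\<integral>\<^sup>+\<omega>. ennreal (exp (- c * Y 1 \<omega>)) \<partial>M) = ennreal (exp (\<Psi> c + q))"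
proof -
  define E where "E = (\<integral>\<^sup>+\<omega>. ennreal (exp (- c * Y 1 \<omega>)) \<partial>M)"
  have "ennreal (exp (\<Psi> c)) = ennreal (exp (- q)) * E"
    using Markov[of 1 "\<lambda>_ _. 1" "- c"] laplace[OF c] by (simp add: E_def emeasure_space_1)
  then have "ennreal (exp q) * ennreal (exp (\<Psi> c)) = (ennreal (exp q) * ennreal (exp (- q))) * E"
    by (simp only: mult.assoc)
  also have "ennreal (exp q) * ennreal (exp (- q)) = 1"
    by (simp add: ennreal_mult[symmetric] exp_add[symmetric])
  finally have "E = ennreal (exp q) * ennreal (exp (\<Psi> c))" by simp
  also have "\<dots> = ennreal (exp (\<Psi> c + q))" by (simp add: ennreal_mult[symmetric] exp_add mult.commute)
  finally show ?thesis by (simp add: E_def)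
qed

text \<open>The unkilled process has exponent \<open>\<Psi> c + q\<close>, and the survival
  probability removes q again.\<close>

lemma Markov_exp:
  assumes u: "0 \<le> u" and c: "0 < c" "c < \<theta>"
    and F: "(\<lambda>(w, z). F w z) \<in> borel_measurable (path_space \<Otimes>\<^sub>M borel)"
  shows "(\<integral>\<^sup>+\<omega>. indicator {\<omega>. ennreal u < \<zeta> \<omega>} \<omega> * ennreal (exp (- c * Y u \<omega>)) * F (shift u \<omega>) (\<zeta> \<omega> - ennreal u) \<partial>M) =
    ennreal (exp (\<Psi> c * u)) * (\<integral>\<^sup>+\<omega>. F (shift 0 \<omega>) (\<zeta> \<omega>) \<partial>M)"
proof -
  have "ennreal (exp (- q * u)) * ennreal (exp ((\<Psi> c + q) * u)) = ennreal (exp (\<Psi> c * u))"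
    by (simp add: ennreal_mult[symmetric] exp_add[symmetric] algebra_simps)
  then show ?thesis
    unfolding Markov[OF u F, of "- c"] expectation_exp[OF expectation_exp_1[OF c] u] by simp
qed

definition J :: "'a \<Rightarrow> ennreal" where
  "J \<omega> = tail \<alpha> 0 (\<zeta> \<omega>) \<omega>"

lemma tail_measurable [measurable]: "(\<lambda>(u, \<omega>). tail \<alpha> u (\<zeta> \<omega>) \<omega>) \<in> borel_measurable (borel \<Otimes>\<^sub>M M)"
proof -
  have "(\<lambda>x. Ym (snd x) (snd (fst x))) \<in> borel_measurable ((borel \<Otimes>\<^sub>M M) \<Otimes>\<^sub>M lborel)"
    using measurable_compose[OF _ Ym_measurable, of "\<lambda>x. (snd x, snd (fst x))"] by simp
  moreover have "(\<lambda>x. indicator {t. fst (fst x) \<le> t \<and> ennreal t < \<zeta> (snd (fst x))} (snd x) :: ennreal) \<in> borel_measurable ((borel \<Otimes>\<^sub>M M) \<Otimes>\<^sub>M lborel)"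
    unfolding indicator_def by measurable
  ultimately have "(\<lambda>x. ennreal (exp (- \<alpha> * Ym (snd x) (snd (fst x)))) * indicator {t. fst (fst x) \<le> t \<and> ennreal t < \<zeta> (snd (fst x))} (snd x)) \<in> borel_measurable ((borel \<Otimes>\<^sub>M M) \<Otimes>\<^sub>M lborel)"
    by measurable
  then show ?thesis
    unfolding tail_def case_prod_beta
    by (intro lborel.borel_measurable_nn_integral) (simp add: case_prod_beta)
qed

lemma J_measurable [measurable]: "J \<in> borel_measurable M"
  unfolding J_def[abs_def] using measurable_compose[OF measurable_Pair1' tail_measurable, of 0] by simp

lemma J_path_functional: "AE \<omega> in M. J \<omega> = path_functional \<alpha> (shift 0 \<omega>) (\<zeta> \<omega>)"
  using Y_0 \<zeta>_pos AE_space
proof eventually_elim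
  case (elim \<omega>)
  then show ?case using tail_eq[of \<omega> 0 "\<zeta> \<omega>" \<alpha>] by (simp add: J_def)
qed

text \<open>With this s the integrand exp(- \<alpha> Y_v) is the power 1/s of exp(- (c/2) Y_v). On
  the unit time interval the integral is therefore at most the power 1/s of the supremum of the grid
  maxima, and the s-th power of that is the supremum itself.\<close>

lemma first_slice_bound:
  assumes c: "0 < c" "c < \<theta>" and s: "s = c / (2 * \<alpha>)"
  shows "(\<integral>\<^sup>+\<omega>. toppowr (path_functional \<alpha> (shift 0 \<omega>) (min 1 (\<zeta> \<omega>))) s \<partial>M) < \<infinity>"
proof -
  have s0: "s > 0" using c \<alpha> s by simp
  have "(\<integral>\<^sup>+\<omega>. toppowr (path_functional \<alpha> (shift 0 \<omega>) (min 1 (\<zeta> \<omega>))) s \<partial>M) \<le> (\<integral>\<^sup>+\<omega>. (SUP N. ennreal (grid_max c N \<omega>)) \<partial>M)"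
  proof (rule nn_integral_mono_AE)
    show "AE \<omega> in M. toppowr (path_functional \<alpha> (shift 0 \<omega>) (min 1 (\<zeta> \<omega>))) s \<le> (SUP N. ennreal (grid_max c N \<omega>))"
      using Y_0 AE_space
    proof eventually_elim
      case (elim \<omega>)
      show ?case
      proof (cases "SUP N. ennreal (grid_max c N \<omega>)")
        case (real S)
        have pt: "exp_path \<alpha> (shift 0 \<omega>) v * indicator {v. 0 \<le> v \<and> ennreal v < min 1 (\<zeta> \<omega>)} v \<le> ennreal (S powr (1 / s)) * indicator {0..1} v" for v
        proof (cases "0 \<le> v \<and> ennreal v < min 1 (\<zeta> \<omega>)")
          case True
          then have v: "0 \<le> v" "v < 1" by (auto simp: ennreal_less_iff simp flip: ennreal_1)
          have "exp (- (c / 2) * Y v \<omega>) \<le> S"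
            using exp_le_SUP_grid_max[of \<omega> v c] elim v real by (simp add: ennreal_le_iff)
          then have "exp (- (c / 2) * Y v \<omega>) powr (1 / s) \<le> S powr (1 / s)" using s0 by (intro powr_mono2) auto
          also have "exp (- (c / 2) * Y v \<omega>) powr (1 / s) = exp (- \<alpha> * Y v \<omega>)"
            using c \<alpha> by (simp add: powr_def s)
          finally show ?thesis using True v elim by (simp add: exp_path_shift ennreal_leI)
        qed simp
        have "path_functional \<alpha> (shift 0 \<omega>) (min 1 (\<zeta> \<omega>)) \<le> (\<integral>\<^sup>+v. ennreal (S powr (1 / s)) * indicator {0..1::real} v \<partial>lborel)"
          unfolding path_functional_def by (rule nn_integral_mono) (rule pt)
        also have "(\<integral>\<^sup>+v. ennreal (S powr (1 / s)) * indicator {0..1::real} v \<partial>lborel) = ennreal (S powr (1 / s))"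
          by (subst nn_integral_cmult_indicator) auto
        finally show ?thesis unfolding real using toppowr_le_iff[OF s0 real(1)] by simp
      next
        case top
        show ?thesis unfolding top by (rule top_greatest)
      qed
    qed
  qed
  also have "\<dots> \<le> ennreal (5 * exp (\<bar>\<Psi> c + q\<bar> / 2))"
    by (rule expectation_SUP_grid_max[OF expectation_exp_1[OF c]])
  also have "\<dots> < \<infinity>" by simp
  finally show ?thesis .
qed

lemma tail_slices:
  assumes \<omega>: "\<omega> \<in> space M"
  shows "tail \<alpha> 0 z \<omega> = (\<Sum>n. tail \<alpha> (real n) (min (ennreal (real (Suc n))) z) \<omega>)"
proof -
  note [measurable] = Ym_measurable_fst[OF \<omega>]
  define A where "A n = {t. real n \<le> t \<and> ennreal t < min (ennreal (real (Suc n))) z}" for n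
  have A: "A n = {t. real n \<le> t \<and> t < real (Suc n) \<and> ennreal t < z}" for n
    unfolding A_def by (auto simp: ennreal_less_iff simp del: ennreal_plus of_nat_Suc)
  have disj: "disjoint_family A"
    unfolding disjoint_family_on_def
  proof (intro ballI impI)
    fix m n :: nat assume "m \<noteq> n"
    then consider "Suc m \<le> n" | "Suc n \<le> m" by linarith
    then show "A m \<inter> A n = {}"
      by cases (auto simp: A simp del: of_nat_Suc dest!: of_nat_mono[where 'a=real])
  qed
  have "(\<Sum>n. ennreal (exp (- \<alpha> * Ym t \<omega>)) * indicator (A n) t) = ennreal (exp (- \<alpha> * Ym t \<omega>)) * indicator {t. 0 \<le> t \<and> ennreal t < z} t" for t
  proof (cases "0 \<le> t \<and> ennreal t < z")
    case True
    then have "t \<in> A (nat \<lfloor>t\<rfloor>)" unfolding A by (auto; linarith)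
    from suminf_cmult_indicator[OF disj this, of "\<lambda>_. ennreal (exp (- \<alpha> * Ym t \<omega>))"] True show ?thesis by simp
  next
    case False
    then have "t \<notin> A n" for n unfolding A by (auto intro: order_trans[of 0 "real n"])
    then show ?thesis using False by simp
  qed
  then have "tail \<alpha> 0 z \<omega> = (\<integral>\<^sup>+t. (\<Sum>n. ennreal (exp (- \<alpha> * Ym t \<omega>)) * indicator (A n) t) \<partial>lborel)"
    by (simp add: tail_def)
  also have "\<dots> = (\<Sum>n. \<integral>\<^sup>+t. ennreal (exp (- \<alpha> * Ym t \<omega>)) * indicator (A n) t \<partial>lborel)"
  proof (rule nn_integral_suminf)
    fix n
    have A_meas: "A n \<in> sets borel" unfolding A by measurable
    define y where "y = (\<lambda>t. Ym t \<omega>)"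
    have [measurable]: "y \<in> borel_measurable borel" unfolding y_def by (rule Ym_measurable_fst[OF \<omega>])
    have "(\<lambda>t. ennreal (exp (- \<alpha> * y t)) * indicator (A n) t) \<in> borel_measurable lborel"
      using A_meas by (intro borel_measurable_times_ennreal) simp_all
    then show "(\<lambda>t. ennreal (exp (- \<alpha> * Ym t \<omega>)) * indicator (A n) t) \<in> borel_measurable lborel" by (simp add: y_def)
  qed
  finally show ?thesis by (simp add: tail_def A_def)
qed

text \<open>Time is cut into unit intervals and \<open>toppowr\<close> is subadditive for
  \<open>s \<le> 1\<close>. By the Markov property at time n, the n-th interval contributes
  \<open>exp (\<Psi> (c / 2) * n)\<close> times the contribution of the first one, and the series is
  geometric because \<open>\<Psi> (c / 2) < 0\<close>.\<close>

lemma J_small_moment: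
  obtains s where "0 < s" "s \<le> 1" "\<alpha> * s < \<theta>" "(\<integral>\<^sup>+\<omega>. toppowr (J \<omega>) s \<partial>M) < \<infinity>"
proof -
  \<comment> \<open>The bound by \<alpha> gives \<open>s \<le> 1 / 2\<close>. Exponent c is needed
    for the maxima on the first interval, and \<open>c / 2 = \<alpha> * s\<close> for the weight of
    the later ones.\<close>
  define c where "c = min (\<theta> / 2) \<alpha>"
  have c: "0 < c" "c < \<theta>" "0 < c / 2" "c / 2 < \<theta>" using \<theta> \<alpha> by (auto simp: c_def)
  define s where "s = c / (2 * \<alpha>)"
  have s: "0 < s" "s \<le> 1" "\<alpha> * s = c / 2" using c \<alpha> by (auto simp: s_def c_def field_simps)
  define F where "F w z = toppowr (path_functional \<alpha> w (min 1 z)) s" for w z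
  have F: "(\<lambda>(w, z). F w z) \<in> borel_measurable (path_space \<Otimes>\<^sub>M borel)"
  proof -
    have "(\<lambda>x. path_functional \<alpha> (fst x) (min 1 (snd x))) \<in> borel_measurable (path_space \<Otimes>\<^sub>M borel)"
      using measurable_compose[OF _ measurable_path_functional, of "\<lambda>x. (fst x, min 1 (snd x))"] by simp
    then show ?thesis unfolding F_def case_prod_beta by measurable
  qed
  define K where "K = (\<integral>\<^sup>+\<omega>. F (shift 0 \<omega>) (\<zeta> \<omega>) \<partial>M)"
  have K: "K < \<infinity>" unfolding K_def F_def by (rule first_slice_bound[OF c(1,2) s_def])
  define G where "G n \<omega> = indicator {\<omega>. ennreal (real n) < \<zeta> \<omega>} \<omega> * ennreal (exp (- (c / 2) * Y (real n) \<omega>)) * F (shift (real n) \<omega>) (\<zeta> \<omega> - ennreal (real n))" for n \<omega>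
  have [measurable]: "G n \<in> borel_measurable M" for n
  proof -
    have [measurable]: "Y (real n) \<in> borel_measurable M" "shift (real n) \<in> measurable M path_space"
      by (auto intro: Y_measurable shift_measurable)
    have "(\<lambda>\<omega>. F (shift (real n) \<omega>) (\<zeta> \<omega> - ennreal (real n))) \<in> borel_measurable M"
      using measurable_compose[OF _ F, of "\<lambda>\<omega>. (shift (real n) \<omega>, \<zeta> \<omega> - ennreal (real n))"] by simp
    moreover have "(\<lambda>\<omega>. indicator {\<omega>. ennreal (real n) < \<zeta> \<omega>} \<omega> :: ennreal) \<in> borel_measurable M"
      unfolding indicator_def by measurable
    ultimately show ?thesis unfolding G_def[abs_def] by measurable
  qed
  have G: "toppowr (tail \<alpha> (real n) (min (ennreal (real (Suc n))) (\<zeta> \<omega>)) \<omega>) s = G n \<omega>" if \<omega>: "\<omega> \<in> space M" for n \<omega>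
  proof (cases "ennreal (real n) < \<zeta> \<omega>")
    case True
    have min_eq: "min (ennreal (real (Suc n))) (\<zeta> \<omega>) - ennreal (real n) = min 1 (\<zeta> \<omega> - ennreal (real n))"
    proof (cases "\<zeta> \<omega>")
      case (real r)
      have rn: "real n < r" using True real by (simp add: ennreal_less_iff)
      show ?thesis
      proof (cases "real (Suc n) \<le> r")
        case True
        have "min (ennreal (real (Suc n))) (ennreal r) = ennreal (real (Suc n))"
          using True by (intro min.absorb1 ennreal_leI)
        moreover have "min (ennreal 1) (ennreal (r - real n)) = ennreal 1"
          using True by (intro min.absorb1 ennreal_leI) simp
        ultimately show ?thesis unfolding real by (simp add: ennreal_minus del: ennreal_plus of_nat_Suc)
      next
        case False
        have "min (ennreal (real (Suc n))) (ennreal r) = ennreal r"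
          using False by (intro min.absorb2 ennreal_leI) simp
        moreover have "min (ennreal 1) (ennreal (r - real n)) = ennreal (r - real n)"
          using False by (intro min.absorb2 ennreal_leI) simp
        ultimately show ?thesis unfolding real by (simp add: ennreal_minus del: ennreal_plus of_nat_Suc)
      qed
    next
      case top
      then show ?thesis by (simp add: ennreal_minus min_def top_unique del: ennreal_plus flip: ennreal_1)
    qed
    have "ennreal (real n) < min (ennreal (real (Suc n))) (\<zeta> \<omega>)" using True by (simp add: ennreal_less_iff del: ennreal_plus)
    then have "tail \<alpha> (real n) (min (ennreal (real (Suc n))) (\<zeta> \<omega>)) \<omega> =
      ennreal (exp (- \<alpha> * Y (real n) \<omega>)) * path_functional \<alpha> (shift (real n) \<omega>) (min 1 (\<zeta> \<omega> - ennreal (real n)))"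
      using tail_eq[of \<omega> "real n" "min (ennreal (real (Suc n))) (\<zeta> \<omega>)" \<alpha>] \<omega> by (simp only: min_eq of_nat_0_le_iff)
    moreover have "exp (- \<alpha> * Y (real n) \<omega>) powr s = exp (- (c / 2) * Y (real n) \<omega>)"
      by (simp add: powr_def s(3)[symmetric])
    ultimately show ?thesis using True by (simp add: toppowr_mult G_def F_def)
  next
    case False
    have "{t. real n \<le> t \<and> ennreal t < min (ennreal (real (Suc n))) (\<zeta> \<omega>)} = {}"
    proof safe
      fix t assume t: "real n \<le> t" "ennreal t < min (ennreal (real (Suc n))) (\<zeta> \<omega>)"
      have "ennreal (real n) \<le> ennreal t" using t(1) by (rule ennreal_leI)
      also have "ennreal t < \<zeta> \<omega>" using t(2) by simp
      finally show "t \<in> {}" using False by simp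
    qed
    then have "tail \<alpha> (real n) (min (ennreal (real (Suc n))) (\<zeta> \<omega>)) \<omega> = 0" unfolding tail_def by simp
    then show ?thesis using False by (simp add: G_def toppowr_def ennpowr_def)
  qed
  have "(\<integral>\<^sup>+\<omega>. toppowr (J \<omega>) s \<partial>M) \<le> (\<integral>\<^sup>+\<omega>. (\<Sum>n. G n \<omega>) \<partial>M)"
  proof (rule nn_integral_mono)
    fix \<omega> assume \<omega>: "\<omega> \<in> space M"
    have "toppowr (J \<omega>) s \<le> (\<Sum>n. toppowr (tail \<alpha> (real n) (min (ennreal (real (Suc n))) (\<zeta> \<omega>)) \<omega>) s)"
      unfolding J_def tail_slices[OF \<omega>] by (rule toppowr_suminf_le[OF s(1,2)])
    then show "toppowr (J \<omega>) s \<le> (\<Sum>n. G n \<omega>)" by (simp only: G[OF \<omega>])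
  qed
  also have "\<dots> = (\<Sum>n. \<integral>\<^sup>+\<omega>. G n \<omega> \<partial>M)" by (rule nn_integral_suminf) measurable
  also have "\<dots> = (\<Sum>n. ennreal (exp (\<Psi> (c / 2) * real n)) * K)"
    unfolding G_def K_def by (subst Markov_exp[OF _ c(3,4) F]) auto
  also have "\<dots> = (\<Sum>n. ennreal (exp (\<Psi> (c / 2)) ^ n)) * K"
    by (simp add: exp_of_nat_mult[symmetric] mult.commute)
  also have "(\<Sum>n. ennreal (exp (\<Psi> (c / 2)) ^ n)) = ennreal (1 / (1 - exp (\<Psi> (c / 2))))"
    using \<Psi>_neg[OF c(3,4)] by (intro suminf_ennreal_eq geometric_sums) auto
  also have "\<dots> * K < \<infinity>" using K by (simp add: ennreal_mult_less_top)
  finally show ?thesis using that s c by simp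
qed

lemma J_finite: "AE \<omega> in M. J \<omega> < \<infinity>"
proof -
  obtain s where s: "0 < s" "(\<integral>\<^sup>+\<omega>. toppowr (J \<omega>) s \<partial>M) < \<infinity>" using J_small_moment by blast
  have "AE \<omega> in M. toppowr (J \<omega>) s \<noteq> \<infinity>"
    by (rule nn_integral_PInf_AE) (use s in auto)
  then show ?thesis by eventually_elim (auto simp: toppowr_def top.not_eq_extremum split: if_splits)
qed

lemma J_pos: "AE \<omega> in M. 0 < J \<omega>"
  using \<zeta>_pos AE_space
proof eventually_elim
  case (elim \<omega>)
  note [measurable] = Ym_measurable_fst[OF elim(2)]
  have "J \<omega> \<noteq> 0"
  proof
    assume "J \<omega> = 0"
    then have "AE t in lborel. ennreal (exp (- \<alpha> * Ym t \<omega>)) * indicator {t. 0 \<le> t \<and> ennreal t < \<zeta> \<omega>} t = 0"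
      unfolding J_def tail_def by (subst (asm) nn_integral_0_iff_AE) auto
    then have ae: "AE t in lborel. \<not> (0 \<le> t \<and> ennreal t < \<zeta> \<omega>)"
      by eventually_elim (auto simp: indicator_def split: if_splits)
    obtain r where r: "0 < r" "ennreal r < \<zeta> \<omega>"
    proof (cases "\<zeta> \<omega>")
      case (real z)
      then have "0 < z / 2" "ennreal (z / 2) < \<zeta> \<omega>" using elim(1) by (auto simp: ennreal_less_iff)
      then show ?thesis by (rule that)
    next
      case top
      then show ?thesis by (intro that[of 1]) auto
    qed
    from ae have "AE t in lborel. t \<notin> {0..r}"
    proof eventually_elim
      case (elim t)
      then show ?case using r by (auto dest: order.strict_trans1[OF ennreal_leI])
    qed
    moreover have eq: "{t \<in> space lborel. \<not> t \<notin> {0..r}} = {0..r}" by auto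
    ultimately have "emeasure lborel {0..r} = 0"
      by (subst (asm) AE_iff_measurable[OF _ eq]) simp_all
    then show False using r by simp
  qed
  then show ?case by (simp add: zero_less_iff_neq_zero)
qed

text \<open>Apply \<open>I\<^sup>s = s \<integral> f(u) (\<integral>\<^sub>u\<^sup>\<infinity> f)\<^sup>s\<^sup>-\<^sup>1 du\<close> pathwise and the Markov property at every \<open>u\<close>. Both sides may be infinite
  here; finiteness of the moments is then propagated upwards from small exponents.\<close>

lemma moment_recurrence:
  assumes s: "0 < s" "\<alpha> * s < \<theta>"
  shows "(\<integral>\<^sup>+\<omega>. ennpowr (J \<omega>) s \<partial>M) = ennreal (s / (- \<Psi> (\<alpha> * s))) * (\<integral>\<^sup>+\<omega>. ennpowr (J \<omega>) (s - 1) \<partial>M)"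
proof -
  define f where "f u \<omega> = exp (- \<alpha> * Ym u \<omega>) * indicator {u. 0 \<le> u \<and> ennreal u < \<zeta> \<omega>} u" for u \<omega>
  have f_meas [measurable]: "(\<lambda>(u, \<omega>). f u \<omega>) \<in> borel_measurable (borel \<Otimes>\<^sub>M M)"
  proof -
    have "(\<lambda>x. indicator {u. 0 \<le> u \<and> ennreal u < \<zeta> (snd x)} (fst x) :: real) \<in> borel_measurable (borel \<Otimes>\<^sub>M M)"
      unfolding indicator_def by measurable
    moreover have "(\<lambda>x. Ym (fst x) (snd x)) \<in> borel_measurable (borel \<Otimes>\<^sub>M M)"
      using Ym_measurable by (simp add: case_prod_beta)
    ultimately show ?thesis unfolding f_def case_prod_beta by measurable
  qed
  define g where "g u \<omega> = ennreal (f u \<omega>) * ennpowr (tail \<alpha> u (\<zeta> \<omega>) \<omega>) (s - 1)" for u \<omega>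
  have g_meas: "(\<lambda>(u, \<omega>). g u \<omega>) \<in> borel_measurable (lborel \<Otimes>\<^sub>M M)"
  proof -
    have "(\<lambda>x. ennpowr (tail \<alpha> (fst x) (\<zeta> (snd x)) (snd x)) (s - 1)) \<in> borel_measurable (borel \<Otimes>\<^sub>M M)"
      using measurable_compose[OF tail_measurable measurable_ennpowr] by (simp add: case_prod_beta)
    moreover have "(\<lambda>x. ennreal (f (fst x) (snd x))) \<in> borel_measurable (borel \<Otimes>\<^sub>M M)"
      using f_meas by (simp add: case_prod_beta)
    ultimately show ?thesis unfolding g_def case_prod_beta
      by (simp cong: measurable_cong_sets sets_pair_measure_cong)
  qed
  have \<alpha>s: "0 < \<alpha> * s" using \<alpha> s by simp
  \<comment> \<open>\<open>powr_total_integral\<close> needs a positive finite total. The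
    restriction to finite J is essential since \<open>ennpowr\<close> sends \<infinity> to
    0.\<close>
  have path: "AE \<omega> in M. ennpowr (J \<omega>) s = ennreal s * (\<integral>\<^sup>+u. g u \<omega> \<partial>lborel)"
    using J_finite J_pos AE_space
  proof eventually_elim
    case (elim \<omega>)
    then obtain R where R: "J \<omega> = ennreal R" "0 < R" by (cases "J \<omega>") auto
    have fm: "(\<lambda>u. f u \<omega>) \<in> borel_measurable borel"
      using measurable_compose[OF measurable_Pair2'[OF elim(3)] f_meas] by simp
    have ef: "ennreal (f t \<omega>) = ennreal (exp (- \<alpha> * Ym t \<omega>)) * indicator {t. 0 \<le> t \<and> ennreal t < \<zeta> \<omega>} t" for t
      by (auto simp: f_def indicator_def)
    have fin: "(\<integral>\<^sup>+t. ennreal (f t \<omega>) \<partial>lborel) = ennreal R"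
      unfolding ef R(1)[symmetric] J_def tail_def ..
    have "(\<integral>\<^sup>+u. ennreal (f u \<omega>) * ennreal (enn2real (\<integral>\<^sup>+x. ennreal (f x \<omega>) * indicator {u..} x \<partial>lborel) powr (s - 1)) \<partial>lborel)
       = ennreal (R powr s / s)"
      by (rule powr_total_integral[OF fm _ fin R(2) s(1)]) (simp add: f_def)
    also have "(\<lambda>u. ennreal (f u \<omega>) * ennreal (enn2real (\<integral>\<^sup>+x. ennreal (f x \<omega>) * indicator {u..} x \<partial>lborel) powr (s - 1))) = (\<lambda>u. g u \<omega>)"
    proof
      fix u
      show "ennreal (f u \<omega>) * ennreal (enn2real (\<integral>\<^sup>+x. ennreal (f x \<omega>) * indicator {u..} x \<partial>lborel) powr (s - 1)) = g u \<omega>"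
      proof (cases "0 \<le> u")
        case True
        have "(\<integral>\<^sup>+x. ennreal (f x \<omega>) * indicator {u..} x \<partial>lborel) = tail \<alpha> u (\<zeta> \<omega>) \<omega>"
          unfolding tail_def ef using True by (intro nn_integral_cong) (auto simp: indicator_def)
        then show ?thesis by (simp add: g_def ennpowr_def)
      qed (simp add: g_def f_def)
    qed
    finally have "ennreal s * (\<integral>\<^sup>+u. g u \<omega> \<partial>lborel) = ennreal s * ennreal (R powr s / s)" by simp
    also have "\<dots> = ennpowr (J \<omega>) s" using s R by (simp add: ennreal_mult[symmetric] ennpowr_def)
    finally show ?case by simp
  qed
  define K where "K = (\<integral>\<^sup>+\<omega>. ennpowr (J \<omega>) (s - 1) \<partial>M)"
  define F where "F w z = ennpowr (path_functional \<alpha> w z) (s - 1)" for w z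
  have F: "(\<lambda>(w, z). F w z) \<in> borel_measurable (path_space \<Otimes>\<^sub>M borel)"
    using measurable_compose[OF measurable_path_functional measurable_ennpowr] by (simp add: F_def case_prod_beta)
  have KF: "K = (\<integral>\<^sup>+\<omega>. F (shift 0 \<omega>) (\<zeta> \<omega>) \<partial>M)"
    unfolding K_def using J_path_functional by (intro nn_integral_cong_AE) (auto simp: F_def elim!: eventually_mono)
  have inner: "(\<integral>\<^sup>+\<omega>. g u \<omega> \<partial>M) = ennreal (exp (\<Psi> (\<alpha> * s) * u)) * indicator {0..} u * K" for u
  proof (cases "0 \<le> u")
    case True
    have "(\<integral>\<^sup>+\<omega>. g u \<omega> \<partial>M) = (\<integral>\<^sup>+\<omega>. indicator {\<omega>. ennreal u < \<zeta> \<omega>} \<omega> * ennreal (exp (- (\<alpha> * s) * Y u \<omega>)) * F (shift u \<omega>) (\<zeta> \<omega> - ennreal u) \<partial>M)"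
    proof (intro nn_integral_cong)
      fix \<omega> assume \<omega>: "\<omega> \<in> space M"
      show "g u \<omega> = indicator {\<omega>. ennreal u < \<zeta> \<omega>} \<omega> * ennreal (exp (- (\<alpha> * s) * Y u \<omega>)) * F (shift u \<omega>) (\<zeta> \<omega> - ennreal u)"
      proof (cases "ennreal u < \<zeta> \<omega>")
        case True
        have "g u \<omega> = ennreal (exp (- \<alpha> * Y u \<omega>)) * (ennreal (exp (- \<alpha> * Y u \<omega>) powr (s - 1)) * F (shift u \<omega>) (\<zeta> \<omega> - ennreal u))"
          using tail_eq[OF \<omega> \<open>0 \<le> u\<close> True, of \<alpha>] True \<open>0 \<le> u\<close> by (simp add: g_def f_def F_def ennpowr_mult Ym_def)
        also have "\<dots> = ennreal (exp (- \<alpha> * Y u \<omega>) * exp (- \<alpha> * Y u \<omega>) powr (s - 1)) * F (shift u \<omega>) (\<zeta> \<omega> - ennreal u)"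
          by (simp add: ennreal_mult mult.assoc)
        \<comment> \<open>The density contributes \<alpha> and the power of the tail contributes
          \<alpha>(s - 1), in total \<alpha> s, the argument of the exponent in the
          recurrence.\<close>
        also have "exp (- \<alpha> * Y u \<omega>) * exp (- \<alpha> * Y u \<omega>) powr (s - 1) = exp (- (\<alpha> * s) * Y u \<omega>)"
          by (simp add: powr_def exp_add[symmetric] algebra_simps)
        finally show ?thesis using True by simp
      qed (simp add: g_def f_def)
    qed
    also have "\<dots> = ennreal (exp (\<Psi> (\<alpha> * s) * u)) * K"
      unfolding KF by (rule Markov_exp[OF True \<alpha>s s(2) F])
    finally show ?thesis using True by simp
  qed (simp add: g_def f_def)
  have int_exp: "(\<integral>\<^sup>+u. ennreal (exp (\<Psi> (\<alpha> * s) * u)) * indicator {0..} u \<partial>lborel) = ennreal (1 / (- \<Psi> (\<alpha> * s)))"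
  proof -
    have neg: "\<Psi> (\<alpha> * s) < 0" by (rule \<Psi>_neg[OF \<alpha>s s(2)])
    have lim: "((\<lambda>u. exp (\<Psi> (\<alpha> * s) * u) / \<Psi> (\<alpha> * s)) \<longlongrightarrow> 0) at_top"
      using neg by real_asymp
    have "(\<integral>\<^sup>+u. ennreal (exp (\<Psi> (\<alpha> * s) * u)) * indicator {0..} u \<partial>lborel) = ennreal (0 - exp (\<Psi> (\<alpha> * s) * 0) / \<Psi> (\<alpha> * s))"
      by (rule nn_integral_FTC_atLeast[OF _ _ _ lim]) (use neg in \<open>auto intro!: derivative_eq_intros\<close>)
    then show ?thesis by simp
  qed
  interpret P: pair_sigma_finite lborel M by unfold_locales
  have g_meas': "(\<lambda>\<omega>. \<integral>\<^sup>+u. g u \<omega> \<partial>lborel) \<in> borel_measurable M"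
    using measurable_compose[OF measurable_pair_swap' g_meas]
    by (intro lborel.borel_measurable_nn_integral) (simp add: case_prod_beta)
  have "(\<integral>\<^sup>+\<omega>. ennpowr (J \<omega>) s \<partial>M) = (\<integral>\<^sup>+\<omega>. ennreal s * (\<integral>\<^sup>+u. g u \<omega> \<partial>lborel) \<partial>M)"
    by (rule nn_integral_cong_AE[OF path])
  also have "\<dots> = ennreal s * (\<integral>\<^sup>+\<omega>. (\<integral>\<^sup>+u. g u \<omega> \<partial>lborel) \<partial>M)"
    by (rule nn_integral_cmult[OF g_meas'])
  also have "(\<integral>\<^sup>+\<omega>. (\<integral>\<^sup>+u. g u \<omega> \<partial>lborel) \<partial>M) = (\<integral>\<^sup>+u. (\<integral>\<^sup>+\<omega>. g u \<omega> \<partial>M) \<partial>lborel)"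
    by (rule P.Fubini'[OF g_meas])
  also have "\<dots> = (\<integral>\<^sup>+u. ennreal (exp (\<Psi> (\<alpha> * s) * u)) * indicator {0..} u * K \<partial>lborel)"
    by (simp only: inner)
  also have "\<dots> = ennreal (1 / (- \<Psi> (\<alpha> * s))) * K"
    by (subst nn_integral_multc) (simp_all add: int_exp[simplified])
  also have "ennreal s * (ennreal (1 / (- \<Psi> (\<alpha> * s))) * K) = ennreal (s / (- \<Psi> (\<alpha> * s))) * K"
    using s \<Psi>_neg[OF \<alpha>s s(2)] by (simp add: mult.assoc[symmetric] ennreal_mult[symmetric] divide_nonneg_nonpos divide_nonpos_nonneg)
  finally show ?thesis by (simp add: K_def)
qed

lemma ennpowr_le:
  assumes "r \<le> t" "0 \<le> r"
  shows "ennpowr x r \<le> 1 + ennpowr x t"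
proof -
  define y where "y = enn2real x"
  have y: "0 \<le> y" by (simp add: y_def)
  have "y powr r \<le> 1 + y powr t"
  proof (cases "y \<le> 1")
    case True
    then have "y powr r \<le> 1" using y assms by (simp add: powr_le1)
    then show ?thesis using powr_ge_zero[of y t] by linarith
  next
    case False
    then have "y powr r \<le> y powr t" using assms by (intro powr_mono) auto
    then show ?thesis by linarith
  qed
  then show ?thesis unfolding ennpowr_def y_def[symmetric]
    by (simp add: ennreal_leI ennreal_plus[symmetric] flip: ennreal_1 del: ennreal_plus)
qed

text \<open>From one small positive order s0 all orders in [0, s0] follow. The recurrence read
  backwards then gives the orders just above -1, a pointwise bound fills the gap up to 0, and the
  recurrence read forwards raises the order by 1 as long as
  \<open>\<alpha> * r < \<theta>\<close>.\<close>

lemma J_moment_finite: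
  assumes r: "- 1 < r" "\<alpha> * r < \<theta>"
  shows "(\<integral>\<^sup>+\<omega>. ennpowr (J \<omega>) r \<partial>M) < \<infinity>"
proof -
  obtain s0 where s0: "0 < s0" "s0 \<le> 1" "\<alpha> * s0 < \<theta>" "(\<integral>\<^sup>+\<omega>. toppowr (J \<omega>) s0 \<partial>M) < \<infinity>"
    by (rule J_small_moment)
  have m0: "(\<integral>\<^sup>+\<omega>. ennpowr (J \<omega>) s0 \<partial>M) < \<infinity>"
  proof -
    have "(\<integral>\<^sup>+\<omega>. ennpowr (J \<omega>) s0 \<partial>M) \<le> (\<integral>\<^sup>+\<omega>. toppowr (J \<omega>) s0 \<partial>M)"
      by (intro nn_integral_mono) (simp add: toppowr_def)
    then show ?thesis using s0 by simp
  qed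
  have small: "(\<integral>\<^sup>+\<omega>. ennpowr (J \<omega>) s \<partial>M) < \<infinity>" if "0 \<le> s" "s \<le> s0" for s
  proof -
    have "(\<integral>\<^sup>+\<omega>. ennpowr (J \<omega>) s \<partial>M) \<le> (\<integral>\<^sup>+\<omega>. 1 + ennpowr (J \<omega>) s0 \<partial>M)"
      using that by (intro nn_integral_mono ennpowr_le) auto
    also have "\<dots> = 1 + (\<integral>\<^sup>+\<omega>. ennpowr (J \<omega>) s0 \<partial>M)"
      by (subst nn_integral_add) (auto simp: emeasure_space_1)
    also have "\<dots> < \<infinity>" using m0 by simp
    finally show ?thesis .
  qed
  \<comment> \<open>The factor in the recurrence is strictly positive, so an infinite moment of
    order s - 1 would make the moment of order s infinite too.\<close>
  have down: "(\<integral>\<^sup>+\<omega>. ennpowr (J \<omega>) (s - 1) \<partial>M) < \<infinity>" if s: "0 < s" "s \<le> s0" for s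
  proof (rule ccontr)
    assume "\<not> (\<integral>\<^sup>+\<omega>. ennpowr (J \<omega>) (s - 1) \<partial>M) < \<infinity>"
    then have top: "(\<integral>\<^sup>+\<omega>. ennpowr (J \<omega>) (s - 1) \<partial>M) = \<infinity>" by (metis infinity_ennreal_def top.not_eq_extremum)
    have \<alpha>s: "\<alpha> * s < \<theta>" using s s0 \<alpha> by (meson le_less_trans mult_left_mono less_imp_le)
    have "0 < s / (- \<Psi> (\<alpha> * s))" using \<Psi>_neg[of "\<alpha> * s"] s \<alpha> \<alpha>s by (intro divide_pos_pos) auto
    then have "ennreal (s / (- \<Psi> (\<alpha> * s))) \<noteq> 0" by (simp only: ennreal_eq_0_iff not_le)
    then have "(\<integral>\<^sup>+\<omega>. ennpowr (J \<omega>) s \<partial>M) = \<infinity>"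
      unfolding moment_recurrence[OF s(1) \<alpha>s] top by (simp only: infinity_ennreal_def ennreal_mult_eq_top_iff) simp
    then show False using small[of s] s by simp
  qed
  have neg: "(\<integral>\<^sup>+\<omega>. ennpowr (J \<omega>) r \<partial>M) < \<infinity>" if r: "- 1 < r" "r \<le> 0" for r
  proof (cases "r + 1 \<le> s0")
    case True
    then show ?thesis using down[of "r + 1"] r by simp
  next
    case False
    have "ennpowr x r \<le> 1 + ennpowr x (s0 - 1)" for x
    proof -
      define y where "y = enn2real x"
      have y: "0 \<le> y" by (simp add: y_def)
      have "y powr r \<le> 1 + y powr (s0 - 1)"
      proof (cases "y \<le> 1")
        case True
        then have "y powr r \<le> y powr (s0 - 1)" using y False by (cases "y = 0") (auto intro!: powr_mono')
        then show ?thesis by linarith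
      next
        case False
        then have "y powr r \<le> y powr 0" using r by (intro powr_mono) auto
        then have "y powr r \<le> 1" using False by simp
        then show ?thesis using powr_ge_zero[of y "s0 - 1"] by linarith
      qed
      then show ?thesis unfolding ennpowr_def y_def[symmetric]
        by (simp add: ennreal_leI ennreal_plus[symmetric] flip: ennreal_1 del: ennreal_plus)
    qed
    then have "(\<integral>\<^sup>+\<omega>. ennpowr (J \<omega>) r \<partial>M) \<le> (\<integral>\<^sup>+\<omega>. 1 + ennpowr (J \<omega>) (s0 - 1) \<partial>M)"
      by (intro nn_integral_mono)
    also have "\<dots> = 1 + (\<integral>\<^sup>+\<omega>. ennpowr (J \<omega>) (s0 - 1) \<partial>M)"
      by (subst nn_integral_add) (auto simp: emeasure_space_1)
    also have "\<dots> < \<infinity>" using down[of s0] s0 by simp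
    finally show ?thesis .
  qed
  have "(\<integral>\<^sup>+\<omega>. ennpowr (J \<omega>) r \<partial>M) < \<infinity>" if "- 1 < r" "\<alpha> * r < \<theta>" "r \<le> real n" for r n
    using that
  proof (induction n arbitrary: r)
    case 0
    then show ?case using neg by simp
  next
    case (Suc n)
    show ?case
    proof (cases "r \<le> 0")
      case True
      then show ?thesis using neg Suc by simp
    next
      case False
      then have r0: "0 < r" by simp
      have "\<alpha> * (r - 1) < \<theta>" using Suc(3) \<alpha> by (simp add: algebra_simps)
      then have "(\<integral>\<^sup>+\<omega>. ennpowr (J \<omega>) (r - 1) \<partial>M) < \<infinity>" using Suc.IH[of "r - 1"] Suc.prems r0 by simp
      then show ?thesis unfolding moment_recurrence[OF r0 Suc.prems(2)] by (simp add: ennreal_mult_less_top)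
    qed
  qed
  moreover have "r \<le> real (nat \<lceil>r\<rceil>)" by linarith
  ultimately show ?thesis using r by blast
qed

end

section \<open>The Mellin transform\<close>

text \<open>Differentiation under the integral sign, by dominated convergence of difference
  quotients along arbitrary sequences. The majorant comes from moments on both sides of Re s0, one
  for large and one for small values of V.\<close>

lemma (in prob_space) mellin_transform_holomorphic:
  fixes V :: "'a \<Rightarrow> real"
  assumes V [measurable]: "V \<in> borel_measurable M" and pos: "AE \<omega> in M. 0 < V \<omega>"
    and fin: "\<And>r. a < r \<Longrightarrow> r < b \<Longrightarrow> (\<integral>\<^sup>+\<omega>. ennreal (V \<omega> powr r) \<partial>M) < \<infinity>"
  shows "\<And>s. a < Re s \<Longrightarrow> Re s < b \<Longrightarrow> integrable M (\<lambda>\<omega>. complex_of_real (V \<omega>) powr s)"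
    and "(\<lambda>s. \<integral>\<omega>. complex_of_real (V \<omega>) powr s \<partial>M) holomorphic_on {s. a < Re s \<and> Re s < b}"
proof -
  have meas [measurable]: "(\<lambda>\<omega>. complex_of_real (V \<omega>) powr s) \<in> borel_measurable M" for s
  proof -
    have "(\<lambda>x. complex_of_real x powr s) = (\<lambda>x. if x = 0 then 0 else exp (s * of_real (if x > 0 then ln x else ln (- x)) + (if x > 0 then 0 else s * (\<i> * of_real pi))))"
    proof
      fix x :: real
      consider "x = 0" | "x > 0" | "x < 0" by linarith
      then show "complex_of_real x powr s = (if x = 0 then 0 else exp (s * of_real (if x > 0 then ln x else ln (- x)) + (if x > 0 then 0 else s * (\<i> * of_real pi))))"
      proof cases
        case 3
        then have "Ln (of_real x) = of_real (ln (- x)) + \<i> * of_real pi"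
          using Ln_minus[of "of_real (- x)"] Ln_of_real[of "- x"] by (simp add: Ln_of_real)
        then show ?thesis using 3 by (simp add: powr_def algebra_simps)
      qed (auto simp: powr_def Ln_of_real)
    qed
    then have "(\<lambda>x. complex_of_real x powr s) \<in> borel_measurable borel" by simp
    from measurable_compose[OF V this] show ?thesis .
  qed
  have norm_eq: "norm (complex_of_real (V \<omega>) powr s) = V \<omega> powr Re s" if "0 < V \<omega>" for \<omega> s
    using that by (simp add: norm_powr_real_powr)
  have int_real: "integrable M (\<lambda>\<omega>. V \<omega> powr r)" if "a < r" "r < b" for r
    using fin[OF that] by (intro integrableI_nonneg) auto
  show int: "integrable M (\<lambda>\<omega>. complex_of_real (V \<omega>) powr s)" if "a < Re s" "Re s < b" for s
  proof (rule Bochner_Integration.integrable_bound[OF int_real[OF that]])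
    show "AE \<omega> in M. norm (complex_of_real (V \<omega>) powr s) \<le> norm (V \<omega> powr Re s)"
      using pos by eventually_elim (simp add: norm_eq)
  qed measurable
  have "open {s. a < Re s \<and> Re s < b}"
    by (intro open_Collect_conj open_Collect_less continuous_intros)
  moreover have "\<exists>D. ((\<lambda>s. \<integral>\<omega>. complex_of_real (V \<omega>) powr s \<partial>M) has_field_derivative D) (at s0)" if s0: "a < Re s0" "Re s0 < b" for s0
  proof -
    \<comment> \<open>The strip must leave room for 2 \<epsilon> on each side: one \<epsilon> covers
      the distance of the sequence from s0, the other absorbs the logarithm through
      \<open>\<bar>L\<bar> \<le> 1 / \<epsilon> * exp (\<epsilon> * \<bar>L\<bar>)\<close>.\<close>
    define \<epsilon> where "\<epsilon> = min (Re s0 - a) (b - Re s0) / 3"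
    have \<epsilon>: "\<epsilon> > 0" "a < Re s0 - 2 * \<epsilon>" "Re s0 + 2 * \<epsilon> < b" using s0 by (auto simp: \<epsilon>_def min_def field_simps)
    define w where "w \<omega> = 1 / \<epsilon> * (V \<omega> powr (Re s0 + 2 * \<epsilon>) + V \<omega> powr (Re s0 - 2 * \<epsilon>))" for \<omega>
    have w: "integrable M w"
      unfolding w_def using \<epsilon> s0 by (intro integrable_mult_right Bochner_Integration.integrable_add int_real) auto
    define D where "D = (\<integral>\<omega>. of_real (ln (V \<omega>)) * complex_of_real (V \<omega>) powr s0 \<partial>M)"
    have "((\<lambda>s. ((\<integral>\<omega>. complex_of_real (V \<omega>) powr s \<partial>M) - (\<integral>\<omega>. complex_of_real (V \<omega>) powr s0 \<partial>M)) / (s - s0)) \<longlongrightarrow> D) (at s0)"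
      unfolding tendsto_at_iff_sequentially comp_def
    proof (intro allI impI)
      fix X :: "nat \<Rightarrow> complex" assume X: "\<forall>i. X i \<in> UNIV - {s0}" "X \<longlonglongrightarrow> s0"
      have "\<forall>\<^sub>F i in sequentially. norm (X i - s0) < \<epsilon>"
        using X(2) \<epsilon>(1) by (auto simp: tendsto_iff dist_norm)
      then obtain N where N: "\<And>i. i \<ge> N \<Longrightarrow> norm (X i - s0) < \<epsilon>" by (auto simp: eventually_sequentially)
      define x where "x i = X (i + N)" for i
      have x: "norm (x i - s0) < \<epsilon>" "x i \<noteq> s0" for i using N[of "i + N"] X(1) by (auto simp: x_def)
      have xlim: "x \<longlonglongrightarrow> s0" unfolding x_def by (rule LIMSEQ_ignore_initial_segment[OF X(2)])
      have "\<bar>Re (x i) - Re s0\<bar> < \<epsilon>" for i using x(1)[of i] abs_Re_le_cmod[of "x i - s0"] by simp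
      then have xs: "a < Re (x i)" "Re (x i) < b" for i
        using \<epsilon> by (smt (verit))+
      define q where "q i \<omega> = (complex_of_real (V \<omega>) powr x i - complex_of_real (V \<omega>) powr s0) / (x i - s0)" for i \<omega>
      have "(\<lambda>i. \<integral>\<omega>. q i \<omega> \<partial>M) \<longlonglongrightarrow> D"
        unfolding D_def
      proof (rule integral_dominated_convergence[OF _ _ w])
        show "(\<lambda>\<omega>. of_real (ln (V \<omega>)) * complex_of_real (V \<omega>) powr s0) \<in> borel_measurable M" by measurable
        show "q i \<in> borel_measurable M" for i unfolding q_def by measurable
        show "AE \<omega> in M. (\<lambda>i. q i \<omega>) \<longlonglongrightarrow> of_real (ln (V \<omega>)) * complex_of_real (V \<omega>) powr s0"
          using pos
        proof eventually_elim
          case (elim \<omega>)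
          have "((\<lambda>s. complex_of_real (V \<omega>) powr s) has_field_derivative of_real (ln (V \<omega>)) * complex_of_real (V \<omega>) powr s0) (at s0)"
            using elim by (auto simp: powr_def Ln_of_real intro!: derivative_eq_intros)
          then have "((\<lambda>s. (complex_of_real (V \<omega>) powr s - complex_of_real (V \<omega>) powr s0) / (s - s0)) \<longlongrightarrow> of_real (ln (V \<omega>)) * complex_of_real (V \<omega>) powr s0) (at s0)"
            by (simp add: has_field_derivative_iff)
          then show ?case
            unfolding q_def tendsto_at_iff_sequentially comp_def using x(2) xlim by auto
        qed
        show "AE \<omega> in M. norm (q i \<omega>) \<le> w \<omega>" for i
          using pos
        proof eventually_elim
          case (elim \<omega>)
          define L where "L = ln (V \<omega>)"
          define z where "z = (x i - s0) * of_real L"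
          have V_exp: "V \<omega> powr r = exp (r * L)" for r using elim by (simp add: powr_def L_def)
          have "complex_of_real (V \<omega>) powr x i - complex_of_real (V \<omega>) powr s0 = complex_of_real (V \<omega>) powr s0 * (exp z - 1)"
            using elim by (simp add: powr_def Ln_of_real z_def L_def algebra_simps exp_add[symmetric])
          then have "norm (q i \<omega>) = V \<omega> powr Re s0 * norm (exp z - 1) / norm (x i - s0)"
            using norm_eq[OF elim] by (simp add: q_def norm_divide norm_mult)
          also have "norm (exp z - 1) \<le> exp (norm z) * norm z"
          proof -
            have "norm (exp z - 1) \<le> exp \<bar>Re z\<bar> * norm z" using Taylor_exp[of z 0] by simp
            also have "\<dots> \<le> exp (norm z) * norm z" by (intro mult_right_mono) (auto simp: abs_Re_le_cmod)
            finally show ?thesis .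
          qed
          then have "V \<omega> powr Re s0 * norm (exp z - 1) / norm (x i - s0) \<le> V \<omega> powr Re s0 * (exp (norm z) * norm z) / norm (x i - s0)"
            by (intro divide_right_mono mult_left_mono) auto
          also have "\<dots> = V \<omega> powr Re s0 * (exp (norm z) * \<bar>L\<bar>)"
            using x(2)[of i] by (simp add: z_def norm_mult)
          also have "exp (norm z) * \<bar>L\<bar> \<le> 1 / \<epsilon> * exp (2 * \<epsilon> * \<bar>L\<bar>)"
          proof -
            have "norm z \<le> \<epsilon> * \<bar>L\<bar>" unfolding z_def norm_mult norm_of_real by (rule mult_right_mono[OF less_imp_le[OF x(1)] abs_ge_zero])
            then have "exp (norm z) \<le> exp (\<epsilon> * \<bar>L\<bar>)" by simp
            moreover have "\<bar>L\<bar> \<le> 1 / \<epsilon> * exp (\<epsilon> * \<bar>L\<bar>)"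
            proof -
              have "\<epsilon> * \<bar>L\<bar> \<le> exp (\<epsilon> * \<bar>L\<bar>)" using exp_ge_add_one_self[of "\<epsilon> * \<bar>L\<bar>"] by linarith
              then show ?thesis using \<epsilon> by (simp add: field_simps)
            qed
            ultimately have "exp (norm z) * \<bar>L\<bar> \<le> exp (\<epsilon> * \<bar>L\<bar>) * (1 / \<epsilon> * exp (\<epsilon> * \<bar>L\<bar>))"
              by (intro mult_mono) auto
            also have "\<dots> = 1 / \<epsilon> * exp (2 * \<epsilon> * \<bar>L\<bar>)" by (simp add: exp_add[symmetric])
            finally show ?thesis .
          qed
          then have "V \<omega> powr Re s0 * (exp (norm z) * \<bar>L\<bar>) \<le> V \<omega> powr Re s0 * (1 / \<epsilon> * exp (2 * \<epsilon> * \<bar>L\<bar>))"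
            by (intro mult_left_mono) auto
          also have "\<dots> = 1 / \<epsilon> * exp (Re s0 * L + 2 * \<epsilon> * \<bar>L\<bar>)" by (simp add: V_exp exp_add)
          also have "\<dots> \<le> w \<omega>"
          proof -
            have "exp (Re s0 * L + 2 * \<epsilon> * \<bar>L\<bar>) \<le> exp ((Re s0 + 2 * \<epsilon>) * L) + exp ((Re s0 - 2 * \<epsilon>) * L)"
              by (cases "0 \<le> L") (auto simp: algebra_simps add_increasing add_increasing2)
            then show ?thesis unfolding w_def V_exp using \<epsilon> by (intro mult_left_mono) auto
          qed
          finally show ?case .
        qed
      qed
      moreover have "(\<integral>\<omega>. q i \<omega> \<partial>M) = ((\<integral>\<omega>. complex_of_real (V \<omega>) powr x i \<partial>M) - (\<integral>\<omega>. complex_of_real (V \<omega>) powr s0 \<partial>M)) / (x i - s0)" for i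
        unfolding q_def using int[of "x i"] int[of s0] xs[of i] s0 by simp
      ultimately have "(\<lambda>i. ((\<integral>\<omega>. complex_of_real (V \<omega>) powr x i \<partial>M) - (\<integral>\<omega>. complex_of_real (V \<omega>) powr s0 \<partial>M)) / (x i - s0)) \<longlonglongrightarrow> D" by simp
      then show "(\<lambda>i. ((\<integral>\<omega>. complex_of_real (V \<omega>) powr X i \<partial>M) - (\<integral>\<omega>. complex_of_real (V \<omega>) powr s0 \<partial>M)) / (X i - s0)) \<longlonglongrightarrow> D"
        unfolding x_def by (rule LIMSEQ_offset)
    qed
    then show ?thesis by (auto simp: has_field_derivative_iff)
  qed
  ultimately show "(\<lambda>s. \<integral>\<omega>. complex_of_real (V \<omega>) powr s \<partial>M) holomorphic_on {s. a < Re s \<and> Re s < b}"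
    by (subst holomorphic_on_open) auto
qed

section \<open>The candidate function: recurrence and lower bound\<close>

locale mellin_candidate =
  fixes \<delta> \<beta> \<gamma> \<beta>' \<gamma>' :: real
  assumes \<delta>: "0 < \<delta>" and \<beta>: "\<beta> \<le> 1" and \<gamma>: "0 < \<gamma>" and \<beta>': "0 < \<beta>'" and \<gamma>': "0 < \<gamma>'" "\<gamma>' < 1"
begin

abbreviation G :: "complex \<Rightarrow> complex" where
  "G z \<equiv> double_gamma z \<delta>"

definition f :: "complex \<Rightarrow> complex" where
  "f s = Gamma s * mellin_M 1 \<delta> \<beta> \<gamma> \<beta>' \<gamma>' s"

lemma f_eq: "f s = Gamma s * (G (of_real ((1 - \<beta>) * \<delta>) + s) / G (of_real ((1 - \<beta> + \<gamma>) * \<delta>) + s))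
       * (G (of_real ((\<beta>' + \<gamma>') * \<delta>) + 1 - s) / G (of_real (\<beta>' * \<delta>) + 1 - s))"
  by (simp add: f_def mellin_M_def)

lemma params: "0 \<le> (1 - \<beta>) * \<delta>" "(1 - \<beta>) * \<delta> \<le> (1 - \<beta> + \<gamma>) * \<delta>" "0 < \<beta>' * \<delta>"
    "\<beta>' * \<delta> < (\<beta>' + \<gamma>') * \<delta>" "(\<beta>' + \<gamma>') * \<delta> < \<beta>' * \<delta> + \<delta>"
  using \<delta> \<beta> \<gamma> \<beta>' \<gamma>' by (auto simp: algebra_simps)

lemma G_nonzero:
  assumes "0 < Re s" "Re s < 1 + \<beta>' * \<delta>"
  shows "G (of_real ((1 - \<beta>) * \<delta>) + s) \<noteq> 0" "G (of_real ((1 - \<beta> + \<gamma>) * \<delta>) + s) \<noteq> 0"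
    "G (of_real ((\<beta>' + \<gamma>') * \<delta>) + 1 - s) \<noteq> 0" "G (of_real (\<beta>' * \<delta>) + 1 - s) \<noteq> 0"
proof -
  have *: "0 < Re (of_real ((1 - \<beta>) * \<delta>) + s)" "0 < Re (of_real ((1 - \<beta> + \<gamma>) * \<delta>) + s)"
    "0 < Re (of_real ((\<beta>' + \<gamma>') * \<delta>) + 1 - s)" "0 < Re (of_real (\<beta>' * \<delta>) + 1 - s)"
    unfolding plus_complex.sel minus_complex.sel Re_complex_of_real one_complex.sel using assms params by linarith+
  show "G (of_real ((1 - \<beta>) * \<delta>) + s) \<noteq> 0" "G (of_real ((1 - \<beta> + \<gamma>) * \<delta>) + s) \<noteq> 0"
    "G (of_real ((\<beta>' + \<gamma>') * \<delta>) + 1 - s) \<noteq> 0" "G (of_real (\<beta>' * \<delta>) + 1 - s) \<noteq> 0"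
    by (rule double_gamma_nonzero[OF \<delta>], rule *)+
qed

lemma f_nonzero:
  assumes "0 < Re s" "Re s < 1 + \<beta>' * \<delta>"
  shows "f s \<noteq> 0"
  using G_nonzero[OF assms] not_nonpos_Int_of_Re_pos[OF assms(1)] by (simp add: f_eq Gamma_eq_zero_iff)

lemma G_holomorphic_plus: "(\<lambda>s. G (a + s)) holomorphic_on A"
proof -
  have "(\<lambda>s. a + s) holomorphic_on A" by (intro holomorphic_intros)
  from holomorphic_on_compose[OF this double_gamma_holomorphic[OF \<delta>]] show ?thesis by (simp add: o_def)
qed

lemma G_holomorphic_minus: "(\<lambda>s. G (a - s)) holomorphic_on A"
proof -
  have "(\<lambda>s. a - s) holomorphic_on A" by (intro holomorphic_intros)
  from holomorphic_on_compose[OF this double_gamma_holomorphic[OF \<delta>]] show ?thesis by (simp add: o_def)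
qed

lemma f_holomorphic: "f holomorphic_on {s. 0 < Re s \<and> Re s < 1 + \<beta>' * \<delta>}"
  unfolding f_eq[abs_def]
  by (intro holomorphic_on_mult holomorphic_on_divide G_holomorphic_plus G_holomorphic_minus holomorphic_Gamma)
     (use G_nonzero not_nonpos_Int_of_Re_pos in auto)

lemma Gamma_mellin_M_meromorphic: "(\<lambda>s. Gamma s * mellin_M C \<delta> \<beta> \<gamma> \<beta>' \<gamma>' s) meromorphic_on UNIV"
proof -
  have hol_mer: "g meromorphic_on UNIV" if "g holomorphic_on UNIV" for g :: "complex \<Rightarrow> complex"
    using that by (intro analytic_on_imp_meromorphic_on) (simp add: analytic_on_open)
  have "(\<lambda>s. inverse (rGamma s)) meromorphic_on (UNIV :: complex set)"
    by (intro meromorphic_on_inverse hol_mer holomorphic_rGamma)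
  then have meromorphic_Gamma: "Gamma meromorphic_on (UNIV :: complex set)"
    by (simp add: Gamma_def[abs_def])
  show ?thesis
    unfolding mellin_M_def
    by (intro meromorphic_on_mult meromorphic_on_divide hol_mer G_holomorphic_plus G_holomorphic_minus
          meromorphic_on_const meromorphic_Gamma)
qed

text \<open>This is -\<psi>(-x), the negative of the hypergeometric exponent; for 0 < x < \<beta>'
  all four arguments of \<Gamma> are positive.\<close>

definition ratio :: "real \<Rightarrow> real" where
  "ratio x = Gamma (1 - \<beta> + \<gamma> + x) / Gamma (1 - \<beta> + x) * (Gamma (\<beta>' + \<gamma>' - x) / Gamma (\<beta>' - x))"

lemma ratio_pos: "0 < x \<Longrightarrow> x < \<beta>' \<Longrightarrow> 0 < ratio x"
  unfolding ratio_def using \<beta> \<gamma> \<gamma>' by (intro mult_pos_pos divide_pos_pos Gamma_real_pos) auto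

text \<open>Replacing s by s + 1 shifts the first two arguments of G up and the last two down by 1.
  The resulting \<Gamma>-values at arguments divided by \<delta> form the reciprocal of
  \<open>ratio (s / \<delta>)\<close>, and the factor s comes from \<Gamma>(s).\<close>

lemma f_shift:
  assumes s: "0 < s" "s < \<beta>' * \<delta>"
  shows "f (of_real s + 1) = of_real (s / ratio (s / \<delta>)) * f (of_real s)"
proof -
  have sd: "0 < s / \<delta>" "s / \<delta> < \<beta>'" using s \<delta> by (auto simp: divide_less_eq)
  have Gs: "G (of_real (a * \<delta>) + (of_real s + 1)) = of_real (Gamma (a + s / \<delta>)) * G (of_real (a * \<delta>) + of_real s)" if "0 \<le> a" for a
  proof -
    have "G ((of_real (a * \<delta>) + of_real s) + 1) = Gamma ((of_real (a * \<delta>) + of_real s) / of_real \<delta>) * G (of_real (a * \<delta>) + of_real s)"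
      by (rule double_gamma_plus1[OF \<delta>]) (use that s \<delta> in \<open>auto intro: add_nonneg_pos\<close>)
    moreover have "(of_real (a * \<delta>) + of_real s) / of_real \<delta> = complex_of_real (a + s / \<delta>)"
      using \<delta> by (simp add: add_divide_distrib)
    ultimately show ?thesis by (simp add: Gamma_complex_of_real add.assoc del: of_real_add)
  qed
  have Gm: "G (of_real (a * \<delta>) + 1 - of_real s) = of_real (Gamma (a - s / \<delta>)) * G (of_real (a * \<delta>) + 1 - (of_real s + 1))" if "s / \<delta> < a" for a
  proof -
    have "s < a * \<delta>" using that \<delta> by (simp add: divide_less_eq)
    then have h1: "G ((of_real (a * \<delta>) - of_real s) + 1) = Gamma ((of_real (a * \<delta>) - of_real s) / of_real \<delta>) * G (of_real (a * \<delta>) - of_real s)"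
      by (intro double_gamma_plus1[OF \<delta>]) auto
    have h2: "(of_real (a * \<delta>) - of_real s) / of_real \<delta> = complex_of_real (a - s / \<delta>)"
      using \<delta> by (simp add: diff_divide_distrib)
    have h3: "of_real (a * \<delta>) - of_real s + 1 = of_real (a * \<delta>) + 1 - complex_of_real s"
      and h4: "of_real (a * \<delta>) + 1 - (complex_of_real s + 1) = of_real (a * \<delta>) - of_real s" by simp_all
    show ?thesis unfolding h4 using h1 unfolding h2 Gamma_complex_of_real unfolding h3 .
  qed
  have pos: "0 < Gamma (1 - \<beta> + s / \<delta>)" "0 < Gamma (1 - \<beta> + \<gamma> + s / \<delta>)" "0 < Gamma (\<beta>' + \<gamma>' - s / \<delta>)" "0 < Gamma (\<beta>' - s / \<delta>)"
    using sd \<beta> \<gamma> \<gamma>' by (auto intro!: Gamma_real_pos)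
  define x where "x = complex_of_real s"
  define a b d e where "a = complex_of_real (Gamma (1 - \<beta> + s / \<delta>))" and "b = complex_of_real (Gamma (1 - \<beta> + \<gamma> + s / \<delta>))"
    and "d = complex_of_real (Gamma (\<beta>' + \<gamma>' - s / \<delta>))" and "e = complex_of_real (Gamma (\<beta>' - s / \<delta>))"
  have nz: "a \<noteq> 0" "b \<noteq> 0" "d \<noteq> 0" "e \<noteq> 0" using pos by (auto simp: a_def b_def d_def e_def)
  have g1: "G (of_real ((1 - \<beta>) * \<delta>) + (x + 1)) = a * G (of_real ((1 - \<beta>) * \<delta>) + x)"
    using Gs[of "1 - \<beta>"] \<beta> by (simp only: x_def a_def)
  have g2: "G (of_real ((1 - \<beta> + \<gamma>) * \<delta>) + (x + 1)) = b * G (of_real ((1 - \<beta> + \<gamma>) * \<delta>) + x)"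
    unfolding x_def b_def by (rule Gs) (use \<beta> \<gamma> in auto)
  have g3: "G (of_real ((\<beta>' + \<gamma>') * \<delta>) + 1 - x) = d * G (of_real ((\<beta>' + \<gamma>') * \<delta>) + 1 - (x + 1))"
    unfolding x_def d_def by (rule Gm) (use sd \<gamma>' in auto)
  have g4: "G (of_real (\<beta>' * \<delta>) + 1 - x) = e * G (of_real (\<beta>' * \<delta>) + 1 - (x + 1))"
    unfolding x_def e_def by (rule Gm) (use sd in auto)
  have g5: "Gamma (x + 1) = x * Gamma x"
    unfolding x_def by (rule Gamma_plus1) (use s not_nonpos_Int_of_Re_pos[of "of_real s"] in auto)
  have r: "complex_of_real (s / ratio (s / \<delta>)) = x * (a / b) * (e / d)"
    by (simp add: ratio_def x_def a_def b_def d_def e_def)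
  have "f (x + 1) = x * Gamma x * (a * G (of_real ((1 - \<beta>) * \<delta>) + x) / (b * G (of_real ((1 - \<beta> + \<gamma>) * \<delta>) + x)))
     * (G (of_real ((\<beta>' + \<gamma>') * \<delta>) + 1 - (x + 1)) / G (of_real (\<beta>' * \<delta>) + 1 - (x + 1)))"
    unfolding f_eq g1 g2 g5 ..
  also have "\<dots> = x * (a / b) * (e / d) * f x"
  proof -
    have "x * g * (a * p / (b * q)) * (u / v) = x * (a / b) * (e / d) * (g * (p / q) * ((d * u) / (e * v)))" for g p q u v
      using nz by (simp add: mult_ac)
    then show ?thesis unfolding f_eq g3 g4 .
  qed
  finally show ?thesis by (simp only: r x_def)
qed

lemma f_lower_bound:
  assumes c: "0 < c" "c < \<beta>' * \<delta>"
  obtains \<kappa> where "\<kappa> > 0" "\<And>s. c \<le> Re s \<Longrightarrow> Re s \<le> c + 1 \<Longrightarrow> norm (f s) \<ge> \<kappa> * exp (- (3 / 2 * pi * \<bar>Im s\<bar>))"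
proof -
  define A B D E where "A = (1 - \<beta>) * \<delta>" and "B = (1 - \<beta> + \<gamma>) * \<delta>" and "D = (\<beta>' + \<gamma>') * \<delta>" and "E = \<beta>' * \<delta>"
  have par: "0 \<le> A" "A \<le> B" "0 < E" "E < D" "D < E + \<delta>" using params by (simp_all add: A_def B_def D_def E_def)
  \<comment> \<open>The product of the constants in the two lower bounds for G-quotients. It is
    positive and continuous in the abscissa, hence bounded away from 0 on [c, c + 1].\<close>
  define r where "r \<sigma> = norm (G (of_real (A + \<sigma>))) / norm (G (of_real (B + \<sigma>))) *
    (norm (G (of_real (D + 1 - \<sigma>))) / norm (G (of_real (E + 1 - \<sigma> + \<delta>)))
       * ((2 * pi) powr ((\<delta> - 1) / 2) * \<delta> powr (1 / 2 - (E + 1 - \<sigma>))))" for \<sigma>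
  have Gnz: "G (of_real x) \<noteq> 0" if "0 < x" for x using double_gamma_nonzero[OF \<delta>, of "of_real x"] that by simp
  have Gcont: "continuous_on X (\<lambda>\<sigma>. G (of_real (g \<sigma>)))" if "continuous_on X g" for X and g :: "real \<Rightarrow> real"
    using that holomorphic_on_imp_continuous_on[OF double_gamma_holomorphic[OF \<delta>, of UNIV]]
    by (auto intro!: continuous_on_compose2[where s=X and t=UNIV and f="\<lambda>\<sigma>. complex_of_real (g \<sigma>)"] continuous_on_of_real)
  have rcont: "continuous_on {c..c+1} r"
    unfolding r_def using par c \<delta> Gnz
    by (intro continuous_intros Gcont) (auto simp: E_def simp del: of_real_add of_real_diff)
  have rpos: "0 < r \<sigma>" if "\<sigma> \<in> {c..c+1}" for \<sigma>
    unfolding r_def using par c \<delta> that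
    by (intro mult_pos_pos divide_pos_pos) (auto simp: E_def Gnz simp del: of_real_add of_real_diff)
  obtain \<sigma>0 where \<sigma>0: "\<sigma>0 \<in> {c..c+1}" "\<And>\<sigma>. \<sigma> \<in> {c..c+1} \<Longrightarrow> r \<sigma>0 \<le> r \<sigma>"
    using continuous_attains_inf[OF compact_Icc _ rcont] by auto
  obtain k1 where k1: "k1 > 0" "\<And>t x. c \<le> x \<Longrightarrow> x \<le> c + 1 \<Longrightarrow> norm (Gamma (Complex x t)) \<ge> k1 * exp (- pi * \<bar>t\<bar> / 2) / (1 + \<bar>t\<bar>)"
    using norm_Gamma_lower_bound[of c "c + 1"] c by auto
  obtain k2 where k2: "k2 > 0" "\<And>t x. E - c \<le> x \<Longrightarrow> x \<le> E - c + 1 \<Longrightarrow> norm (Gamma (Complex x t)) \<ge> k2 * exp (- pi * \<bar>t\<bar> / 2) / (1 + \<bar>t\<bar>)"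
    using norm_Gamma_lower_bound[of "E - c" "E - c + 1"] c by (auto simp: E_def)
  define \<kappa> where "\<kappa> = k1 * r \<sigma>0 * k2 * (pi / 4)\<^sup>2"
  have "\<kappa> > 0" using k1 k2 rpos[OF \<sigma>0(1)] by (simp add: \<kappa>_def)
  moreover have "norm (f s) \<ge> \<kappa> * exp (- (3 / 2 * pi * \<bar>Im s\<bar>))" if s: "c \<le> Re s" "Re s \<le> c + 1" for s
  proof -
    define \<sigma> t where "\<sigma> = Re s" and "t = Im s"
    have st: "s = Complex \<sigma> t" by (simp add: \<sigma>_def t_def complex_eq_iff)
    have \<sigma>: "c \<le> \<sigma>" "\<sigma> \<le> c + 1" "0 < \<sigma>" using s c by (auto simp: \<sigma>_def)
    define x where "x = E + 1 - \<sigma>"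
    have x: "0 < x" "E - c \<le> x" "x \<le> E - c + 1" using \<sigma> c by (auto simp: x_def E_def)
    define g1 where "g1 = norm (Gamma (Complex \<sigma> t))"
    define g2 where "g2 = norm (Gamma (Complex x (- t)))"
    define r1 where "r1 = norm (G (of_real (A + \<sigma>))) / norm (G (of_real (B + \<sigma>)))"
    define r2 where "r2 = norm (G (of_real (D + 1 - \<sigma>))) / norm (G (of_real (x + \<delta>)))
       * ((2 * pi) powr ((\<delta> - 1) / 2) * \<delta> powr (1 / 2 - x))"
    have q1: "norm (G (of_real A + s) / G (of_real B + s)) \<ge> r1"
    proof -
      have "of_real A + s = Complex (A + \<sigma>) t" "of_real B + s = Complex (B + \<sigma>) t" by (auto simp: st complex_eq_iff)
      then show ?thesis unfolding r1_def using double_gamma_quotient_lower_bound[OF \<delta>, of "A + \<sigma>" "B + \<sigma>" t] par \<sigma> by simp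
    qed
    \<comment> \<open>Here \<open>D < E + \<delta>\<close>, that is \<gamma>' < 1, keeps the
      numerator within one period \<delta> of the denominator, as the comparison requires.\<close>
    have q2: "norm (G (of_real D + 1 - s) / G (of_real E + 1 - s)) \<ge> r2 * g2"
    proof -
      have "of_real D + 1 - s = Complex (D + 1 - \<sigma>) (- t)" "of_real E + 1 - s = Complex x (- t)" by (auto simp: st x_def complex_eq_iff)
      then show ?thesis unfolding r2_def g2_def
        using double_gamma_quotient_lower_bound'[OF \<delta> x(1), of "D + 1 - \<sigma>" "- t"] par x by (simp add: x_def)
    qed
    have r12: "r1 * r2 = r \<sigma>" by (simp add: r1_def r2_def r_def x_def)
    have r1n: "0 \<le> r1" "0 \<le> r2" by (auto simp: r1_def r2_def)
    have "norm (f s) = g1 * norm (G (of_real A + s) / G (of_real B + s)) * norm (G (of_real D + 1 - s) / G (of_real E + 1 - s))"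
      by (simp only: f_eq norm_mult g1_def A_def B_def D_def E_def st)
    also have "\<dots> \<ge> g1 * r1 * (r2 * g2)"
      using q1 q2 r1n by (intro mult_mono mult_nonneg_nonneg) (auto simp: g1_def g2_def)
    finally have n1: "norm (f s) \<ge> r \<sigma> * (g1 * g2)" by (simp add: r12[symmetric] mult_ac)
    define u where "u = exp (- pi * \<bar>t\<bar> / 2) / (1 + \<bar>t\<bar>)"
    have u: "0 \<le> u" by (simp add: u_def)
    have "g1 \<ge> k1 * u" using k1(2)[OF \<sigma>(1,2), of t] by (simp add: g1_def u_def)
    moreover have "g2 \<ge> k2 * u" using k2(2)[OF x(2,3), of "- t"] by (simp add: g2_def u_def)
    ultimately have p1: "(k1 * u) * (k2 * u) \<le> g1 * g2" using k1 k2 u by (intro mult_mono) (auto simp: g1_def)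
    have p2: "r \<sigma>0 \<le> r \<sigma>" using \<sigma>0(2) \<sigma> by auto
    have "r \<sigma>0 * ((k1 * u) * (k2 * u)) \<le> r \<sigma> * (g1 * g2)"
      by (rule mult_mono[OF p2 p1]) (use rpos[of \<sigma>] \<sigma> k1(1) k2(1) u in auto)
    then have n2: "norm (f s) \<ge> k1 * r \<sigma>0 * k2 * u\<^sup>2" using n1 by (simp add: power2_eq_square mult_ac)
    \<comment> \<open>The loss \<open>1 + \<bar>t\<bar>\<close> is paid for with exp(\<pi> |t| / 4):
      since \<pi> / 4 < 1, \<open>pi / 4 * (1 + \<bar>t\<bar>) \<le> 1 + pi / 4 * \<bar>t\<bar>
      \<le> exp (pi / 4 * \<bar>t\<bar>)\<close>. After squaring, the rate is 3 \<pi> / 2.\<close>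
    have "pi / 4 * exp (- (3 / 4 * pi * \<bar>t\<bar>)) \<le> u"
    proof -
      have "pi / 4 * (1 + \<bar>t\<bar>) \<le> 1 + pi / 4 * \<bar>t\<bar>" using pi_less_4 by (simp add: distrib_left)
      also have "\<dots> \<le> exp (pi / 4 * \<bar>t\<bar>)" by (rule exp_ge_add_one_self)
      finally have "pi / 4 * (1 + \<bar>t\<bar>) * exp (- (3 / 4 * pi * \<bar>t\<bar>)) \<le> exp (pi / 4 * \<bar>t\<bar>) * exp (- (3 / 4 * pi * \<bar>t\<bar>))"
        by (rule mult_right_mono) simp
      also have "\<dots> = exp (- pi * \<bar>t\<bar> / 2)" by (simp add: exp_add[symmetric])
      finally show ?thesis by (simp add: u_def pos_le_divide_eq mult_ac)
    qed
    then have "(pi / 4 * exp (- (3 / 4 * pi * \<bar>t\<bar>)))\<^sup>2 \<le> u\<^sup>2" by (intro power_mono) auto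
    moreover have "(pi / 4 * exp (- (3 / 4 * pi * \<bar>t\<bar>)))\<^sup>2 = (pi / 4)\<^sup>2 * exp (- (3 / 2 * pi * \<bar>t\<bar>))"
    proof -
      have "(exp (- (3 / 4 * pi * \<bar>t\<bar>)))\<^sup>2 = exp (2 * (- (3 / 4 * pi * \<bar>t\<bar>)))" by (rule exp_double[symmetric])
      then show ?thesis by (simp only: power_mult_distrib) simp
    qed
    ultimately have "(k1 * r \<sigma>0 * k2) * ((pi / 4)\<^sup>2 * exp (- (3 / 2 * pi * \<bar>t\<bar>))) \<le> (k1 * r \<sigma>0 * k2) * u\<^sup>2"
      using k1 k2 rpos[OF \<sigma>0(1)] by (intro mult_left_mono) auto
    then show ?thesis using n2 by (simp only: \<kappa>_def t_def mult.assoc)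
  qed
  ultimately show ?thesis by (rule that)
qed

end

lemma hypergeometric_exponent_of_real:
  fixes \<delta> c :: real
  assumes "\<delta> > 0" "\<beta> \<le> 1" "0 < \<gamma>" "0 < \<gamma>'" "\<gamma>' < 1" "0 < c" "c < \<beta>'"
  shows "hypergeometric_exponent \<beta> \<gamma> \<beta>' \<gamma>' (of_real (- c)) = of_real (- mellin_candidate.ratio \<beta> \<gamma> \<beta>' \<gamma>' c)"
proof -
  interpret mellin_candidate \<delta> \<beta> \<gamma> \<beta>' \<gamma>' by unfold_locales (use assms in auto)
  have a: "complex_of_real (1 - \<beta> + \<gamma>) - of_real (- c) = of_real (1 - \<beta> + \<gamma> + c)"
    "complex_of_real (1 - \<beta>) - of_real (- c) = of_real (1 - \<beta> + c)"
    "complex_of_real (\<beta>' + \<gamma>') + of_real (- c) = of_real (\<beta>' + \<gamma>' - c)"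
    "complex_of_real \<beta>' + of_real (- c) = of_real (\<beta>' - c)" by simp_all
  show ?thesis
    unfolding hypergeometric_exponent_def a Gamma_complex_of_real rGamma_complex_of_real ratio_def
    by (simp add: rGamma_inverse_Gamma divide_inverse)
qed

text \<open>The recurrences are proved for real arguments, where moments can be compared as extended
  nonnegative numbers; the identity theorem carries them to the strip.\<close>

lemma strip_identity:
  fixes f g :: "complex \<Rightarrow> complex"
  assumes "f holomorphic_on {s. 0 < Re s \<and> Re s < h}" "g holomorphic_on {s. 0 < Re s \<and> Re s < h}"
    and eq: "\<And>x. 0 < x \<Longrightarrow> x < h \<Longrightarrow> f (of_real x) = g (of_real x)" and h: "0 < h"
    and s: "0 < Re s" "Re s < h"
  shows "f s = g s"
proof -
  let ?S = "{s. 0 < Re s \<and> Re s < h}"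
  have "f s - g s = 0"
  proof (rule analytic_continuation[where f="\<lambda>z. f z - g z" and S="?S" and U="of_real ` {0<..<h}" and \<xi>="of_real (h / 2)"])
    show "(\<lambda>z. f z - g z) holomorphic_on ?S" by (intro holomorphic_intros assms)
    show "open ?S" by (intro open_Collect_conj open_Collect_less continuous_intros)
    have "?S = {s. 0 < Re s} \<inter> {s. Re s < h}" by auto
    then have "convex ?S" by (simp add: convex_Int convex_halfspace_Re_gt convex_halfspace_Re_lt)
    then show "connected ?S" by (rule convex_connected)
    show "complex_of_real (h / 2) islimpt complex_of_real ` {0<..<h}"
      unfolding islimpt_approachable
    proof (intro allI impI)
      fix e :: real assume e: "0 < e"
      define y where "y = h / 2 + min (e / 2) (h / 4)"
      have "y \<in> {0<..<h}" "y \<noteq> h / 2" "\<bar>y - h / 2\<bar> < e" using e h by (auto simp: y_def min_def)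
      then show "\<exists>x'\<in>of_real ` {0<..<h}. x' \<noteq> complex_of_real (h / 2) \<and> dist x' (complex_of_real (h / 2)) < e"
        by (intro bexI[of _ "complex_of_real y"]) (auto simp: dist_of_real dist_real_def simp del: of_real_divide)
    qed
  qed (use h s eq in auto)
  then show ?thesis by simp
qed

text \<open>The quotient of the Mellin transform and the candidate is periodic and grows more slowly than
  \<open>exp (2 \<pi> \<bar>Im s\<bar>)\<close>, hence constant.\<close>

lemma (in mellin_candidate) mellin_transform_unique:
  fixes m :: "complex \<Rightarrow> complex"
  assumes hol: "m holomorphic_on {s. 0 < Re s \<and> Re s < 1 + \<beta>' * \<delta>}"
    and rec: "\<And>s. 0 < s \<Longrightarrow> s < \<beta>' * \<delta> \<Longrightarrow> m (of_real s + 1) = of_real (s / ratio (s / \<delta>)) * m (of_real s)"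
    and bound: "\<And>c. 0 < c \<Longrightarrow> c < \<beta>' * \<delta> \<Longrightarrow> \<exists>K. \<forall>s. c \<le> Re s \<longrightarrow> Re s \<le> c + 1 \<longrightarrow> norm (m s) \<le> K"
  obtains w where "\<And>s. 0 < Re s \<Longrightarrow> Re s < 1 + \<beta>' * \<delta> \<Longrightarrow> m s = w * f s"
proof -
  let ?h = "\<beta>' * \<delta>"
  have h: "0 < ?h" using params by simp
  define F where "F s = m s / f s" for s
  have F_hol: "F holomorphic_on {s. 0 < Re s \<and> Re s < 1 + ?h}"
    unfolding F_def by (intro holomorphic_on_divide hol f_holomorphic) (auto dest: f_nonzero)
  have F_real: "F (of_real s + 1) = F (of_real s)" if "0 < s" "s < ?h" for s
  proof -
    have "s / \<delta> < \<beta>'" using that \<delta> by (simp add: divide_less_eq)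
    then have "complex_of_real (s / ratio (s / \<delta>)) \<noteq> 0" using ratio_pos[of "s / \<delta>"] that \<delta> by simp
    then show ?thesis unfolding F_def rec[OF that] f_shift[OF that] by simp
  qed
  have per: "F (s + 1) = F s" if "0 < Re s" "Re s < ?h" for s
  proof (rule strip_identity[OF _ _ _ h that, where f="\<lambda>s. F (s + 1)"])
    show "F holomorphic_on {s. 0 < Re s \<and> Re s < ?h}"
      by (rule holomorphic_on_subset[OF F_hol]) auto
    have "(F \<circ> (\<lambda>s. s + 1)) holomorphic_on {s. 0 < Re s \<and> Re s < ?h}"
      by (rule holomorphic_on_compose_gen[OF _ F_hol]) (auto intro: holomorphic_intros)
    then show "(\<lambda>s. F (s + 1)) holomorphic_on {s. 0 < Re s \<and> Re s < ?h}" by (simp add: o_def)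
  qed (rule F_real)
  define c where "c = ?h / 2"
  have c: "0 < c" "c < ?h" using h by (auto simp: c_def)
  obtain K where K: "\<And>s. c \<le> Re s \<Longrightarrow> Re s \<le> c + 1 \<Longrightarrow> norm (m s) \<le> K" using bound[OF c] by blast
  obtain \<kappa> where \<kappa>: "\<kappa> > 0" "\<And>s. c \<le> Re s \<Longrightarrow> Re s \<le> c + 1 \<Longrightarrow> norm (f s) \<ge> \<kappa> * exp (- (3 / 2 * pi * \<bar>Im s\<bar>))"
    using f_lower_bound[OF c] by blast
  have F_bound: "norm (F s) \<le> (K / \<kappa>) * exp (3 / 2 * pi * \<bar>Im s\<bar>)" if s: "c \<le> Re s" "Re s \<le> c + 1" for s
  proof -
    have "norm (F s) = norm (m s) / norm (f s)" by (simp add: F_def norm_divide)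
    also have "\<dots> \<le> K / (\<kappa> * exp (- (3 / 2 * pi * \<bar>Im s\<bar>)))"
      using K[OF s] \<kappa>(2)[OF s] \<kappa>(1) by (intro frac_le) (auto intro: order_trans[OF norm_ge_zero])
    also have "\<dots> = (K / \<kappa>) * exp (3 / 2 * pi * \<bar>Im s\<bar>)" by (simp add: exp_minus field_simps)
    finally show ?thesis .
  qed
  obtain w where w: "\<And>s. 0 < Re s \<Longrightarrow> Re s < 1 + ?h \<Longrightarrow> F s = w"
    using periodic_on_strip_constant[OF F_hol h per c F_bound] by blast
  have "m s = w * f s" if "0 < Re s" "Re s < 1 + ?h" for s
    using w[OF that] f_nonzero[OF that] by (simp add: F_def field_simps)
  then show ?thesis by (rule that)
qed

section \<open>Identification of the Mellin transform of the exponential functional\<close>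

theorem theorem2:
  fixes M :: "'a measure" and X :: "real \<Rightarrow> 'a \<Rightarrow> real" and \<zeta> :: "'a \<Rightarrow> ennreal"
    and \<alpha> \<delta> \<beta> \<gamma> \<beta>' \<gamma>' :: real
  assumes "\<alpha> > 0" and "\<delta> = 1 / \<alpha>"
    and "\<beta> \<le> 1" and "0 < \<gamma>" and "\<gamma> < 1" and "\<beta>' > 0" and "0 < \<gamma>'" and "\<gamma>' < 1"
    and "hypergeometric_levy_process M X \<zeta> \<beta> \<gamma> \<beta>' \<gamma>'"
  shows "(AE \<omega> in M. exp_functional \<alpha> X \<zeta> \<omega> < \<infinity>) \<and>
    (\<exists>C. mellin_M C \<delta> \<beta> \<gamma> \<beta>' \<gamma>' 1 = 1 \<and>
      (\<forall>s. 0 < Re s \<and> Re s < 1 + \<beta>' * \<delta> \<longrightarrow>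
         has_bochner_integral M
           (\<lambda>\<omega>. complex_of_real (enn2real (exp_functional \<alpha> X \<zeta> \<omega>)) powr (s - 1))
           (Gamma s * mellin_M C \<delta> \<beta> \<gamma> \<beta>' \<gamma>' s)) \<and>
      (\<lambda>s. Gamma s * mellin_M C \<delta> \<beta> \<gamma> \<beta>' \<gamma>' s) meromorphic_on UNIV)"
proof -
  have \<delta>: "0 < \<delta>" using assms by simp
  interpret mellin_candidate \<delta> \<beta> \<gamma> \<beta>' \<gamma>' by unfold_locales (use assms \<delta> in auto)
  have killed: "killed_levy_process M X \<zeta>"
    and lap: "has_laplace_exponent M X \<zeta> (hypergeometric_exponent \<beta> \<gamma> \<beta>' \<gamma>') {z. - (\<beta>' + \<gamma>') < Re z \<and> Re z < 1 - \<beta> + \<gamma>}"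
    using assms(9) by (auto simp: hypergeometric_levy_process_def)
  obtain Y q where Y: "levy_process M Y" "0 \<le> q" "\<zeta> \<in> borel_measurable M"
    "\<forall>t\<ge>0. measure M {\<omega> \<in> space M. ennreal t < \<zeta> \<omega>} = exp (- q * t)"
    "prob_space.indep_set M
          (sets (vimage_algebra (space M) (\<lambda>\<omega>. \<lambda>t\<in>{0..}. Y t \<omega>) (Pi\<^sub>M {0..} (\<lambda>_. borel))))
          (sets (vimage_algebra (space M) \<zeta> borel))"
    and XY: "\<And>\<omega> t. \<omega> \<in> space M \<Longrightarrow> 0 \<le> t \<Longrightarrow> ennreal t < \<zeta> \<omega> \<Longrightarrow> X t \<omega> = Y t \<omega>"
    using killed unfolding killed_levy_process_def by blast
  interpret levy M Y by unfold_locales (rule Y(1))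
  interpret killed_levy M Y \<zeta> q by unfold_locales (use Y in auto)
  \<comment> \<open>The value \<psi>(-c). The strip of the Laplace exponent extends to the left of
    -\<beta>', so every c in (0, \<beta>') is admissible.\<close>
  define \<Psi> where "\<Psi> c = - ratio c" for c
  have laplace: "(\<integral>\<^sup>+\<omega>. indicator {\<omega>. 1 < \<zeta> \<omega>} \<omega> * ennreal (exp (- c * Y 1 \<omega>)) \<partial>M) = ennreal (exp (\<Psi> c))"
    if c: "0 < c" "c < \<beta>'" for c
  proof -
    define g where "g \<omega> = (if 1 < \<zeta> \<omega> then exp (- c * X 1 \<omega>) else 0)" for \<omega>
    have "has_bochner_integral M (\<lambda>\<omega>. if 1 < \<zeta> \<omega> then exp (of_real (- c) * complex_of_real (X 1 \<omega>)) else 0)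
       (exp (hypergeometric_exponent \<beta> \<gamma> \<beta>' \<gamma>' (of_real (- c))))"
    proof -
      have "of_real (- c) \<in> {z. - (\<beta>' + \<gamma>') < Re z \<and> Re z < 1 - \<beta> + \<gamma>}" using c assms by simp
      then show ?thesis using lap unfolding has_laplace_exponent_def by blast
    qed
    also have "hypergeometric_exponent \<beta> \<gamma> \<beta>' \<gamma>' (of_real (- c)) = of_real (\<Psi> c)"
      unfolding \<Psi>_def using assms \<delta> c by (intro hypergeometric_exponent_of_real) auto
    also have "(\<lambda>\<omega>. if 1 < \<zeta> \<omega> then exp (of_real (- c) * complex_of_real (X 1 \<omega>)) else 0) = (\<lambda>\<omega>. complex_of_real (g \<omega>))"
      by (auto simp: g_def fun_eq_iff exp_of_real[symmetric])
    also have "exp (complex_of_real (\<Psi> c)) = of_real (exp (\<Psi> c))" by (rule exp_of_real)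
    finally have b: "has_bochner_integral M (\<lambda>\<omega>. complex_of_real (g \<omega>)) (of_real (exp (\<Psi> c)))" .
    then have "integrable M g" "integral\<^sup>L M g = exp (\<Psi> c)"
      by (auto simp: has_bochner_integral_iff complex_of_real_integrable_eq)
    then have "(\<integral>\<^sup>+\<omega>. ennreal (g \<omega>) \<partial>M) = ennreal (exp (\<Psi> c))"
      by (subst nn_integral_eq_integral) (auto simp: g_def)
    moreover have "(\<integral>\<^sup>+\<omega>. ennreal (g \<omega>) \<partial>M) = (\<integral>\<^sup>+\<omega>. indicator {\<omega>. 1 < \<zeta> \<omega>} \<omega> * ennreal (exp (- c * Y 1 \<omega>)) \<partial>M)"
      using XY[of _ 1] by (intro nn_integral_cong) (auto simp: g_def indicator_def)
    ultimately show ?thesis by simp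
  qed
  interpret negative_exponent M Y \<zeta> q \<alpha> \<beta>' \<Psi>
    by unfold_locales (use assms laplace ratio_pos in \<open>auto simp: \<Psi>_def\<close>)
  \<comment> \<open>Both integrals only involve times before \<zeta>, where X and the unkilled
    process coincide.\<close>
  have I_J: "exp_functional \<alpha> X \<zeta> \<omega> = J \<omega>" if "\<omega> \<in> space M" for \<omega>
    unfolding exp_functional_def J_def tail_def
    by (intro nn_integral_cong) (use XY[OF that] in \<open>auto simp: indicator_def Ym_def\<close>)
  define V where "V \<omega> = enn2real (J \<omega>)" for \<omega>
  have V_meas [measurable]: "V \<in> borel_measurable M" unfolding V_def[abs_def] by measurable
  have V_pos: "AE \<omega> in M. 0 < V \<omega>"
    using J_pos J_finite by eventually_elim (auto simp: V_def enn2real_positive_iff)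
  have \<alpha>\<delta>: "x / \<delta> < \<beta>' \<longleftrightarrow> x < \<beta>' * \<delta>" "\<alpha> * x = x / \<delta>" for x
    unfolding assms(2) using assms(1) by (simp_all add: field_simps)
  have V_fin: "(\<integral>\<^sup>+\<omega>. ennreal (V \<omega> powr r) \<partial>M) < \<infinity>" if "- 1 < r" "r < \<beta>' * \<delta>" for r
    using J_moment_finite[of r] that by (simp add: \<alpha>\<delta> ennpowr_def V_def)
  have V_int: "integrable M (\<lambda>\<omega>. V \<omega> powr r)" if "- 1 < r" "r < \<beta>' * \<delta>" for r
    using V_fin[OF that] by (intro integrableI_nonneg) auto
  note mellin = mellin_transform_holomorphic[OF V_meas V_pos V_fin]
  define m where "m s = (\<integral>\<omega>. complex_of_real (V \<omega>) powr (s - 1) \<partial>M)" for s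
  have m_hol: "m holomorphic_on {s. 0 < Re s \<and> Re s < 1 + \<beta>' * \<delta>}"
  proof -
    have "((\<lambda>s. \<integral>\<omega>. complex_of_real (V \<omega>) powr s \<partial>M) \<circ> (\<lambda>s. s - 1)) holomorphic_on {s. 0 < Re s \<and> Re s < 1 + \<beta>' * \<delta>}"
      by (rule holomorphic_on_compose_gen[OF _ mellin(2)]) (auto intro: holomorphic_intros)
    then show ?thesis by (simp add: m_def[abs_def] o_def)
  qed
  have m_real: "m (of_real s) = of_real (\<integral>\<omega>. V \<omega> powr (s - 1) \<partial>M)" for s
  proof -
    have "complex_of_real (V \<omega>) powr (of_real s - 1) = of_real (V \<omega> powr (s - 1))" for \<omega>
      using powr_of_real[of "V \<omega>" "s - 1"] by (simp add: V_def)
    then show ?thesis by (simp add: m_def)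
  qed
  have m_rec: "m (of_real s + 1) = of_real (s / ratio (s / \<delta>)) * m (of_real s)" if s: "0 < s" "s < \<beta>' * \<delta>" for s
  proof -
    have "(\<integral>\<^sup>+\<omega>. ennreal (V \<omega> powr s) \<partial>M) = ennreal (s / ratio (s / \<delta>)) * (\<integral>\<^sup>+\<omega>. ennreal (V \<omega> powr (s - 1)) \<partial>M)"
      using moment_recurrence[of s] s by (simp add: \<alpha>\<delta> \<Psi>_def V_def ennpowr_def)
    moreover have "(\<integral>\<^sup>+\<omega>. ennreal (V \<omega> powr r) \<partial>M) = ennreal (\<integral>\<omega>. V \<omega> powr r \<partial>M)" if "- 1 < r" "r < \<beta>' * \<delta>" for r
      using V_int[OF that] by (intro nn_integral_eq_integral) auto
    moreover have "0 < s / ratio (s / \<delta>)"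
      using s \<delta> by (intro divide_pos_pos ratio_pos) (auto simp: divide_less_eq)
    ultimately have "ennreal (\<integral>\<omega>. V \<omega> powr s \<partial>M) = ennreal (s / ratio (s / \<delta>) * (\<integral>\<omega>. V \<omega> powr (s - 1) \<partial>M))"
      using s \<open>0 < s / ratio (s / \<delta>)\<close> ennreal_mult[of "s / ratio (s / \<delta>)" "\<integral>\<omega>. V \<omega> powr (s - 1) \<partial>M"]
      by simp
    moreover have "0 \<le> s / ratio (s / \<delta>) * (\<integral>\<omega>. V \<omega> powr (s - 1) \<partial>M)"
      using \<open>0 < s / ratio (s / \<delta>)\<close> by (intro mult_nonneg_nonneg) auto
    ultimately have "(\<integral>\<omega>. V \<omega> powr s \<partial>M) = s / ratio (s / \<delta>) * (\<integral>\<omega>. V \<omega> powr (s - 1) \<partial>M)"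
      by (subst (asm) ennreal_inj) auto
    then have "complex_of_real (\<integral>\<omega>. V \<omega> powr s \<partial>M) = of_real (s / ratio (s / \<delta>)) * of_real (\<integral>\<omega>. V \<omega> powr (s - 1) \<partial>M)"
      by (simp only: of_real_mult)
    then show ?thesis using m_real[of "s + 1"] m_real[of s] by simp
  qed
  \<comment> \<open>The modulus of the integrand depends on Re s only, and for Re s in [c, c + 1] it
    is dominated by the sum of the two boundary powers, of orders c - 1 and c.\<close>
  have m_bound: "\<exists>K. \<forall>s. c \<le> Re s \<longrightarrow> Re s \<le> c + 1 \<longrightarrow> norm (m s) \<le> K" if c: "0 < c" "c < \<beta>' * \<delta>" for c
  proof (intro exI allI impI)
    fix s assume s: "c \<le> Re s" "Re s \<le> c + 1"
    have "norm (m s) \<le> (\<integral>\<omega>. norm (complex_of_real (V \<omega>) powr (s - 1)) \<partial>M)"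
      unfolding m_def by (rule integral_norm_bound)
    also have "\<dots> \<le> (\<integral>\<omega>. V \<omega> powr (c - 1) + V \<omega> powr c \<partial>M)"
    proof (rule integral_mono_AE)
      show "integrable M (\<lambda>\<omega>. norm (complex_of_real (V \<omega>) powr (s - 1)))"
        using s c by (intro integrable_norm mellin(1)) auto
      show "integrable M (\<lambda>\<omega>. V \<omega> powr (c - 1) + V \<omega> powr c)"
        using c by (intro Bochner_Integration.integrable_add V_int) auto
      show "AE \<omega> in M. norm (complex_of_real (V \<omega>) powr (s - 1)) \<le> V \<omega> powr (c - 1) + V \<omega> powr c"
        using V_pos
      proof eventually_elim
        case (elim \<omega>)
        have "norm (complex_of_real (V \<omega>) powr (s - 1)) = V \<omega> powr (Re s - 1)"
          using elim by (simp add: norm_powr_real_powr)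
        also have "\<dots> \<le> V \<omega> powr (c - 1) + V \<omega> powr c"
        proof (cases "V \<omega> \<le> 1")
          case True
          then have "V \<omega> powr (Re s - 1) \<le> V \<omega> powr (c - 1)" using elim s by (intro powr_mono') auto
          then show ?thesis using powr_ge_zero[of "V \<omega>" c] by linarith
        next
          case False
          then have "V \<omega> powr (Re s - 1) \<le> V \<omega> powr c" using s by (intro powr_mono) auto
          then show ?thesis using powr_ge_zero[of "V \<omega>" "c - 1"] by linarith
        qed
        finally show ?case .
      qed
    qed
    finally show "norm (m s) \<le> (\<integral>\<omega>. V \<omega> powr (c - 1) + V \<omega> powr c \<partial>M)" .
  qed
  obtain C where C: "\<And>s. 0 < Re s \<Longrightarrow> Re s < 1 + \<beta>' * \<delta> \<Longrightarrow> m s = C * f s"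
    using mellin_transform_unique[OF m_hol m_rec m_bound] by blast
  have Cf: "C * f s = Gamma s * mellin_M C \<delta> \<beta> \<gamma> \<beta>' \<gamma>' s" for s
    by (simp add: f_def mellin_M_def)
  \<comment> \<open>The total mass fixes the factor of proportionality, as \<Gamma>(1) = 1.
    Positivity of V matters here because \<open>0 powr 0 = 0\<close>.\<close>
  have "m 1 = 1"
  proof -
    have "m 1 = of_real (\<integral>\<omega>. V \<omega> powr 0 \<partial>M)" using m_real[of 1] by simp
    also have "(\<integral>\<omega>. V \<omega> powr 0 \<partial>M) = (\<integral>\<omega>. 1 \<partial>M)"
      using V_pos by (intro integral_cong_AE) (auto elim!: eventually_mono)
    finally show ?thesis by (simp add: prob_space)
  qed
  then have C1: "mellin_M C \<delta> \<beta> \<gamma> \<beta>' \<gamma>' 1 = 1"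
    using C[of 1] Cf[of 1] params by simp
  have bochner: "has_bochner_integral M (\<lambda>\<omega>. complex_of_real (enn2real (exp_functional \<alpha> X \<zeta> \<omega>)) powr (s - 1))
     (Gamma s * mellin_M C \<delta> \<beta> \<gamma> \<beta>' \<gamma>' s)" if s: "0 < Re s" "Re s < 1 + \<beta>' * \<delta>" for s
  proof -
    have "has_bochner_integral M (\<lambda>\<omega>. complex_of_real (V \<omega>) powr (s - 1)) (m s)"
      unfolding m_def using s by (intro has_bochner_integral_integrable mellin(1)) auto
    moreover have "m s = Gamma s * mellin_M C \<delta> \<beta> \<gamma> \<beta>' \<gamma>' s" using C[OF s] Cf by simp
    ultimately show ?thesis
      by (subst has_bochner_integral_cong[OF refl _ refl, where g="\<lambda>\<omega>. complex_of_real (V \<omega>) powr (s - 1)"])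
         (simp_all add: I_J V_def)
  qed
  have fin: "AE \<omega> in M. exp_functional \<alpha> X \<zeta> \<omega> < \<infinity>"
    using J_finite AE_space by eventually_elim (simp add: I_J)
  show ?thesis
    using fin C1 bochner Gamma_mellin_M_meromorphic[of C] by blast
qed

end
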